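(* Let $\mathcal{C}$ be a small simplicial weak cofibration category. Suppose that the following conditions are satisfied: (1) $\mathcal{C}$ has finite limits. (2) Every object in $\mathcal{C}$ is fibrant and cofibrant. (3) Every map in $\mathcal{C}$ that is a homotopy equivalence in the simplicial category $\mathcal{C}$ is also a weak equivalence. Then $\mathcal{C}$ is ind-admissible, i.e. the class $\mathrm{Lw}^{\cong}(\mathcal{W})$ of morphisms in $\mathrm{Ind}(\mathcal{C})$, where $\mathcal{W}$ is the class of weak equivalences of $\mathcal{C}$, satisfies the two out of three property.
   Context: Weak cofibration category: a category $\mathcal{C}$ with two subcategories, the cofibrations $\mathcal{C}of$ and the weak equivalences $\mathcal{W}$, each containing all isomorphisms, such that: (i) $\mathcal{C}$ has all finite colimits; (ii) $\mathcal{W}$ has the two out of three property; (iii) $\mathcal{C}of$ and $\mathcal{C}of\cap\mathcal{W}$ are closed under cobase change; (iv) every map of $\mathcal{C}$ factors as a map in $\mathcal{C}of$ followed by a map in $\mathcal{W}$. Maps in $\mathcal{C}of\cap\mathcal{W}$ are called acyclic cofibrations. An object $D$ of $\mathcal{C}$ is cofibrant if the map from the initial object to $D$ is a cofibration; it is fibrant if for every acyclic cofibration $A\to B$ in $\mathcal{C}$ every map $A\to D$ extends along $A\to B$ to a map $B\to D$. Let $\mathcal{S}$ be the category of simplicial sets with its standard (Kan--Quillen) model structure and $\mathcal{S}_f\subseteq\mathcal{S}$ the full subcategory of finite simplicial sets (finitely many non-degenerate simplices); a map in $\mathcal{S}_f$ is a cofibration or weak equivalence if it is so in $\mathcal{S}$.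 A simplicial weak cofibration category is a weak cofibration category $\mathcal{C}$ tensored over $\mathcal{S}_f$, i.e. equipped with an action $\otimes:\mathcal{S}_f\times\mathcal{C}\to\mathcal{C}$ of the monoidal category $(\mathcal{S}_f,\times,\Delta^0)$ (with coherent associativity and unit isomorphisms), such that: (a) the action is weakly closed, i.e. $\otimes$ commutes with finite colimits in each variable separately; (b) for every cofibration $X\to Y$ in $\mathcal{S}_f$ and every cofibration $L\to K$ in $\mathcal{C}$ the induced map $X\otimes K\coprod_{X\otimes L}Y\otimes L\to Y\otimes K$ is a cofibration, which is acyclic if either of the two given maps is. Such a $\mathcal{C}$ is enriched in $\mathcal{S}$ by $\mathrm{Map}_{\mathcal{C}}(A,B)_n=\mathrm{Hom}_{\mathcal{C}}(\Delta^n\otimes A,B)$. A map $f:A\to B$ is a homotopy equivalence in the simplicial category $\mathcal{C}$ if there is $g:B\to A$ with $gf$ and $\mathrm{id}_A$ in the same connected component of $\mathrm{Map}_{\mathcal{C}}(A,A)$, and $fg$ and $\mathrm{id}_B$ in the same connected component of $\mathrm{Map}_{\mathcal{C}}(B,B)$. $\mathrm{Ind}(\mathcal{C})$ is the category whose objects are diagrams $I\to\mathcal{C}$ with $I$ small and filtered, and $\mathrm{Hom}_{\mathrm{Ind}(\mathcal{C})}(X,Y)=\lim_s\operatorname{colim}_t\mathrm{Hom}_{\mathcal{C}}(X_s,Y_t)$. A natural transformation between diagrams with the same small filtered index category induces a morphism in $\mathrm{Ind}(\mathcal{C})$. For a class $M$ of maps in $\mathcal{C}$, $\mathrm{Lw}^{\cong}(M)$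 is the class of morphisms in $\mathrm{Ind}(\mathcal{C})$ that are isomorphic (as morphisms) to one induced by a natural transformation all of whose components lie in $M$. *)

theory Defs
  imports "HOL-Homology.Simplices" "HOL-Analysis.Sum_Topology"
    "HOL-Library.Nat_Bijection" "HOL-Library.Equipollence"
begin

section \<open>Categories and functors\<close>

record ('o, 'a) cat =
  Obj :: "'o set"
  Arr :: "'a set"
  Dom :: "'a \<Rightarrow> 'o"
  Cod :: "'a \<Rightarrow> 'o"
  Id :: "'o \<Rightarrow> 'a"
  Comp :: "'a \<Rightarrow> 'a \<Rightarrow> 'a"

abbreviation comp_in :: "'a \<Rightarrow> ('o, 'a) cat \<Rightarrow> 'a \<Rightarrow> 'a"
    ("_ \<circ>\<^bsub>_\<^esub> _" [70, 0, 71] 70)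
  where "g \<circ>\<^bsub>C\<^esub> f \<equiv> Comp C g f"

definition Hom :: "('o, 'a) cat \<Rightarrow> 'o \<Rightarrow> 'o \<Rightarrow> 'a set" where
  "Hom C A B = {f \<in> Arr C. Dom C f = A \<and> Cod C f = B}"

locale category =
  fixes C :: "('o, 'a) cat"
  assumes dom_in_Obj: "f \<in> Arr C \<Longrightarrow> Dom C f \<in> Obj C"
    and cod_in_Obj: "f \<in> Arr C \<Longrightarrow> Cod C f \<in> Obj C"
    and Id_in_Hom: "A \<in> Obj C \<Longrightarrow> Id C A \<in> Hom C A A"
    and Comp_in_Hom: "\<lbrakk>f \<in> Hom C A B; g \<in> Hom C B D\<rbrakk> \<Longrightarrow> g \<circ>\<^bsub>C\<^esub> f \<in> Hom C A D"
    and Comp_Id_left: "f \<in> Hom C A B \<Longrightarrow> Id C B \<circ>\<^bsub>C\<^esub> f = f"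
    and Comp_Id_right: "f \<in> Hom C A B \<Longrightarrow> f \<circ>\<^bsub>C\<^esub> Id C A = f"
    and Comp_assoc: "\<lbrakk>f \<in> Hom C A B; g \<in> Hom C B D; h \<in> Hom C D E\<rbrakk>
      \<Longrightarrow> h \<circ>\<^bsub>C\<^esub> (g \<circ>\<^bsub>C\<^esub> f) = (h \<circ>\<^bsub>C\<^esub> g) \<circ>\<^bsub>C\<^esub> f"

definition finite_category :: "('o, 'a) cat \<Rightarrow> bool" where
  "finite_category J \<longleftrightarrow> category J \<and> finite (Obj J) \<and> finite (Arr J)"

definition filtered_category :: "('o, 'a) cat \<Rightarrow> bool" where
  "filtered_category I \<longleftrightarrow> category I \<and> Obj I \<noteq> {} \<and>
     (\<forall>i\<in>Obj I. \<forall>j\<in>Obj I. \<exists>k\<in>Obj I. Hom I i k \<noteq> {} \<and> Hom I j k \<noteq> {}) \<and>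
     (\<forall>i\<in>Obj I. \<forall>j\<in>Obj I. \<forall>u\<in>Hom I i j. \<forall>v\<in>Hom I i j.
        \<exists>k\<in>Obj I. \<exists>w\<in>Hom I j k. w \<circ>\<^bsub>I\<^esub> u = w \<circ>\<^bsub>I\<^esub> v)"

definition op_cat :: "('o, 'a) cat \<Rightarrow> ('o, 'a) cat" where
  "op_cat C = \<lparr>Obj = Obj C, Arr = Arr C, Dom = Cod C, Cod = Dom C, Id = Id C,
     Comp = (\<lambda>g f. f \<circ>\<^bsub>C\<^esub> g)\<rparr>"

definition prod_cat :: "('o, 'a) cat \<Rightarrow> ('p, 'b) cat \<Rightarrow> ('o \<times> 'p, 'a \<times> 'b) cat" where
  "prod_cat C D = \<lparr>Obj = Obj C \<times> Obj D, Arr = Arr C \<times> Arr D,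
     Dom = map_prod (Dom C) (Dom D), Cod = map_prod (Cod C) (Cod D),
     Id = map_prod (Id C) (Id D),
     Comp = (\<lambda>g f. (fst g \<circ>\<^bsub>C\<^esub> fst f, snd g \<circ>\<^bsub>D\<^esub> snd f))\<rparr>"

definition is_iso :: "('o, 'a) cat \<Rightarrow> 'a \<Rightarrow> bool" where
  "is_iso C f \<longleftrightarrow> f \<in> Arr C \<and>
     (\<exists>g\<in>Hom C (Cod C f) (Dom C f). g \<circ>\<^bsub>C\<^esub> f = Id C (Dom C f) \<and> f \<circ>\<^bsub>C\<^esub> g = Id C (Cod C f))"

record ('o, 'a, 'p, 'b) func =
  FObj :: "'o \<Rightarrow> 'p"
  FArr :: "'a \<Rightarrow> 'b"

definition is_functor :: "('o, 'a) cat \<Rightarrow> ('p, 'b) cat \<Rightarrow> ('o, 'a, 'p, 'b) func \<Rightarrow> bool" where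
  "is_functor C D F \<longleftrightarrow>
     (\<forall>A\<in>Obj C. FObj F A \<in> Obj D) \<and>
     (\<forall>f\<in>Arr C. FArr F f \<in> Hom D (FObj F (Dom C f)) (FObj F (Cod C f))) \<and>
     (\<forall>A\<in>Obj C. FArr F (Id C A) = Id D (FObj F A)) \<and>
     (\<forall>f\<in>Arr C. \<forall>g\<in>Arr C. Dom C g = Cod C f \<longrightarrow>
        FArr F (g \<circ>\<^bsub>C\<^esub> f) = FArr F g \<circ>\<^bsub>D\<^esub> FArr F f)"

definition func_comp ::
  "('p, 'b, 'q, 'c) func \<Rightarrow> ('o, 'a, 'p, 'b) func \<Rightarrow> ('o, 'a, 'q, 'c) func" where
  "func_comp G F = \<lparr>FObj = FObj G \<circ> FObj F, FArr = FArr G \<circ> FArr F\<rparr>"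

definition is_natural ::
  "('o, 'a) cat \<Rightarrow> ('p, 'b) cat \<Rightarrow> ('o, 'a, 'p, 'b) func \<Rightarrow> ('o, 'a, 'p, 'b) func \<Rightarrow>
     ('o \<Rightarrow> 'b) \<Rightarrow> bool" where
  "is_natural C D F G \<tau> \<longleftrightarrow>
     (\<forall>A\<in>Obj C. \<tau> A \<in> Hom D (FObj F A) (FObj G A)) \<and>
     (\<forall>f\<in>Arr C. \<tau> (Cod C f) \<circ>\<^bsub>D\<^esub> FArr F f = FArr G f \<circ>\<^bsub>D\<^esub> \<tau> (Dom C f))"

definition two_out_of_three :: "('o, 'a) cat \<Rightarrow> 'a set \<Rightarrow> bool" where
  "two_out_of_three C M \<longleftrightarrow>
     (\<forall>f\<in>Arr C. \<forall>g\<in>Arr C. Dom C g = Cod C f \<longrightarrow>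
        (f \<in> M \<and> g \<in> M \<longrightarrow> g \<circ>\<^bsub>C\<^esub> f \<in> M) \<and>
        (f \<in> M \<and> g \<circ>\<^bsub>C\<^esub> f \<in> M \<longrightarrow> g \<in> M) \<and>
        (g \<in> M \<and> g \<circ>\<^bsub>C\<^esub> f \<in> M \<longrightarrow> f \<in> M))"

section \<open>Finite limits and colimits\<close>

definition is_cocone ::
  "('j, 'k) cat \<Rightarrow> ('o, 'a) cat \<Rightarrow> ('j, 'k, 'o, 'a) func \<Rightarrow> 'o \<Rightarrow> ('j \<Rightarrow> 'a) \<Rightarrow> bool" where
  "is_cocone J C D L \<iota> \<longleftrightarrow> L \<in> Obj C \<and>
     (\<forall>j\<in>Obj J. \<iota> j \<in> Hom C (FObj D j) L) \<and>
     (\<forall>u\<in>Arr J. \<iota> (Cod J u) \<circ>\<^bsub>C\<^esub> FArr D u = \<iota> (Dom J u))"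

definition is_colimit ::
  "('j, 'k) cat \<Rightarrow> ('o, 'a) cat \<Rightarrow> ('j, 'k, 'o, 'a) func \<Rightarrow> 'o \<Rightarrow> ('j \<Rightarrow> 'a) \<Rightarrow> bool" where
  "is_colimit J C D L \<iota> \<longleftrightarrow> is_cocone J C D L \<iota> \<and>
     (\<forall>N \<mu>. is_cocone J C D N \<mu> \<longrightarrow>
        (\<exists>!h. h \<in> Hom C L N \<and> (\<forall>j\<in>Obj J. h \<circ>\<^bsub>C\<^esub> \<iota> j = \<mu> j)))"

text \<open>Every finite category is isomorphic to one whose objects and arrows are natural
  numbers, so it suffices to let finite shapes range over those.\<close>

definition has_finite_colimits :: "('o, 'a) cat \<Rightarrow> bool" where
  "has_finite_colimits C \<longleftrightarrow>
     (\<forall>(J :: (nat, nat) cat) D. finite_category J \<and> is_functor J C D \<longrightarrow>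
        (\<exists>L \<iota>. is_colimit J C D L \<iota>))"

definition has_finite_limits :: "('o, 'a) cat \<Rightarrow> bool" where
  "has_finite_limits C \<longleftrightarrow> has_finite_colimits (op_cat C)"

definition preserves_finite_colimits ::
  "('o, 'a) cat \<Rightarrow> ('p, 'b) cat \<Rightarrow> ('o, 'a, 'p, 'b) func \<Rightarrow> bool" where
  "preserves_finite_colimits C D F \<longleftrightarrow>
     (\<forall>(J :: (nat, nat) cat) G L \<iota>.
        finite_category J \<and> is_functor J C G \<and> is_colimit J C G L \<iota> \<longrightarrow>
        is_colimit J D (func_comp F G) (FObj F L) (\<lambda>j. FArr F (\<iota> j)))"

definition is_initial :: "('o, 'a) cat \<Rightarrow> 'o \<Rightarrow> bool" where
  "is_initial C Z \<longleftrightarrow> Z \<in> Obj C \<and> (\<forall>A\<in>Obj C. \<exists>!f. f \<in> Hom C Z A)"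

text \<open>\<open>p\<close> and \<open>q\<close> exhibit their common codomain as the pushout of \<open>f : A \<rightarrow> B\<close> and
  \<open>g : A \<rightarrow> D\<close>, with \<open>p : B \<rightarrow> P\<close> and \<open>q : D \<rightarrow> P\<close>; so \<open>q\<close> is the cobase change of \<open>f\<close>
  along \<open>g\<close>.\<close>

definition is_pushout :: "('o, 'a) cat \<Rightarrow> 'a \<Rightarrow> 'a \<Rightarrow> 'a \<Rightarrow> 'a \<Rightarrow> bool" where
  "is_pushout C f g p q \<longleftrightarrow>
     f \<in> Arr C \<and> g \<in> Arr C \<and> p \<in> Arr C \<and> q \<in> Arr C \<and>
     Dom C f = Dom C g \<and> Dom C p = Cod C f \<and> Dom C q = Cod C g \<and> Cod C p = Cod C q \<and>
     p \<circ>\<^bsub>C\<^esub> f = q \<circ>\<^bsub>C\<^esub> g \<and>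
     (\<forall>E. \<forall>r\<in>Hom C (Cod C f) E. \<forall>s\<in>Hom C (Cod C g) E. r \<circ>\<^bsub>C\<^esub> f = s \<circ>\<^bsub>C\<^esub> g \<longrightarrow>
        (\<exists>!h. h \<in> Hom C (Cod C p) E \<and> h \<circ>\<^bsub>C\<^esub> p = r \<and> h \<circ>\<^bsub>C\<^esub> q = s))"

definition closed_under_cobase_change :: "('o, 'a) cat \<Rightarrow> 'a set \<Rightarrow> bool" where
  "closed_under_cobase_change C M \<longleftrightarrow>
     (\<forall>f g p q. is_pushout C f g p q \<and> f \<in> M \<longrightarrow> q \<in> M)"

section \<open>Weak cofibration categories\<close>

definition subcategory_with_isos :: "('o, 'a) cat \<Rightarrow> 'a set \<Rightarrow> bool" where
  "subcategory_with_isos C M \<longleftrightarrow> M \<subseteq> Arr C \<and> (\<forall>f. is_iso C f \<longrightarrow> f \<in> M) \<and>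
     (\<forall>f\<in>M. \<forall>g\<in>M. Dom C g = Cod C f \<longrightarrow> g \<circ>\<^bsub>C\<^esub> f \<in> M)"

locale weak_cofibration_category = category C
  for C :: "('o, 'a) cat" +
  fixes Cof :: "'a set" and W :: "'a set"
  assumes Cof_subcategory: "subcategory_with_isos C Cof"
    and W_subcategory: "subcategory_with_isos C W"
    and finite_colimits: "has_finite_colimits C"
    and W_two_out_of_three: "two_out_of_three C W"
    and Cof_cobase_change: "closed_under_cobase_change C Cof"
    and acyclic_Cof_cobase_change: "closed_under_cobase_change C (Cof \<inter> W)"
    and factorization: "f \<in> Arr C \<Longrightarrow>
      \<exists>i\<in>Cof. \<exists>p\<in>W. Dom C p = Cod C i \<and> f = p \<circ>\<^bsub>C\<^esub> i"

definition cofibrant :: "('o, 'a) cat \<Rightarrow> 'a set \<Rightarrow> 'o \<Rightarrow> bool" where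
  "cofibrant C Cof D \<longleftrightarrow> (\<forall>Z f. is_initial C Z \<and> f \<in> Hom C Z D \<longrightarrow> f \<in> Cof)"

definition fibrant :: "('o, 'a) cat \<Rightarrow> 'a set \<Rightarrow> 'a set \<Rightarrow> 'o \<Rightarrow> bool" where
  "fibrant C Cof W D \<longleftrightarrow>
     (\<forall>i\<in>Cof \<inter> W. \<forall>u\<in>Hom C (Dom C i) D. \<exists>v\<in>Hom C (Cod C i) D. v \<circ>\<^bsub>C\<^esub> i = u)"

section \<open>Simplicial sets\<close>

text \<open>A morphism \<open>\<theta> : [m] \<rightarrow> [n]\<close> of the simplex category is the list of its values
  \<open>\<theta> 0, \<dots>, \<theta> m\<close>.\<close>

definition Delta :: "nat \<Rightarrow> nat \<Rightarrow> nat list set" where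
  "Delta m n = {\<theta>. length \<theta> = Suc m \<and> sorted \<theta> \<and> set \<theta> \<subseteq> {..n}}"

definition Delta_comp :: "nat list \<Rightarrow> nat list \<Rightarrow> nat list" where
  "Delta_comp \<theta> \<phi> = map (\<lambda>i. \<theta> ! i) \<phi>"

text \<open>\<open>sact X n \<theta> : simplices X n \<rightarrow> simplices X m\<close> is the structure map of
  \<open>\<theta> : [m] \<rightarrow> [n]\<close>.\<close>

record 's sset =
  simplices :: "nat \<Rightarrow> 's set"
  sact :: "nat \<Rightarrow> nat list \<Rightarrow> 's \<Rightarrow> 's"

definition is_sset :: "'s sset \<Rightarrow> bool" where
  "is_sset X \<longleftrightarrow>
     (\<forall>m n. \<forall>\<theta>\<in>Delta m n. \<forall>x\<in>simplices X n. sact X n \<theta> x \<in> simplices X m) \<and>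
     (\<forall>n. \<forall>x\<in>simplices X n. sact X n [0..<Suc n] x = x) \<and>
     (\<forall>k m n. \<forall>\<theta>\<in>Delta m n. \<forall>\<phi>\<in>Delta k m. \<forall>x\<in>simplices X n.
        sact X m \<phi> (sact X n \<theta> x) = sact X n (Delta_comp \<theta> \<phi>) x)"

definition degenerate :: "'s sset \<Rightarrow> nat \<Rightarrow> 's \<Rightarrow> bool" where
  "degenerate X n x \<longleftrightarrow>
     (\<exists>m<n. \<exists>\<sigma>\<in>Delta n m. set \<sigma> = {..m} \<and> (\<exists>y\<in>simplices X m. x = sact X m \<sigma> y))"

definition finite_sset :: "'s sset \<Rightarrow> bool" where
  "finite_sset X \<longleftrightarrow> is_sset X \<and> finite {(n, x). x \<in> simplices X n \<and> \<not> degenerate X n x}"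

text \<open>The edge \<open>e\<close> runs from \<open>d\<^sub>1 e\<close> to \<open>d\<^sub>0 e\<close>, the restrictions along \<open>[0] \<rightarrow> [1]\<close> with value
  \<open>0\<close> and \<open>1\<close> respectively.\<close>

definition same_component :: "'s sset \<Rightarrow> 's \<Rightarrow> 's \<Rightarrow> bool" where
  "same_component X = equivclp (\<lambda>x y. \<exists>e\<in>simplices X 1. x = sact X 1 [0] e \<and> y = sact X 1 [1] e)"

subsection \<open>Geometric realization\<close>

definition simplex_map :: "nat list \<Rightarrow> (nat \<Rightarrow> real) \<Rightarrow> nat \<Rightarrow> real" where
  "simplex_map \<theta> t i = (\<Sum>j | j < length \<theta> \<and> \<theta> ! j = i. t j)"

definition pre_realization :: "'s sset \<Rightarrow> ((nat \<times> 's) \<times> (nat \<Rightarrow> real)) topology" where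
  "pre_realization X =
     sum_topology (\<lambda>(n, x). subtopology (powertop_real UNIV) (standard_simplex n))
       {(n, x). x \<in> simplices X n}"

definition realization_step ::
  "'s sset \<Rightarrow> (nat \<times> 's) \<times> (nat \<Rightarrow> real) \<Rightarrow> (nat \<times> 's) \<times> (nat \<Rightarrow> real) \<Rightarrow> bool" where
  "realization_step X p q \<longleftrightarrow>
     (\<exists>m n. \<exists>\<theta>\<in>Delta m n. \<exists>x\<in>simplices X n. \<exists>t\<in>standard_simplex m.
        p = ((m, sact X n \<theta> x), t) \<and> q = ((n, x), simplex_map \<theta> t))"

definition realization_class ::
  "'s sset \<Rightarrow> (nat \<times> 's) \<times> (nat \<Rightarrow> real) \<Rightarrow> ((nat \<times> 's) \<times> (nat \<Rightarrow> real)) set" where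
  "realization_class X p = {q. equivclp (realization_step X) p q}"

definition realization :: "'s sset \<Rightarrow> ((nat \<times> 's) \<times> (nat \<Rightarrow> real)) set topology" where
  "realization X = topology (\<lambda>U.
     U \<subseteq> realization_class X ` topspace (pre_realization X) \<and>
     openin (pre_realization X) {p \<in> topspace (pre_realization X). realization_class X p \<in> U})"

text \<open>The image of a point does not depend on its representative, so the union below is a
  union of copies of a single class.\<close>

definition realization_map ::
  "'t sset \<Rightarrow> (nat \<Rightarrow> 's \<Rightarrow> 't) \<Rightarrow> ((nat \<times> 's) \<times> (nat \<Rightarrow> real)) set \<Rightarrow>
     ((nat \<times> 't) \<times> (nat \<Rightarrow> real)) set" where
  "realization_map Y f c = (\<Union>((n, x), t)\<in>c. realization_class Y ((n, f n x), t))"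

definition is_homotopy_equivalence_map :: "'x topology \<Rightarrow> 'y topology \<Rightarrow> ('x \<Rightarrow> 'y) \<Rightarrow> bool" where
  "is_homotopy_equivalence_map X Y f \<longleftrightarrow> continuous_map X Y f \<and>
     (\<exists>g. continuous_map Y X g \<and>
        homotopic_with (\<lambda>_. True) X X (g \<circ> f) id \<and>
        homotopic_with (\<lambda>_. True) Y Y (f \<circ> g) id)"

subsection \<open>The category of finite simplicial sets\<close>

text \<open>A finite simplicial set has finitely many simplices in each dimension, hence is isomorphic
  to one whose simplices are natural numbers; the category below is a small category
  equivalent to that of all finite simplicial sets.\<close>

type_synonym fsset_map = "nat sset \<times> nat sset \<times> (nat \<Rightarrow> nat \<Rightarrow> nat)"

definition sset_maps :: "'s sset \<Rightarrow> 't sset \<Rightarrow> (nat \<Rightarrow> 's \<Rightarrow> 't) set" where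
  "sset_maps X Y = {f. (\<forall>n. f n \<in> simplices X n \<rightarrow>\<^sub>E simplices Y n) \<and>
     (\<forall>m n. \<forall>\<theta>\<in>Delta m n. \<forall>x\<in>simplices X n. f m (sact X n \<theta> x) = sact Y n \<theta> (f n x))}"

definition mk_map :: "nat sset \<Rightarrow> nat sset \<Rightarrow> (nat \<Rightarrow> nat \<Rightarrow> nat) \<Rightarrow> fsset_map" where
  "mk_map X Y f = (X, Y, \<lambda>n. restrict (f n) (simplices X n))"

definition FSset :: "(nat sset, fsset_map) cat" where
  "FSset = \<lparr>Obj = {X. finite_sset X},
     Arr = {(X, Y, f). finite_sset X \<and> finite_sset Y \<and> f \<in> sset_maps X Y},
     Dom = (\<lambda>(X, Y, f). X), Cod = (\<lambda>(X, Y, f). Y),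
     Id = (\<lambda>X. mk_map X X (\<lambda>n x. x)),
     Comp = (\<lambda>(Y', Z, g) (X, Y, f). mk_map X Z (\<lambda>n x. g n (f n x)))\<rparr>"

definition FSset_cof :: "fsset_map set" where
  "FSset_cof = {(X, Y, f) \<in> Arr FSset. \<forall>n. inj_on (f n) (simplices X n)}"

text \<open>Weak equivalences of the Kan--Quillen model structure, as defined by Quillen: the maps whose
  geometric realization is a homotopy equivalence.\<close>

definition FSset_weq :: "fsset_map set" where
  "FSset_weq = {(X, Y, f) \<in> Arr FSset.
     is_homotopy_equivalence_map (realization X) (realization Y) (realization_map Y f)}"

definition simplex :: "nat \<Rightarrow> nat sset" where
  "simplex n = \<lparr>simplices = (\<lambda>m. list_encode ` Delta m n),
     sact = (\<lambda>m \<theta> x. list_encode (Delta_comp (list_decode x) \<theta>))\<rparr>"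

definition simplex_arr :: "nat \<Rightarrow> nat \<Rightarrow> nat list \<Rightarrow> fsset_map" where
  "simplex_arr m n \<theta> = mk_map (simplex m) (simplex n)
     (\<lambda>k x. list_encode (Delta_comp \<theta> (list_decode x)))"

text \<open>The cartesian monoidal structure, with pairs of simplices encoded by \<open>prod_encode\<close>.\<close>

definition sprod :: "nat sset \<Rightarrow> nat sset \<Rightarrow> nat sset" where
  "sprod X Y = \<lparr>simplices = (\<lambda>n. prod_encode ` (simplices X n \<times> simplices Y n)),
     sact = (\<lambda>n \<theta> z. prod_encode (map_prod (sact X n \<theta>) (sact Y n \<theta>) (prod_decode z)))\<rparr>"

definition sprod_map :: "fsset_map \<Rightarrow> fsset_map \<Rightarrow> fsset_map" where
  "sprod_map = (\<lambda>(X, X', f) (Y, Y', g).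
     mk_map (sprod X Y) (sprod X' Y')
       (\<lambda>n z. prod_encode (map_prod (f n) (g n) (prod_decode z))))"

definition sprod_assoc :: "nat sset \<Rightarrow> nat sset \<Rightarrow> nat sset \<Rightarrow> fsset_map" where
  "sprod_assoc X Y Z = mk_map (sprod (sprod X Y) Z) (sprod X (sprod Y Z))
     (\<lambda>n z. case prod_decode z of (w, c) \<Rightarrow> case prod_decode w of (a, b) \<Rightarrow>
        prod_encode (a, prod_encode (b, c)))"

definition sprod_fst :: "nat sset \<Rightarrow> nat sset \<Rightarrow> fsset_map" where
  "sprod_fst X Y = mk_map (sprod X Y) X (\<lambda>n z. fst (prod_decode z))"

definition sprod_snd :: "nat sset \<Rightarrow> nat sset \<Rightarrow> fsset_map" where
  "sprod_snd X Y = mk_map (sprod X Y) Y (\<lambda>n z. snd (prod_decode z))"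

section \<open>Simplicial weak cofibration categories\<close>

type_synonym ('o, 'a) tensor = "(nat sset \<times> 'o, fsset_map \<times> 'a, 'o, 'a) func"

definition tensor_left :: "('o, 'a) tensor \<Rightarrow> nat sset \<Rightarrow> ('o, 'a, 'o, 'a) func" where
  "tensor_left T X = \<lparr>FObj = (\<lambda>A. FObj T (X, A)), FArr = (\<lambda>f. FArr T (Id FSset X, f))\<rparr>"

definition tensor_right ::
  "('o, 'a) cat \<Rightarrow> ('o, 'a) tensor \<Rightarrow> 'o \<Rightarrow> (nat sset, fsset_map, 'o, 'a) func" where
  "tensor_right C T A = \<lparr>FObj = (\<lambda>X. FObj T (X, A)), FArr = (\<lambda>f. FArr T (f, Id C A))\<rparr>"

text \<open>\<open>T\<close> is an action of the monoidal category of finite simplicial sets on \<open>C\<close>, with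
  associativity isomorphisms \<open>\<alpha> X Y A : (X \<times> Y) \<otimes> A \<rightarrow> X \<otimes> (Y \<otimes> A)\<close> and unit isomorphisms
  \<open>\<upsilon> A : \<Delta>\<^sup>0 \<otimes> A \<rightarrow> A\<close>. Since \<open>\<Delta>\<^sup>0\<close> is terminal, the monoidal unit
  isomorphisms are the product projections.\<close>

locale simplicial_action = category C
  for C :: "('o, 'a) cat" +
  fixes T :: "('o, 'a) tensor"
    and \<alpha> :: "nat sset \<Rightarrow> nat sset \<Rightarrow> 'o \<Rightarrow> 'a"
    and \<upsilon> :: "'o \<Rightarrow> 'a"
  assumes tensor_functor: "is_functor (prod_cat FSset C) C T"
    and assoc_in_Hom: "\<lbrakk>X \<in> Obj FSset; Y \<in> Obj FSset; A \<in> Obj C\<rbrakk> \<Longrightarrow>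
      \<alpha> X Y A \<in> Hom C (FObj T (sprod X Y, A)) (FObj T (X, FObj T (Y, A)))"
    and assoc_iso: "\<lbrakk>X \<in> Obj FSset; Y \<in> Obj FSset; A \<in> Obj C\<rbrakk> \<Longrightarrow> is_iso C (\<alpha> X Y A)"
    and assoc_natural: "\<lbrakk>f \<in> Hom FSset X X'; g \<in> Hom FSset Y Y'; h \<in> Hom C A A'\<rbrakk> \<Longrightarrow>
      \<alpha> X' Y' A' \<circ>\<^bsub>C\<^esub> FArr T (sprod_map f g, h) = FArr T (f, FArr T (g, h)) \<circ>\<^bsub>C\<^esub> \<alpha> X Y A"
    and unit_in_Hom: "A \<in> Obj C \<Longrightarrow> \<upsilon> A \<in> Hom C (FObj T (simplex 0, A)) A"
    and unit_iso: "A \<in> Obj C \<Longrightarrow> is_iso C (\<upsilon> A)"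
    and unit_natural: "h \<in> Hom C A A' \<Longrightarrow>
      \<upsilon> A' \<circ>\<^bsub>C\<^esub> FArr T (Id FSset (simplex 0), h) = h \<circ>\<^bsub>C\<^esub> \<upsilon> A"
    and pentagon:
      "\<lbrakk>X \<in> Obj FSset; Y \<in> Obj FSset; Z \<in> Obj FSset; A \<in> Obj C\<rbrakk> \<Longrightarrow>
       \<alpha> X Y (FObj T (Z, A)) \<circ>\<^bsub>C\<^esub> \<alpha> (sprod X Y) Z A =
       FArr T (Id FSset X, \<alpha> Y Z A) \<circ>\<^bsub>C\<^esub> (\<alpha> X (sprod Y Z) A
         \<circ>\<^bsub>C\<^esub> FArr T (sprod_assoc X Y Z, Id C A))"
    and triangle_right: "\<lbrakk>X \<in> Obj FSset; A \<in> Obj C\<rbrakk> \<Longrightarrow>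
      FArr T (Id FSset X, \<upsilon> A) \<circ>\<^bsub>C\<^esub> \<alpha> X (simplex 0) A =
      FArr T (sprod_fst X (simplex 0), Id C A)"
    and triangle_left: "\<lbrakk>X \<in> Obj FSset; A \<in> Obj C\<rbrakk> \<Longrightarrow>
      \<upsilon> (FObj T (X, A)) \<circ>\<^bsub>C\<^esub> \<alpha> (simplex 0) X A =
      FArr T (sprod_snd (simplex 0) X, Id C A)"

text \<open>In \<open>pushout_product\<close>, \<open>p : X \<otimes> K \<rightarrow> P\<close> and \<open>q : Y \<otimes> L \<rightarrow> P\<close> are the pushout of
  \<open>X \<otimes> i : X \<otimes> L \<rightarrow> X \<otimes> K\<close> and \<open>j \<otimes> L : X \<otimes> L \<rightarrow> Y \<otimes> L\<close>, and \<open>h : P \<rightarrow> Y \<otimes> K\<close> is the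
  induced map.\<close>

locale simplicial_weak_cofibration_category =
  weak_cofibration_category C Cof W + simplicial_action C T \<alpha> \<upsilon>
  for C :: "('o, 'a) cat" and Cof :: "'a set" and W :: "'a set"
    and T :: "('o, 'a) tensor"
    and \<alpha> :: "nat sset \<Rightarrow> nat sset \<Rightarrow> 'o \<Rightarrow> 'a"
    and \<upsilon> :: "'o \<Rightarrow> 'a" +
  assumes tensor_left_colimits: "X \<in> Obj FSset \<Longrightarrow>
      preserves_finite_colimits C C (tensor_left T X)"
    and tensor_right_colimits: "A \<in> Obj C \<Longrightarrow>
      preserves_finite_colimits FSset C (tensor_right C T A)"
    and pushout_product:
      "\<lbrakk>j \<in> FSset_cof; j \<in> Hom FSset X Y; i \<in> Cof; i \<in> Hom C L K;
        is_pushout C (FArr T (Id FSset X, i)) (FArr T (j, Id C L)) p q;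
        h \<in> Hom C (Cod C p) (FObj T (Y, K));
        h \<circ>\<^bsub>C\<^esub> p = FArr T (j, Id C K); h \<circ>\<^bsub>C\<^esub> q = FArr T (Id FSset Y, i)\<rbrakk> \<Longrightarrow>
       h \<in> Cof \<and> (j \<in> FSset_weq \<or> i \<in> W \<longrightarrow> h \<in> W)"

definition mapping_space :: "('o, 'a) cat \<Rightarrow> ('o, 'a) tensor \<Rightarrow> 'o \<Rightarrow> 'o \<Rightarrow> 'a sset" where
  "mapping_space C T A B = \<lparr>simplices = (\<lambda>n. Hom C (FObj T (simplex n, A)) B),
     sact = (\<lambda>n \<theta> h. h \<circ>\<^bsub>C\<^esub> FArr T (simplex_arr (length \<theta> - 1) n \<theta>, Id C A))\<rparr>"

text \<open>A map \<open>f : A \<rightarrow> B\<close> is regarded as the vertex \<open>f \<circ> \<upsilon> A\<close> of the mapping space.\<close>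

definition homotopy_equivalence ::
  "('o, 'a) cat \<Rightarrow> ('o, 'a) tensor \<Rightarrow> ('o \<Rightarrow> 'a) \<Rightarrow> 'a \<Rightarrow> bool" where
  "homotopy_equivalence C T \<upsilon> f \<longleftrightarrow> f \<in> Arr C \<and>
     (let A = Dom C f; B = Cod C f in
      \<exists>g\<in>Hom C B A.
        same_component (mapping_space C T A A) ((g \<circ>\<^bsub>C\<^esub> f) \<circ>\<^bsub>C\<^esub> \<upsilon> A) (Id C A \<circ>\<^bsub>C\<^esub> \<upsilon> A) \<and>
        same_component (mapping_space C T B B) ((f \<circ>\<^bsub>C\<^esub> g) \<circ>\<^bsub>C\<^esub> \<upsilon> B) (Id C B \<circ>\<^bsub>C\<^esub> \<upsilon> B))"

section \<open>Ind-categories\<close>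

text \<open>The type \<open>'i\<close> plays the role of the universe: a set is small if it embeds into \<open>'i\<close>, and a
  small index category is, up to isomorphism, a category with objects and arrows in \<open>'i\<close>.\<close>

definition small_category :: "'i itself \<Rightarrow> ('o, 'a) cat \<Rightarrow> bool" where
  "small_category _ C \<longleftrightarrow> Obj C \<lesssim> (UNIV :: 'i set) \<and> Arr C \<lesssim> (UNIV :: 'i set)"

type_synonym ('i, 'o, 'a) diagram = "('i, 'i) cat \<times> ('i, 'i, 'o, 'a) func"

text \<open>The colimit of the sets \<open>Hom C A (Y t)\<close> over \<open>t\<close>: equivalence classes of pairs \<open>(t, \<phi>)\<close> with
  \<open>\<phi> : A \<rightarrow> Y t\<close>.\<close>

definition colim_step ::
  "('o, 'a) cat \<Rightarrow> 'o \<Rightarrow> ('i, 'o, 'a) diagram \<Rightarrow> 'i \<times> 'a \<Rightarrow> 'i \<times> 'a \<Rightarrow> bool" where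
  "colim_step C A = (\<lambda>(J, Y) (t, \<phi>) (t', \<phi>').
     \<phi> \<in> Hom C A (FObj Y t) \<and> (\<exists>u\<in>Hom J t t'. \<phi>' = FArr Y u \<circ>\<^bsub>C\<^esub> \<phi>))"

definition colim_class ::
  "('o, 'a) cat \<Rightarrow> 'o \<Rightarrow> ('i, 'o, 'a) diagram \<Rightarrow> 'i \<times> 'a \<Rightarrow> ('i \<times> 'a) set" where
  "colim_class C A Y p = {q. equivclp (colim_step C A Y) p q}"

definition colim_Hom :: "('o, 'a) cat \<Rightarrow> 'o \<Rightarrow> ('i, 'o, 'a) diagram \<Rightarrow> ('i \<times> 'a) set set" where
  "colim_Hom C A Y = {colim_class C A Y (t, \<phi>) | t \<phi>.
     t \<in> Obj (fst Y) \<and> \<phi> \<in> Hom C A (FObj (snd Y) t)}"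

text \<open>The map of colimits given by precomposition with \<open>g : A \<rightarrow> A'\<close>.\<close>

definition colim_precomp ::
  "('o, 'a) cat \<Rightarrow> 'a \<Rightarrow> ('i, 'o, 'a) diagram \<Rightarrow> ('i \<times> 'a) set \<Rightarrow> ('i \<times> 'a) set" where
  "colim_precomp C g Y c = (\<Union>(t, \<phi>)\<in>c. colim_class C (Dom C g) Y (t, \<phi> \<circ>\<^bsub>C\<^esub> g))"

definition ind_Hom ::
  "('o, 'a) cat \<Rightarrow> ('i, 'o, 'a) diagram \<Rightarrow> ('i, 'o, 'a) diagram \<Rightarrow> ('i \<Rightarrow> ('i \<times> 'a) set) set" where
  "ind_Hom C = (\<lambda>(I, X) Y. {F \<in> (\<Pi>\<^sub>E s\<in>Obj I. colim_Hom C (FObj X s) Y).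
     \<forall>u\<in>Arr I. colim_precomp C (FArr X u) Y (F (Cod I u)) = F (Dom I u)})"

type_synonym ('i, 'o, 'a) ind_arr =
  "('i, 'o, 'a) diagram \<times> ('i, 'o, 'a) diagram \<times> ('i \<Rightarrow> ('i \<times> 'a) set)"

text \<open>The morphism induced by components \<open>\<tau> s : X s \<rightarrow> Y s\<close> over a common index category.\<close>

definition levelwise ::
  "('o, 'a) cat \<Rightarrow> ('i, 'i) cat \<Rightarrow> ('i, 'i, 'o, 'a) func \<Rightarrow> ('i, 'i, 'o, 'a) func \<Rightarrow>
     ('i \<Rightarrow> 'a) \<Rightarrow> ('i, 'o, 'a) ind_arr" where
  "levelwise C I X Y \<tau> =
     ((I, X), (I, Y), \<lambda>s\<in>Obj I. colim_class C (FObj X s) (I, Y) (s, \<tau> s))"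

definition is_ind_object :: "('o, 'a) cat \<Rightarrow> ('i, 'o, 'a) diagram \<Rightarrow> bool" where
  "is_ind_object C = (\<lambda>(I, X). filtered_category I \<and> is_functor I C X)"

definition Ind :: "('o, 'a) cat \<Rightarrow> (('i, 'o, 'a) diagram, ('i, 'o, 'a) ind_arr) cat" where
  "Ind C = \<lparr>Obj = {X. is_ind_object C X},
     Arr = {(X, Y, F). is_ind_object C X \<and> is_ind_object C Y \<and> F \<in> ind_Hom C X Y},
     Dom = (\<lambda>(X, Y, F). X), Cod = (\<lambda>(X, Y, F). Y),
     Id = (\<lambda>(I, X). levelwise C I X X (\<lambda>s. Id C (FObj X s))),
     Comp = (\<lambda>(Y', Z, G) ((I, X), Y, F). ((I, X), Z,
        \<lambda>s\<in>Obj I. \<Union>(t, \<phi>)\<in>F s. \<Union>(r, \<psi>)\<in>G t.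
          colim_class C (FObj X s) Z (r, \<psi> \<circ>\<^bsub>C\<^esub> \<phi>)))\<rparr>"

definition Lw_iso :: "('o, 'a) cat \<Rightarrow> 'a set \<Rightarrow> ('i, 'o, 'a) ind_arr set" where
  "Lw_iso C M = {f \<in> Arr (Ind C).
     \<exists>I X Y \<tau> a b. filtered_category I \<and> is_functor I C X \<and> is_functor I C Y \<and>
       is_natural I C X Y \<tau> \<and> (\<forall>s\<in>Obj I. \<tau> s \<in> M) \<and>
       is_iso (Ind C) a \<and> a \<in> Hom (Ind C) (Dom (Ind C) f) (I, X) \<and>
       is_iso (Ind C) b \<and> b \<in> Hom (Ind C) (Cod (Ind C) f) (I, Y) \<and>
       b \<circ>\<^bsub>Ind C\<^esub> f = levelwise C I X Y \<tau> \<circ>\<^bsub>Ind C\<^esub> a}"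

definition ind_admissible :: "'i itself \<Rightarrow> ('o, 'a) cat \<Rightarrow> 'a set \<Rightarrow> bool" where
  "ind_admissible _ C W \<longleftrightarrow>
     two_out_of_three (Ind C :: (('i, 'o, 'a) diagram, ('i, 'o, 'a) ind_arr) cat) (Lw_iso C W)"

end

(* In a weak cofibration category C all of whose objects are fibrant and cofibrant, a morphism
   f : X -> Y of Ind(C) lies in Lw(W) up to isomorphism if and only if the weak equivalences are
   cofinal among the arrows A -> B of C over f: if they are, X and Y are the colimits of the
   sources and targets over the filtered category of all weak equivalences over f.

   This cofinality is in turn equivalent to a homotopy lifting property: for a cofibration
   A -> B over f there is a lift B -> X, strict on A and correct on B up to a homotopy relative
   to A. The lifting property is stable under composition, and it passes from g and gf to f by
   lifting a homotopy g f l ~ g y along g. That f and gf force g is seen directly on the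
   cofinality side, after replacing a weak equivalence by an acyclic cofibration. The homotopies
   live on relative cylinders obtained from the factorization axiom. *)

theory Submission
  imports Defs
begin

text \<open>Two composable ind-morphisms, each isomorphic to a levelwise weak equivalence, come with
  unrelated index categories, so their components cannot be compared directly. A criterion in terms
  of the morphism alone is needed. An ind-object \<open>Y\<close> is therefore seen only through the
  sets of maps \<open>A -> Y\<close> with \<open>A\<close> in C, and a morphism through its action
  on these sets. Filtered colimits commute with finite limits, so maps into \<open>Y\<close> can be
  glued along pushouts of C; no pushout is ever formed in Ind(C).

  The two forms of the criterion serve different cases. Homotopy lifting fixes the cofibration in
  advance, so that homotopies can be concatenated, and being strict on the source it can lift a
  homotopy with prescribed ends. To get g from f and gf, however, a lifting problem for g starts
  with a map to the middle ind-object, for which no preimage under f is at hand; cofinality for f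
  supplies one after passing to a weak equivalence.\<close>

section \<open>Pushouts and initial objects\<close>

text \<open>The shape of a span: objects \<open>0, 1, 2\<close>, which are also the names of their identities,
  and arrows \<open>3 : 0 \<rightarrow> 1\<close> and \<open>4 : 0 \<rightarrow> 2\<close>.\<close>

definition span_cat :: "(nat, nat) cat" where
  "span_cat = \<lparr>Obj = {0, 1, 2}, Arr = {0, 1, 2, 3, 4}, Dom = (\<lambda>k. if k \<le> 2 then k else 0),
     Cod = (\<lambda>k. if k \<le> 2 then k else k - 2), Id = id, Comp = (\<lambda>g f. if g \<le> 2 then f else g)\<rparr>"

lemma category_span_cat: "category span_cat"
proof
  show "f \<in> Arr span_cat \<Longrightarrow> Dom span_cat f \<in> Obj span_cat" for f
    by (auto simp: span_cat_def)
  show "f \<in> Arr span_cat \<Longrightarrow> Cod span_cat f \<in> Obj span_cat" for f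
    by (auto simp: span_cat_def)
  show "A \<in> Obj span_cat \<Longrightarrow> Id span_cat A \<in> Hom span_cat A A" for A
    by (auto simp: span_cat_def Hom_def)
  show "\<lbrakk>f \<in> Hom span_cat A B; g \<in> Hom span_cat B D\<rbrakk> \<Longrightarrow> g \<circ>\<^bsub>span_cat\<^esub> f \<in> Hom span_cat A D" for f g A B D
    by (auto simp: span_cat_def Hom_def split: if_splits)
  show "f \<in> Hom span_cat A B \<Longrightarrow> Id span_cat B \<circ>\<^bsub>span_cat\<^esub> f = f" for f A B
    by (auto simp: span_cat_def Hom_def)
  show "f \<in> Hom span_cat A B \<Longrightarrow> f \<circ>\<^bsub>span_cat\<^esub> Id span_cat A = f" for f A B
    by (auto simp: span_cat_def Hom_def split: if_splits)
  show "\<lbrakk>f \<in> Hom span_cat A B; g \<in> Hom span_cat B D; h \<in> Hom span_cat D E\<rbrakk>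
      \<Longrightarrow> h \<circ>\<^bsub>span_cat\<^esub> (g \<circ>\<^bsub>span_cat\<^esub> f) = (h \<circ>\<^bsub>span_cat\<^esub> g) \<circ>\<^bsub>span_cat\<^esub> f" for f g h A B D E
    by (simp add: span_cat_def)
qed

context category
begin

abbreviation comp_C (infixr "\<cdot>" 70) where "g \<cdot> f \<equiv> Comp C g f"

lemma Hom_iff: "f \<in> Hom C A B \<longleftrightarrow> f \<in> Arr C \<and> Dom C f = A \<and> Cod C f = B"
  by (auto simp: Hom_def)

lemma Comp_simps [simp]:
  assumes "f \<in> Arr C" "g \<in> Arr C" "Dom C g = Cod C f"
  shows "g \<cdot> f \<in> Arr C" "Dom C (g \<cdot> f) = Dom C f" "Cod C (g \<cdot> f) = Cod C g"
  using Comp_in_Hom[of f "Dom C f" "Cod C f" g "Cod C g"] assms by (auto simp: Hom_iff)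

lemma Id_simps [simp]:
  assumes "A \<in> Obj C"
  shows "Id C A \<in> Arr C" "Dom C (Id C A) = A" "Cod C (Id C A) = A"
  using Id_in_Hom[OF assms] by (auto simp: Hom_iff)

lemma Id_Comp [simp]: "f \<in> Arr C \<Longrightarrow> Cod C f = B \<Longrightarrow> Id C B \<cdot> f = f"
  using Comp_Id_left[of f "Dom C f" B] by (auto simp: Hom_iff)

lemma Comp_Id [simp]: "f \<in> Arr C \<Longrightarrow> Dom C f = A \<Longrightarrow> f \<cdot> Id C A = f"
  using Comp_Id_right[of f A "Cod C f"] by (auto simp: Hom_iff)

lemma assoc:
  "\<lbrakk>f \<in> Arr C; g \<in> Arr C; h \<in> Arr C; Dom C g = Cod C f; Dom C h = Cod C g\<rbrakk>
    \<Longrightarrow> (h \<cdot> g) \<cdot> f = h \<cdot> g \<cdot> f"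
  using Comp_assoc[of f "Dom C f" "Cod C f" g "Cod C g" h "Cod C h"] by (auto simp: Hom_iff)

text \<open>With \<open>assoc\<close> as a rewrite rule composites are nested to the right, so an
  equation for \<open>g \<cdot> f\<close> no longer matches inside a longer composite. This form
  carries the tail \<open>x\<close>.\<close>

lemma Comp_reduce:
  "\<lbrakk>g \<cdot> f = k; f \<in> Arr C; g \<in> Arr C; x \<in> Arr C; Dom C g = Cod C f; Dom C f = Cod C x\<rbrakk>
    \<Longrightarrow> g \<cdot> f \<cdot> x = k \<cdot> x"
  using assoc[of x f g] by simp

lemma is_iso_Id: "A \<in> Obj C \<Longrightarrow> is_iso C (Id C A)"
  unfolding is_iso_def by (auto simp: Hom_iff intro!: bexI[of _ "Id C A"])

lemma is_pushoutD:
  assumes "is_pushout C f g p q"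
  shows "f \<in> Arr C" "g \<in> Arr C" "p \<in> Arr C" "q \<in> Arr C" "Dom C g = Dom C f"
    "Dom C p = Cod C f" "Dom C q = Cod C g" "Cod C q = Cod C p" "p \<cdot> f = q \<cdot> g"
  using assms by (auto simp: is_pushout_def)

lemma is_pushout_induced:
  assumes "is_pushout C f g p q" "r \<in> Arr C" "s \<in> Arr C" "Dom C r = Cod C f"
    "Dom C s = Cod C g" "Cod C r = Cod C s" "r \<cdot> f = s \<cdot> g"
  obtains h where "h \<in> Arr C" "Dom C h = Cod C p" "Cod C h = Cod C r" "h \<cdot> p = r" "h \<cdot> q = s"
  using assms unfolding is_pushout_def by (metis (no_types, lifting) Hom_iff)

lemma is_pushout_unique:
  assumes "is_pushout C f g p q" "h \<in> Arr C" "h' \<in> Arr C" "Dom C h = Cod C p"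
    "Dom C h' = Cod C p" "Cod C h = Cod C h'" "h \<cdot> p = h' \<cdot> p" "h \<cdot> q = h' \<cdot> q"
  shows "h = h'"
proof -
  note D = is_pushoutD[OF assms(1)]
  have "h \<cdot> p \<in> Hom C (Cod C f) (Cod C h)" "h \<cdot> q \<in> Hom C (Cod C g) (Cod C h)"
    "(h \<cdot> p) \<cdot> f = (h \<cdot> q) \<cdot> g"
    using D assms(2-) by (auto simp: Hom_iff assoc)
  then have "\<exists>!k. k \<in> Hom C (Cod C p) (Cod C h) \<and> k \<cdot> p = h \<cdot> p \<and> k \<cdot> q = h \<cdot> q"
    using assms(1) unfolding is_pushout_def by blast
  moreover have "h \<in> Hom C (Cod C p) (Cod C h)" "h' \<in> Hom C (Cod C p) (Cod C h)"
    using assms(2-) by (auto simp: Hom_iff)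
  ultimately show ?thesis
    using assms(7,8) by metis
qed

lemma is_pushout_sym:
  assumes "is_pushout C f g p q"
  shows "is_pushout C g f q p"
proof -
  note D = is_pushoutD[OF assms]
  have "\<exists>!h. h \<in> Hom C (Cod C q) E \<and> h \<cdot> q = r \<and> h \<cdot> p = s"
    if "r \<in> Hom C (Cod C g) E" "s \<in> Hom C (Cod C f) E" "r \<cdot> g = s \<cdot> f" for E r s
  proof -
    have "\<exists>!h. h \<in> Hom C (Cod C p) E \<and> h \<cdot> p = s \<and> h \<cdot> q = r"
      using assms that(1,2) that(3)[symmetric] unfolding is_pushout_def by blast
    then show ?thesis
      using D(8) by (simp add: conj_commute)
  qed
  then show ?thesis
    using D unfolding is_pushout_def by simp
qed

lemma initial_arrow:
  assumes "is_initial C Z" "A \<in> Obj C"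
  obtains z where "z \<in> Arr C" "Dom C z = Z" "Cod C z = A"
  using assms unfolding is_initial_def by (metis Hom_iff)

lemma initial_arrow_unique:
  assumes "is_initial C Z" "f \<in> Arr C" "g \<in> Arr C" "Dom C f = Z" "Dom C g = Z" "Cod C f = Cod C g"
  shows "f = g"
  using assms cod_in_Obj unfolding is_initial_def by (metis Hom_iff)

text \<open>An initial object is the colimit of the empty diagram; the values of the functor
  \<open>?D\<close> are never evaluated.\<close>

lemma initial_exists:
  assumes "has_finite_colimits C"
  shows "\<exists>Z. is_initial C Z"
proof -
  let ?J = "\<lparr>Obj = {}, Arr = {}, Dom = id, Cod = id, Id = id, Comp = (\<lambda>g f. f)\<rparr> :: (nat, nat) cat"
  let ?D = "\<lparr>FObj = undefined, FArr = undefined\<rparr> :: (nat, nat, 'o, 'a) func"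
  have "category ?J"
    by unfold_locales (auto simp: Hom_def)
  then have "finite_category ?J" "is_functor ?J C ?D"
    by (auto simp: finite_category_def is_functor_def)
  then obtain L \<iota> where "is_colimit ?J C ?D L \<iota>"
    using assms unfolding has_finite_colimits_def by blast
  then have "is_initial C L"
    unfolding is_colimit_def is_cocone_def is_initial_def by auto
  then show ?thesis ..
qed

lemma pushout_exists:
  assumes "has_finite_colimits C" "f \<in> Arr C" "g \<in> Arr C" "Dom C f = Dom C g"
  shows "\<exists>p q. is_pushout C f g p q"
proof -
  define D :: "(nat, nat, 'o, 'a) func" where
    "D = \<lparr>FObj = (\<lambda>k. if k = 0 then Dom C f else if k = 1 then Cod C f else Cod C g),
      FArr = (\<lambda>k. if k = 0 then Id C (Dom C f) else if k = 1 then Id C (Cod C f)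
        else if k = 2 then Id C (Cod C g) else if k = 3 then f else g)\<rparr>"
  have "finite_category span_cat"
    using category_span_cat by (auto simp: finite_category_def span_cat_def)
  moreover have "is_functor span_cat C D"
    unfolding is_functor_def
  proof (intro conjI ballI impI)
    note assms(2-) [simp] dom_in_Obj[OF assms(3), simp] cod_in_Obj[OF assms(2), simp]
      cod_in_Obj[OF assms(3), simp]
    show "FObj D A \<in> Obj C" if "A \<in> Obj span_cat" for A
      using that by (auto simp: span_cat_def D_def)
    show "FArr D k \<in> Hom C (FObj D (Dom span_cat k)) (FObj D (Cod span_cat k))"
      if "k \<in> Arr span_cat" for k
      using that by (auto simp: span_cat_def D_def Hom_iff)
    show "FArr D (Id span_cat A) = Id C (FObj D A)" if "A \<in> Obj span_cat" for A
      using that by (auto simp: span_cat_def D_def)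
    show "FArr D (l \<circ>\<^bsub>span_cat\<^esub> k) = FArr D l \<cdot> FArr D k"
      if "k \<in> Arr span_cat" "l \<in> Arr span_cat" "Dom span_cat l = Cod span_cat k" for k l
    proof -
      have "k \<in> {0, 1, 2, 3, 4}" "l \<in> {0, 1, 2, 3, 4}"
        using that by (auto simp: span_cat_def)
      then show ?thesis
        using that(3) by (elim insertE emptyE; simp add: span_cat_def D_def)
    qed
  qed
  ultimately obtain L \<iota> where colim: "is_colimit span_cat C D L \<iota>"
    using assms(1) unfolding has_finite_colimits_def by blast
  then have \<iota>: "\<iota> 0 \<in> Hom C (Dom C f) L" "\<iota> 1 \<in> Hom C (Cod C f) L" "\<iota> 2 \<in> Hom C (Cod C g) L"
    "\<iota> 1 \<cdot> f = \<iota> 0" "\<iota> 2 \<cdot> g = \<iota> 0"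
    by (auto simp: is_colimit_def is_cocone_def span_cat_def D_def)
  have "is_pushout C f g (\<iota> 1) (\<iota> 2)"
    unfolding is_pushout_def
  proof (intro conjI allI ballI impI)
    fix E r s
    assume r: "r \<in> Hom C (Cod C f) E" and s: "s \<in> Hom C (Cod C g) E" and rs: "r \<cdot> f = s \<cdot> g"
    define \<mu> where "\<mu> k = (if k = 0 then r \<cdot> f else if k = 1 then r else s)" for k :: nat
    have "is_cocone span_cat C D E \<mu>"
      using r s rs assms cod_in_Obj
      by (auto simp: is_cocone_def span_cat_def D_def \<mu>_def Hom_iff)
    then have "\<exists>!h. h \<in> Hom C L E \<and> (\<forall>j\<in>Obj span_cat. h \<cdot> \<iota> j = \<mu> j)"
      using colim unfolding is_colimit_def by blast
    \<comment> \<open>The component at the vertex \<open>0\<close> is forced by the one at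
      \<open>1\<close>, so uniqueness of maps of cocones becomes uniqueness of maps out of the
      pushout.\<close>
    moreover have "(\<forall>j\<in>Obj span_cat. h \<cdot> \<iota> j = \<mu> j) \<longleftrightarrow> h \<cdot> \<iota> 1 = r \<and> h \<cdot> \<iota> 2 = s"
      if "h \<in> Hom C L E" for h
    proof -
      have "h \<cdot> \<iota> 0 = r \<cdot> f" if "h \<cdot> \<iota> 1 = r"
        using \<iota> that \<open>h \<in> Hom C L E\<close> assms(2) assoc[of f "\<iota> 1" h] by (auto simp: Hom_iff)
      then show ?thesis
        by (auto simp: span_cat_def \<mu>_def)
    qed
    ultimately have "\<exists>!h. h \<in> Hom C L E \<and> h \<cdot> \<iota> 1 = r \<and> h \<cdot> \<iota> 2 = s"
      by (simp cong: conj_cong)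
    moreover have "Cod C (\<iota> 1) = L"
      using \<iota> by (simp add: Hom_iff)
    ultimately show "\<exists>!h. h \<in> Hom C (Cod C (\<iota> 1)) E \<and> h \<cdot> \<iota> 1 = r \<and> h \<cdot> \<iota> 2 = s"
      by simp
  qed (use \<iota> assms in \<open>auto simp: Hom_iff\<close>)
  then show ?thesis by blast
qed

end

section \<open>Finitely continuous presheaves\<close>

record ('o, 'a, 'x) presheaf =
  El :: "'o \<Rightarrow> 'x set"
  Res :: "'a \<Rightarrow> 'x \<Rightarrow> 'x"

text \<open>Of an ind-object \<open>Y\<close> the homotopical part of the argument uses only that the presheaf
  \<open>A \<mapsto> Hom A Y\<close> turns pushouts and the initial object into limits.\<close>

locale lex_presheaf = category C for C :: "('o, 'a) cat" +
  fixes P :: "('o, 'a, 'x) presheaf"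
  assumes Res_in: "\<lbrakk>a \<in> Arr C; x \<in> El P (Cod C a)\<rbrakk> \<Longrightarrow> Res P a x \<in> El P (Dom C a)"
    and Res_Id: "\<lbrakk>A \<in> Obj C; x \<in> El P A\<rbrakk> \<Longrightarrow> Res P (Id C A) x = x"
    and Res_Comp: "\<lbrakk>a \<in> Arr C; b \<in> Arr C; Dom C b = Cod C a; x \<in> El P (Cod C b)\<rbrakk> \<Longrightarrow>
      Res P (b \<cdot> a) x = Res P a (Res P b x)"
    and glue: "\<lbrakk>is_pushout C a b p q; x \<in> El P (Cod C a); y \<in> El P (Cod C b);
        Res P a x = Res P b y\<rbrakk> \<Longrightarrow> \<exists>z\<in>El P (Cod C p). Res P p z = x \<and> Res P q z = y"
    and separated: "\<lbrakk>is_pushout C a b p q; z \<in> El P (Cod C p); z' \<in> El P (Cod C p);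
        Res P p z = Res P p z'; Res P q z = Res P q z'\<rbrakk> \<Longrightarrow> z = z'"
    and initial_El: "is_initial C Z \<Longrightarrow> \<exists>!x. x \<in> El P Z"
begin

lemma Res_mem [simp]: "\<lbrakk>a \<in> Arr C; Dom C a = A; x \<in> El P (Cod C a)\<rbrakk> \<Longrightarrow> Res P a x \<in> El P A"
  using Res_in by auto

lemma initial_El_unique: "\<lbrakk>is_initial C Z; x \<in> El P Z; y \<in> El P Z\<rbrakk> \<Longrightarrow> x = y"
  using initial_El by blast

end

locale presheaf_map = P: lex_presheaf C P + Q: lex_presheaf C Q
  for C :: "('o, 'a) cat" and P :: "('o, 'a, 'x) presheaf" and Q :: "('o, 'a, 'y) presheaf" +
  fixes f :: "'o \<Rightarrow> 'x \<Rightarrow> 'y"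
  assumes map_in [simp]: "\<lbrakk>A \<in> Obj C; x \<in> El P A\<rbrakk> \<Longrightarrow> f A x \<in> El Q A"
    and natural: "\<lbrakk>a \<in> Arr C; x \<in> El P (Cod C a)\<rbrakk> \<Longrightarrow>
      f (Dom C a) (Res P a x) = Res Q a (f (Cod C a) x)"
begin

lemma natural': "\<lbrakk>a \<in> Arr C; Dom C a = A; Cod C a = B; x \<in> El P B\<rbrakk> \<Longrightarrow>
    f A (Res P a x) = Res Q a (f B x)"
  using natural by auto

end

lemma presheaf_map_comp:
  assumes "presheaf_map C P Q f" "presheaf_map C Q R g"
  shows "presheaf_map C P R (\<lambda>A x. g A (f A x))"
proof -
  interpret f: presheaf_map C P Q f by fact
  interpret g: presheaf_map C Q R g by fact
  show ?thesis
    by unfold_locales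
      (auto simp: f.natural g.natural f.P.dom_in_Obj f.P.cod_in_Obj)
qed

text \<open>In the comma category of arrows of \<open>C\<close> over \<open>f\<close>, those in \<open>W\<close> are cofinal.\<close>

definition W_cofinal ::
  "('o, 'a) cat \<Rightarrow> 'a set \<Rightarrow> ('o, 'a, 'x) presheaf \<Rightarrow> ('o, 'a, 'y) presheaf \<Rightarrow>
     ('o \<Rightarrow> 'x \<Rightarrow> 'y) \<Rightarrow> bool" where
  "W_cofinal C W P Q f \<longleftrightarrow>
     (\<forall>a\<in>Arr C. \<forall>x\<in>El P (Dom C a). \<forall>y\<in>El Q (Cod C a). f (Dom C a) x = Res Q a y \<longrightarrow>
       (\<exists>w\<in>W. \<exists>u\<in>Hom C (Dom C a) (Dom C w). \<exists>v\<in>Hom C (Cod C a) (Cod C w).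
          \<exists>x'\<in>El P (Dom C w). \<exists>y'\<in>El Q (Cod C w).
          Comp C w u = Comp C v a \<and> Res P u x' = x \<and> Res Q v y' = y \<and>
          f (Dom C w) x' = Res Q w y'))"

lemma W_cofinalE:
  assumes "W_cofinal C W P Q f" "a \<in> Arr C" "Dom C a = A" "Cod C a = B"
    "x \<in> El P A" "y \<in> El Q B" "f A x = Res Q a y"
  obtains w u v A' B' x' y' where "w \<in> W" "u \<in> Arr C" "v \<in> Arr C" "Dom C w = A'" "Cod C w = B'"
    "Dom C u = A" "Cod C u = A'" "Dom C v = B" "Cod C v = B'"
    "x' \<in> El P A'" "y' \<in> El Q B'" "Comp C w u = Comp C v a" "Res P u x' = x" "Res Q v y' = y"
    "f A' x' = Res Q w y'"
proof -
  obtain w u v x' y' where "w\<in>W" "u\<in>Hom C (Dom C a) (Dom C w)" "v\<in>Hom C (Cod C a) (Cod C w)"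
    "x'\<in>El P (Dom C w)" "y'\<in>El Q (Cod C w)" "Comp C w u = Comp C v a" "Res P u x' = x"
    "Res Q v y' = y" "f (Dom C w) x' = Res Q w y'"
    using assms unfolding W_cofinal_def by blast
  then show thesis
    using assms that[of w u v "Dom C w" "Cod C w" x' y'] by (simp add: Hom_def)
qed

text \<open>Lifting against cofibrations up to a homotopy relative to the domain, where an object \<open>E\<close>
  with weak equivalences \<open>e0, e1 : B \<rightarrow> E\<close> that agree on \<open>A\<close> serves as a relative cylinder.\<close>

definition homotopy_lifting ::
  "('o, 'a) cat \<Rightarrow> 'a set \<Rightarrow> 'a set \<Rightarrow> ('o, 'a, 'x) presheaf \<Rightarrow> ('o, 'a, 'y) presheaf \<Rightarrow>
     ('o \<Rightarrow> 'x \<Rightarrow> 'y) \<Rightarrow> bool" where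
  "homotopy_lifting C Cof W P Q f \<longleftrightarrow>
     (\<forall>k\<in>Cof. \<forall>x\<in>El P (Dom C k). \<forall>y\<in>El Q (Cod C k). f (Dom C k) x = Res Q k y \<longrightarrow>
       (\<exists>l\<in>El P (Cod C k). \<exists>E. \<exists>e0\<in>W \<inter> Hom C (Cod C k) E. \<exists>e1\<in>W \<inter> Hom C (Cod C k) E.
          \<exists>z\<in>El Q E. Comp C e0 k = Comp C e1 k \<and> Res P k l = x \<and>
          Res Q e0 z = f (Cod C k) l \<and> Res Q e1 z = y))"

lemma homotopy_liftingE:
  assumes "homotopy_lifting C Cof W P Q f" "k \<in> Cof" "Dom C k = A" "Cod C k = B"
    "x \<in> El P A" "y \<in> El Q B" "f A x = Res Q k y"
  obtains l E e0 e1 z where "l \<in> El P B" "e0 \<in> W" "e1 \<in> W" "e0 \<in> Arr C" "e1 \<in> Arr C"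
    "Dom C e0 = B" "Dom C e1 = B" "Cod C e0 = E" "Cod C e1 = E" "z \<in> El Q E"
    "Comp C e0 k = Comp C e1 k" "Res P k l = x" "Res Q e0 z = f B l" "Res Q e1 z = y"
proof -
  obtain l E e0 e1 z where "l \<in> El P (Cod C k)" "e0\<in>W \<inter> Hom C (Cod C k) E"
    "e1\<in>W \<inter> Hom C (Cod C k) E" "z\<in>El Q E" "Comp C e0 k = Comp C e1 k" "Res P k l = x"
    "Res Q e0 z = f (Cod C k) l" "Res Q e1 z = y"
    using assms unfolding homotopy_lifting_def by blast
  then show thesis
    using assms that[of l e0 e1 E z] by (simp add: Hom_def)
qed

section \<open>Cofinality of weak equivalences and homotopy lifting\<close>

locale bifibrant_category = weak_cofibration_category C Cof W
  for C :: "('o, 'a) cat" and Cof W +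
  assumes all_fibrant: "D \<in> Obj C \<Longrightarrow> fibrant C Cof W D"
    and all_cofibrant: "D \<in> Obj C \<Longrightarrow> cofibrant C Cof D"
begin

section \<open>Consequences of the axioms, and relative cylinders\<close>

lemma Cof_Arr: "f \<in> Cof \<Longrightarrow> f \<in> Arr C"
  and W_Arr: "f \<in> W \<Longrightarrow> f \<in> Arr C"
  using Cof_subcategory W_subcategory unfolding subcategory_with_isos_def by auto

lemma Cof_Comp: "\<lbrakk>f \<in> Cof; g \<in> Cof; Dom C g = Cod C f\<rbrakk> \<Longrightarrow> g \<cdot> f \<in> Cof"
  and W_Comp: "\<lbrakk>f \<in> W; g \<in> W; Dom C g = Cod C f\<rbrakk> \<Longrightarrow> g \<cdot> f \<in> W"
  using Cof_subcategory W_subcategory unfolding subcategory_with_isos_def by auto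

lemma Id_W: "A \<in> Obj C \<Longrightarrow> Id C A \<in> W"
  using W_subcategory is_iso_Id unfolding subcategory_with_isos_def by auto

lemma W_cancel_first: "\<lbrakk>g \<cdot> f \<in> W; f \<in> W; g \<in> Arr C; Dom C g = Cod C f\<rbrakk> \<Longrightarrow> g \<in> W"
  using W_two_out_of_three W_Arr unfolding two_out_of_three_def by blast

lemma W_cancel_second: "\<lbrakk>g \<cdot> f \<in> W; g \<in> W; f \<in> Arr C; Dom C g = Cod C f\<rbrakk> \<Longrightarrow> f \<in> W"
  using W_two_out_of_three W_Arr unfolding two_out_of_three_def by blast

lemma pushout_obtain:
  assumes "f \<in> Arr C" "g \<in> Arr C" "Dom C f = Dom C g"
  obtains p q E where "is_pushout C f g p q" "p \<in> Arr C" "q \<in> Arr C" "Dom C p = Cod C f"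
    "Dom C q = Cod C g" "Cod C p = E" "Cod C q = E" "E \<in> Obj C" "p \<cdot> f = q \<cdot> g"
proof -
  obtain p q where pq: "is_pushout C f g p q"
    using pushout_exists[OF finite_colimits assms] by blast
  note D = is_pushoutD[OF this]
  show thesis
    using that[OF pq, of "Cod C p"] D cod_in_Obj[of p] by simp
qed

lemma Cof_pushout: "\<lbrakk>is_pushout C f g p q; f \<in> Cof\<rbrakk> \<Longrightarrow> q \<in> Cof"
  and Cof_pushout': "\<lbrakk>is_pushout C f g p q; g \<in> Cof\<rbrakk> \<Longrightarrow> p \<in> Cof"
  using Cof_cobase_change is_pushout_sym unfolding closed_under_cobase_change_def by blast+

lemma acyclic_pushout: "\<lbrakk>is_pushout C f g p q; f \<in> Cof; f \<in> W\<rbrakk> \<Longrightarrow> q \<in> W"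
  and acyclic_pushout': "\<lbrakk>is_pushout C f g p q; g \<in> Cof; g \<in> W\<rbrakk> \<Longrightarrow> p \<in> W"
  using acyclic_Cof_cobase_change is_pushout_sym unfolding closed_under_cobase_change_def
  by blast+

lemma factor_obtain:
  assumes "f \<in> Arr C"
  obtains i p E where "i \<in> Cof" "p \<in> W" "i \<in> Arr C" "p \<in> Arr C" "Dom C i = Dom C f"
    "Cod C i = E" "Dom C p = E" "Cod C p = Cod C f" "E \<in> Obj C" "p \<cdot> i = f"
proof -
  obtain i p where ip: "i \<in> Cof" "p \<in> W" "Dom C p = Cod C i" "f = p \<cdot> i"
    using factorization[OF assms] by blast
  have "i \<in> Arr C" "p \<in> Arr C"
    using ip Cof_Arr W_Arr by auto
  moreover from this have "Dom C i = Dom C f" "Cod C p = Cod C f"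
    using ip(3,4) by simp_all
  ultimately show thesis
    by (intro that[OF ip(1,2) _ _ _ refl ip(3) _ _ ip(4)[symmetric]]) (auto simp: cod_in_Obj)
qed

lemma extension_obtain:
  assumes "i \<in> Cof" "i \<in> W" "u \<in> Arr C" "Dom C u = Dom C i"
  obtains v where "v \<in> Arr C" "Dom C v = Cod C i" "Cod C v = Cod C u" "v \<cdot> i = u"
proof -
  have "u \<in> Hom C (Dom C i) (Cod C u)"
    using assms by (simp add: Hom_iff)
  then have "\<exists>v\<in>Hom C (Cod C i) (Cod C u). v \<cdot> i = u"
    using assms all_fibrant[OF cod_in_Obj[OF assms(3)]] unfolding fibrant_def by blast
  then show thesis
    using that by (auto simp: Hom_iff)
qed

text \<open>Two copies of the target of \<open>k\<close>, glued along its source, map to the target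
  of \<open>e0\<close> and \<open>e1\<close>; this map is factored, and two out of three passes from
  \<open>e0\<close> and \<open>e1\<close> to the new ends. A loose cylinder as in
  \<open>homotopy_lifting\<close> can thus be replaced by one whose ends jointly form a cofibration.
  For identities \<open>e0\<close> and \<open>e1\<close> this is the usual relative
  cylinder.\<close>

lemma relative_cylinder:
  assumes "is_pushout C k k s0 s1" "e0 \<in> W" "e1 \<in> W" "Dom C e0 = Cod C k" "Dom C e1 = Cod C k"
    "Cod C e1 = Cod C e0" "e0 \<cdot> k = e1 \<cdot> k"
  obtains E c p where "c \<in> Cof" "p \<in> W" "c \<in> Arr C" "p \<in> Arr C" "Dom C c = Cod C s0" "Cod C c = E"
    "Dom C p = E" "Cod C p = Cod C e0" "E \<in> Obj C" "c \<cdot> s0 \<in> W" "c \<cdot> s1 \<in> W"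
    "p \<cdot> c \<cdot> s0 = e0" "p \<cdot> c \<cdot> s1 = e1"
proof -
  note [simp] = is_pushoutD(1-8)[OF assms(1)] assms(4-6) assms(2,3)[THEN W_Arr]
  obtain h where h [simp]: "h \<in> Arr C" "Dom C h = Cod C s0" "Cod C h = Cod C e0"
    and hs: "h \<cdot> s0 = e0" "h \<cdot> s1 = e1"
    by (rule is_pushout_induced[OF assms(1), of e0 e1]) (use assms(7) in auto)
  obtain c p E where c: "c \<in> Cof" "p \<in> W"
    and [simp]: "c \<in> Arr C" "p \<in> Arr C" "Dom C c = Cod C s0" "Cod C c = E" "Dom C p = E"
      "Cod C p = Cod C e0" "E \<in> Obj C"
    and pc: "p \<cdot> c = h"
    by (rule factor_obtain[OF h(1)]) auto
  have pcs: "p \<cdot> c \<cdot> s0 = e0" "p \<cdot> c \<cdot> s1 = e1"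
    by (simp_all add: Comp_reduce[OF pc] hs)
  moreover have "c \<cdot> s0 \<in> W" "c \<cdot> s1 \<in> W"
    by (rule W_cancel_second[of p]; use c assms(2,3) pcs in simp)+
  ultimately show thesis
    using that[of c p E] c by simp
qed

text \<open>The homotopy is pulled back along the weak equivalence \<open>p\<close> of
  \<open>relative_cylinder\<close>. As \<open>k\<close> is a cofibration, each end of the new
  cylinder is an acyclic cofibration, stable under cobase change, and \<open>c\<close> can itself be
  the cofibration of a further lifting problem.\<close>

lemma homotopy_liftingE':
  assumes "homotopy_lifting C Cof W P Q f" "presheaf_map C P Q f" "is_pushout C k k s0 s1"
    "k \<in> Cof" "Dom C k = A" "Cod C k = B" "x \<in> El P A" "y \<in> El Q B" "f A x = Res Q k y"
  obtains l E c z where "l \<in> El P B" "c \<in> Cof" "c \<in> Arr C" "Dom C c = Cod C s0" "Cod C c = E"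
    "E \<in> Obj C" "c \<cdot> s0 \<in> W" "c \<cdot> s1 \<in> W" "z \<in> El Q E" "Res P k l = x"
    "Res Q (c \<cdot> s0) z = f B l" "Res Q (c \<cdot> s1) z = y"
proof -
  interpret presheaf_map C P Q f by fact
  obtain l E e0 e1 z where l: "l \<in> El P B" and e: "e0 \<in> W" "e1 \<in> W"
    and [simp]: "e0 \<in> Arr C" "e1 \<in> Arr C" "Dom C e0 = B" "Dom C e1 = B" "Cod C e0 = E"
      "Cod C e1 = E"
    and z [simp]: "z \<in> El Q E"
    and eqs: "e0 \<cdot> k = e1 \<cdot> k" "Res P k l = x" "Res Q e0 z = f B l" "Res Q e1 z = y"
    by (rule homotopy_liftingE[OF assms(1,4-9)]) auto
  note [simp] = is_pushoutD(1-8)[OF assms(3)]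
  obtain E' c p where c: "c \<in> Cof" "c \<cdot> s0 \<in> W" "c \<cdot> s1 \<in> W"
    and [simp]: "c \<in> Arr C" "p \<in> Arr C" "Dom C c = Cod C s0" "Cod C c = E'"
    "Dom C p = E'" "Cod C p = E" "E' \<in> Obj C"
    and pc: "p \<cdot> c \<cdot> s0 = e0" "p \<cdot> c \<cdot> s1 = e1"
    by (rule relative_cylinder[OF assms(3) e]) (use assms(6) eqs(1) in auto)
  show thesis
  proof (rule that[of l c E' "Res Q p z"])
    show "Res Q (c \<cdot> s0) (Res Q p z) = f B l"
      using Q.Res_Comp[of "c \<cdot> s0" p z] eqs pc by simp
    show "Res Q (c \<cdot> s1) (Res Q p z) = y"
      using Q.Res_Comp[of "c \<cdot> s1" p z] eqs pc by simp
  qed (use l c eqs in auto)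
qed


text \<open>If the given square factors through \<open>w : A' \<rightarrow> B'\<close>, then \<open>w\<close> factors as an acyclic
  cofibration \<open>j : A' \<rightarrow> N'\<close> followed by \<open>p\<close>, where \<open>B\<close> maps to \<open>N'\<close>. As \<open>A'\<close> is fibrant, \<open>j\<close> has
  a retraction \<open>r\<close>, and as \<open>N'\<close> is fibrant, \<open>j \<cdot> r\<close> is homotopic to the identity relative to \<open>A'\<close>;
  the cylinder of this homotopy is built so as to receive a relative cylinder of \<open>B\<close>.\<close>

lemma W_cofinal_imp_homotopy_lifting:
  assumes f: "presheaf_map C P Q f" and L: "W_cofinal C W P Q f"
  shows "homotopy_lifting C Cof W P Q f"
  unfolding homotopy_lifting_def
proof (intro ballI impI)
  fix k x y
  assume k: "k \<in> Cof" and "x \<in> El P (Dom C k)" and "y \<in> El Q (Cod C k)"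
    and "f (Dom C k) x = Res Q k y"
  moreover define A B where "A = Dom C k" and "B = Cod C k"
  ultimately have xy: "x \<in> El P A" "y \<in> El Q B" "f A x = Res Q k y"
    and k' [simp]: "k \<in> Arr C" "Dom C k = A" "Cod C k = B"
    by (auto simp: Cof_Arr)
  interpret presheaf_map C P Q f by fact
  have [simp]: "B \<in> Obj C"
    using cod_in_Obj[OF k'(1)] by simp
  obtain w u v A' B' x' y' where w: "w \<in> W"
    and [simp]: "u \<in> Arr C" "v \<in> Arr C" "Dom C w = A'" "Cod C w = B'"
    "Dom C u = A" "Cod C u = A'" "Dom C v = B" "Cod C v = B'"
    and [simp]: "x' \<in> El P A'" "y' \<in> El Q B'"
    and wu: "w \<cdot> u = v \<cdot> k" and ux': "Res P u x' = x" and vy': "Res Q v y' = y"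
    and wy': "f A' x' = Res Q w y'"
    by (rule W_cofinalE[OF L k' xy])
  have [simp]: "w \<in> Arr C"
    using w by (rule W_Arr)
  have [simp]: "A' \<in> Obj C"
    using dom_in_Obj[of w] by simp
  \<comment> \<open>\<open>N\<close> is \<open>B\<close> glued to \<open>A'\<close> along
    \<open>A\<close>. Factoring \<open>h : N -> B'\<close> rather than \<open>w\<close> is what lets
    \<open>B\<close> map to the middle object \<open>N'\<close>.\<close>
  obtain nB j0 N where N: "is_pushout C k u nB j0"
    and [simp]: "nB \<in> Arr C" "j0 \<in> Arr C" "Dom C nB = B" "Dom C j0 = A'" "Cod C nB = N"
      "Cod C j0 = N"
    and nBk: "nB \<cdot> k = j0 \<cdot> u"
    by (rule pushout_obtain[of k u]) auto
  obtain h where h [simp]: "h \<in> Arr C" "Dom C h = N" "Cod C h = B'"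
    and hn: "h \<cdot> nB = v" "h \<cdot> j0 = w"
    by (rule is_pushout_induced[OF N, of v w]) (use wu in auto)
  obtain c p N' where c: "c \<in> Cof" "p \<in> W"
    and [simp]: "c \<in> Arr C" "p \<in> Arr C" "Dom C c = N" "Cod C c = N'" "Dom C p = N'"
      "Cod C p = B'" "N' \<in> Obj C"
    and pc: "p \<cdot> c = h"
    by (rule factor_obtain[OF h(1)]) auto
  define j where "j = c \<cdot> j0"
  define n where "n = c \<cdot> nB"
  have [simp]: "j \<in> Arr C" "n \<in> Arr C" "Dom C j = A'" "Cod C j = N'" "Dom C n = B" "Cod C n = N'"
    by (simp_all add: j_def n_def)
  have pj: "p \<cdot> j = w" and pn: "p \<cdot> n = v" and nk: "n \<cdot> k = j \<cdot> u"
    by (simp_all add: j_def n_def Comp_reduce[OF pc] hn assoc nBk)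
  have j: "j \<in> Cof" "j \<in> W"
    using Cof_Comp[OF Cof_pushout[OF N k] c(1)] W_cancel_second[of p j] c w pj
    by (simp_all add: j_def)
  \<comment> \<open>The lift over \<open>B\<close> will be the restriction of \<open>x'\<close>
    along \<open>r \<cdot> n\<close>; it is strict on \<open>A\<close> because
    \<open>n \<cdot> k = j \<cdot> u\<close>.\<close>
  obtain r where [simp]: "r \<in> Arr C" "Dom C r = N'" "Cod C r = A'" and rj: "r \<cdot> j = Id C A'"
    by (rule extension_obtain[OF j, of "Id C A'"]) auto
  obtain t0 t1 T where T: "is_pushout C k k t0 t1"
    and [simp]: "t0 \<in> Arr C" "t1 \<in> Arr C" "Dom C t0 = B" "Dom C t1 = B" "Cod C t0 = T"
      "Cod C t1 = T"
    and t01: "t0 \<cdot> k = t1 \<cdot> k"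
    by (rule pushout_obtain[of k k]) auto
  obtain E cE pE where cE: "cE \<in> Cof" "cE \<cdot> t0 \<in> W" "cE \<cdot> t1 \<in> W"
    and [simp]: "cE \<in> Arr C" "pE \<in> Arr C" "Dom C cE = T" "Cod C cE = E" "Dom C pE = E"
      "Cod C pE = B"
    and pE: "pE \<cdot> cE \<cdot> t0 = Id C B" "pE \<cdot> cE \<cdot> t1 = Id C B"
    by (rule relative_cylinder[OF T Id_W[of B] Id_W[of B]]) auto
  \<comment> \<open>\<open>S\<close> is \<open>N'\<close> doubled along \<open>A'\<close>, as
    \<open>T\<close> is \<open>B\<close> doubled along \<open>A\<close>; the map
    \<open>m : T -> S\<close> obtained below is \<open>n\<close> on both copies.\<close>
  obtain s0 s1 S where S: "is_pushout C j j s0 s1"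
    and [simp]: "s0 \<in> Arr C" "s1 \<in> Arr C" "Dom C s0 = N'" "Dom C s1 = N'" "Cod C s0 = S"
      "Cod C s1 = S"
    and s01: "s0 \<cdot> j = s1 \<cdot> j"
    by (rule pushout_obtain[of j j]) auto
  obtain fold where [simp]: "fold \<in> Arr C" "Dom C fold = S" "Cod C fold = N'"
    and fold: "fold \<cdot> s0 = Id C N'" "fold \<cdot> s1 = Id C N'"
    by (rule is_pushout_induced[OF S, of "Id C N'" "Id C N'"]) auto
  have "s0 \<cdot> n \<cdot> k = s1 \<cdot> n \<cdot> k"
    unfolding nk using s01 by (simp add: assoc[symmetric])
  then obtain m where [simp]: "m \<in> Arr C" "Dom C m = T" "Cod C m = S"
    and m: "m \<cdot> t0 = s0 \<cdot> n" "m \<cdot> t1 = s1 \<cdot> n"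
    by (rule_tac is_pushout_induced[OF T, of "s0 \<cdot> n" "s1 \<cdot> n"]) (auto simp: assoc)
  \<comment> \<open>A cylinder on \<open>N'\<close> chosen independently need not receive
    \<open>E\<close>. So \<open>E\<close> is glued to \<open>S\<close> along \<open>T\<close> before
    factoring; then \<open>d : S -> E'\<close> is a cofibration and \<open>E\<close> maps to
    \<open>E'\<close> compatibly with the ends.\<close>
  obtain e d0 F where F: "is_pushout C cE m e d0"
    and [simp]: "e \<in> Arr C" "d0 \<in> Arr C" "Dom C e = E" "Dom C d0 = S" "Cod C e = F"
      "Cod C d0 = F"
    and ecE: "e \<cdot> cE = d0 \<cdot> m"
    by (rule pushout_obtain[of cE m]) auto
  have "n \<cdot> pE \<cdot> cE = fold \<cdot> m"
    by (rule is_pushout_unique[OF T]) (simp_all add: assoc m pE Comp_reduce[OF fold(1)] Comp_reduce[OF fold(2)])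
  then obtain g0 where g0 [simp]: "g0 \<in> Arr C" "Dom C g0 = F" "Cod C g0 = N'"
    and g0d: "g0 \<cdot> d0 = fold"
    by (rule_tac is_pushout_induced[OF F, of "n \<cdot> pE" fold]) (auto simp: assoc)
  obtain d1 q E' where d1: "d1 \<in> Cof" "q \<in> W"
    and [simp]: "d1 \<in> Arr C" "q \<in> Arr C" "Dom C d1 = F" "Cod C d1 = E'" "Dom C q = E'"
      "Cod C q = N'"
    and qd1: "q \<cdot> d1 = g0"
    by (rule factor_obtain[OF g0(1)]) auto
  define d where "d = d1 \<cdot> d0"
  define \<epsilon> where "\<epsilon> = d1 \<cdot> e"
  have [simp]: "d \<in> Arr C" "\<epsilon> \<in> Arr C" "Dom C d = S" "Cod C d = E'" "Dom C \<epsilon> = E" "Cod C \<epsilon> = E'"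
    by (simp_all add: d_def \<epsilon>_def)
  have \<epsilon>cE: "\<epsilon> \<cdot> cE = d \<cdot> m"
    by (simp add: d_def \<epsilon>_def assoc ecE)
  have qd: "q \<cdot> d = fold"
    by (simp add: d_def Comp_reduce[OF qd1] g0d)
  \<comment> \<open>As \<open>j\<close> is acyclic, so is its cobase change \<open>s0\<close>; since
    \<open>d \<cdot> s0\<close> is a weak equivalence too, \<open>d\<close> is an acyclic
    cofibration. Hence any two maps from \<open>N'\<close> to a fibrant object that agree on
    \<open>A'\<close> are homotopic.\<close>
  have "q \<cdot> d \<cdot> s0 = Id C N'"
    by (simp add: Comp_reduce[OF qd] fold)
  then have "d \<cdot> s0 \<in> W"
    using W_cancel_second[of q "d \<cdot> s0"] d1 Id_W[of N'] by simp
  moreover have "s0 \<in> W"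
    using acyclic_pushout'[OF S j] .
  ultimately have d: "d \<in> W" "d \<in> Cof"
    using W_cancel_first[of d s0] Cof_Comp[OF Cof_pushout[OF F cE(1)] d1(1)]
    by (simp_all add: d_def)
  \<comment> \<open>The two maps compared are \<open>j \<cdot> r\<close> and the identity of
    \<open>N'\<close>; the homotopy \<open>G\<close> between them is an extension along
    \<open>d\<close>.\<close>
  have "(j \<cdot> r) \<cdot> j = j"
    by (simp add: assoc rj)
  then obtain i where [simp]: "i \<in> Arr C" "Dom C i = S" "Cod C i = N'"
    and i: "i \<cdot> s0 = j \<cdot> r" "i \<cdot> s1 = Id C N'"
    by (rule_tac is_pushout_induced[OF S, of "j \<cdot> r" "Id C N'"]) auto
  obtain G where [simp]: "G \<in> Arr C" "Dom C G = E'" "Cod C G = N'" and Gd: "G \<cdot> d = i"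
    by (rule extension_obtain[OF d(2,1), of i]) auto
  \<comment> \<open>The homotopy \<open>G\<close>, restricted to \<open>E\<close> and followed by
    \<open>p\<close>. At the end \<open>t0\<close> it is \<open>w \<cdot> r \<cdot> n\<close>, so
    the relation between \<open>x'\<close> and \<open>y'\<close> turns the restriction into a value
    of \<open>f\<close>; at \<open>t1\<close> it is \<open>p \<cdot> n = v\<close>.\<close>
  define z where "z = Res Q (p \<cdot> G \<cdot> \<epsilon>) y'"
  have G\<epsilon>: "G \<cdot> \<epsilon> \<cdot> cE \<cdot> t0 = j \<cdot> r \<cdot> n" "G \<cdot> \<epsilon> \<cdot> cE \<cdot> t1 = n"
    by (simp_all add: Comp_reduce[OF \<epsilon>cE] assoc m Comp_reduce[OF Gd] Comp_reduce[OF i(1)]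
      Comp_reduce[OF i(2)])
  have z [simp]: "z \<in> El Q E"
    by (simp add: z_def)
  have res: "Res Q a z = Res Q (p \<cdot> G \<cdot> \<epsilon> \<cdot> a) y'" if "a \<in> Arr C" "Cod C a = E" for a
    using that Q.Res_Comp[of a "p \<cdot> G \<cdot> \<epsilon>" y'] by (simp add: z_def assoc)
  have z0: "Res Q (cE \<cdot> t0) z = f B (Res P (r \<cdot> n) x')"
  proof -
    have "Res Q (cE \<cdot> t0) z = Res Q (w \<cdot> r \<cdot> n) y'"
      by (simp add: res G\<epsilon> Comp_reduce[OF pj])
    also have "\<dots> = Res Q (r \<cdot> n) (f A' x')"
      using Q.Res_Comp[of "r \<cdot> n" w y'] wy' by simp
    also have "\<dots> = f B (Res P (r \<cdot> n) x')"
      using natural'[of "r \<cdot> n" B A' x'] by simp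
    finally show ?thesis .
  qed
  have z1: "Res Q (cE \<cdot> t1) z = y"
    by (simp add: res G\<epsilon> pn vy')
  have l: "Res P k (Res P (r \<cdot> n) x') = x"
  proof -
    have "(r \<cdot> n) \<cdot> k = u"
      by (simp add: assoc nk Comp_reduce[OF rj])
    then show ?thesis
      using P.Res_Comp[of k "r \<cdot> n" x'] ux' by simp
  qed
  show "\<exists>l\<in>El P (Cod C k). \<exists>E. \<exists>e0\<in>W \<inter> Hom C (Cod C k) E. \<exists>e1\<in>W \<inter> Hom C (Cod C k) E.
    \<exists>z\<in>El Q E. e0 \<cdot> k = e1 \<cdot> k \<and> Res P k l = x \<and> Res Q e0 z = f (Cod C k) l \<and> Res Q e1 z = y"
    by (rule bexI[of _ "Res P (r \<cdot> n) x'"], rule exI[of _ E], rule bexI[of _ "cE \<cdot> t0"],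
      rule bexI[of _ "cE \<cdot> t1"], rule bexI[of _ z])
      (use z0 z1 l cE t01 in \<open>auto simp: Hom_iff assoc\<close>)
qed

text \<open>Write \<open>a\<close> as a cofibration \<open>k : A -> M\<close> followed by a weak
  equivalence \<open>p : M -> B\<close>, and lift along \<open>k\<close> to \<open>l\<close> over
  \<open>M\<close>, with a homotopy from \<open>f l\<close> to the restriction of \<open>y\<close>
  along \<open>p\<close>. Gluing \<open>B\<close> along \<open>p\<close> to the end of the cylinder
  that carries \<open>y\<close> yields \<open>D\<close>; the other end \<open>M -> D\<close> is the
  weak equivalence sought. The square commutes strictly because the homotopy is relative to
  \<open>A\<close>.\<close>

lemma homotopy_lifting_imp_W_cofinal:
  assumes f: "presheaf_map C P Q f" and H: "homotopy_lifting C Cof W P Q f"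
  shows "W_cofinal C W P Q f"
  unfolding W_cofinal_def
proof (intro ballI impI)
  fix a x y
  assume a: "a \<in> Arr C" and "x \<in> El P (Dom C a)" and "y \<in> El Q (Cod C a)"
    and "f (Dom C a) x = Res Q a y"
  moreover define A B where "A = Dom C a" and "B = Cod C a"
  ultimately have xy [simp]: "x \<in> El P A" "y \<in> El Q B" and sq: "f A x = Res Q a y"
    and a' [simp]: "a \<in> Arr C" "Dom C a = A" "Cod C a = B"
    by auto
  interpret presheaf_map C P Q f by fact
  obtain k p M where k: "k \<in> Cof" "p \<in> W"
    and k' [simp]: "k \<in> Arr C" "p \<in> Arr C" "Dom C k = A" "Cod C k = M" "Dom C p = M"
      "Cod C p = B"
    and pk: "p \<cdot> k = a"
    by (rule factor_obtain[OF a'(1)]) auto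
  obtain s0 s1 where S: "is_pushout C k k s0 s1"
    by (rule pushout_obtain[of k k]) auto
  note [simp] = is_pushoutD(1-8)[OF S]
  have "f A x = Res Q k (Res Q p y)"
    using Q.Res_Comp[of k p y] sq pk by simp
  then obtain l E c z where l [simp]: "l \<in> El P M" and c: "c \<in> Cof" "c \<cdot> s0 \<in> W" "c \<cdot> s1 \<in> W"
    and [simp]: "c \<in> Arr C" "Dom C c = Cod C s0" "Cod C c = E" and z [simp]: "z \<in> El Q E"
    and kl: "Res P k l = x" and z01: "Res Q (c \<cdot> s0) z = f M l" "Res Q (c \<cdot> s1) z = Res Q p y"
    by (rule_tac homotopy_liftingE'[OF H f S k(1), of A M x "Res Q p y"]) auto
  have "s1 \<in> Cof"
    using Cof_pushout[OF S k(1)] .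
  then have e1: "c \<cdot> s1 \<in> Cof"
    using Cof_Comp c by simp
  obtain t b D where D: "is_pushout C (c \<cdot> s1) p t b"
    and [simp]: "t \<in> Arr C" "b \<in> Arr C" "Dom C t = E" "Dom C b = B" "Cod C t = D" "Cod C b = D"
    and tb: "t \<cdot> c \<cdot> s1 = b \<cdot> p"
    by (rule pushout_obtain[of "c \<cdot> s1" p]) auto
  \<comment> \<open>\<open>b\<close> is a cobase change of the acyclic cofibration
    \<open>c \<cdot> s1\<close>; two out of three then gives \<open>t\<close>.\<close>
  have "b \<cdot> p \<in> W"
    using W_Comp[of p b] k(2) acyclic_pushout[OF D e1 c(3)] by simp
  then have "t \<in> W"
    using W_cancel_first[of t "c \<cdot> s1"] c(3) tb by simp
  then have w: "t \<cdot> c \<cdot> s0 \<in> W"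
    using W_Comp[of "c \<cdot> s0" t] c(2) by simp
  obtain y' where y' [simp]: "y' \<in> El Q D" and y'tb: "Res Q t y' = z" "Res Q b y' = y"
    using Q.glue[OF D, of z y] z01 by auto
  have sk: "s0 \<cdot> k = s1 \<cdot> k"
    using is_pushoutD(9)[OF S] .
  have "(t \<cdot> c \<cdot> s0) \<cdot> k = (t \<cdot> c \<cdot> s1) \<cdot> k"
    by (simp add: assoc sk)
  also have "\<dots> = b \<cdot> a"
    unfolding tb by (simp add: assoc pk)
  finally have wk: "(t \<cdot> c \<cdot> s0) \<cdot> k = b \<cdot> a" .
  have "Res Q (t \<cdot> c \<cdot> s0) y' = f M l"
    using Q.Res_Comp[of "c \<cdot> s0" t y'] y'tb z01 by simp
  then show "\<exists>w\<in>W. \<exists>u\<in>Hom C (Dom C a) (Dom C w). \<exists>v\<in>Hom C (Cod C a) (Cod C w).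
    \<exists>x'\<in>El P (Dom C w). \<exists>y'\<in>El Q (Cod C w).
      w \<cdot> u = v \<cdot> a \<and> Res P u x' = x \<and> Res Q v y' = y \<and> f (Dom C w) x' = Res Q w y'"
    by (intro bexI[of _ "t \<cdot> c \<cdot> s0"] bexI[of _ k] bexI[of _ b] bexI[of _ l] bexI[of _ y'])
      (use w wk kl y'tb in \<open>auto simp: Hom_iff\<close>)
qed


text \<open>Lifting along \<open>g\<close> comes first and gives \<open>m\<close> over
  \<open>B\<close>, which extends \<open>f A x\<close> strictly; this is a lifting problem for
  \<open>f\<close>, solved by \<open>l\<close>. The image under \<open>g\<close> of the homotopy
  \<open>f l ~ m\<close> is concatenated with the homotopy \<open>g m ~ y\<close> by gluing the two
  cylinders along the ends that carry \<open>m\<close>.\<close>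

lemma homotopy_lifting_comp:
  assumes f: "presheaf_map C P Q f" "homotopy_lifting C Cof W P Q f"
    and g: "presheaf_map C Q R g" "homotopy_lifting C Cof W Q R g"
  shows "homotopy_lifting C Cof W P R (\<lambda>A x. g A (f A x))"
  unfolding homotopy_lifting_def
proof (intro ballI impI)
  fix k x y
  assume k: "k \<in> Cof" and "x \<in> El P (Dom C k)" and "y \<in> El R (Cod C k)"
    and "g (Dom C k) (f (Dom C k) x) = Res R k y"
  moreover define A B where "A = Dom C k" and "B = Cod C k"
  ultimately have xy [simp]: "x \<in> El P A" "y \<in> El R B" and sq: "g A (f A x) = Res R k y"
    and k' [simp]: "k \<in> Arr C" "Dom C k = A" "Cod C k = B"
    by (auto simp: Cof_Arr)
  interpret f: presheaf_map C P Q f by fact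
  interpret g: presheaf_map C Q R g by fact
  have [simp]: "A \<in> Obj C" "B \<in> Obj C"
    using dom_in_Obj[OF k'(1)] cod_in_Obj[OF k'(1)] by simp_all
  obtain s0 s1 where S: "is_pushout C k k s0 s1"
    by (rule pushout_obtain[of k k]) auto
  note [simp] = is_pushoutD(1-8)[OF S]
  obtain m E2 c2 z2 where m [simp]: "m \<in> El Q B"
    and c2: "c2 \<in> Cof" "c2 \<cdot> s0 \<in> W" "c2 \<cdot> s1 \<in> W"
    and [simp]: "c2 \<in> Arr C" "Dom C c2 = Cod C s0" "Cod C c2 = E2" "z2 \<in> El R E2"
    and km: "Res Q k m = f A x"
    and z2: "Res R (c2 \<cdot> s0) z2 = g B m" "Res R (c2 \<cdot> s1) z2 = y"
    by (rule homotopy_liftingE'[OF g(2,1) S k, of A B "f A x" y]) (use sq in auto)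
  obtain l E1 c1 z1 where l [simp]: "l \<in> El P B"
    and c1: "c1 \<in> Cof" "c1 \<cdot> s0 \<in> W" "c1 \<cdot> s1 \<in> W"
    and [simp]: "c1 \<in> Arr C" "Dom C c1 = Cod C s0" "Cod C c1 = E1" "E1 \<in> Obj C"
      "z1 \<in> El Q E1"
    and kl: "Res P k l = x"
    and z1: "Res Q (c1 \<cdot> s0) z1 = f B l" "Res Q (c1 \<cdot> s1) z1 = m"
    by (rule homotopy_liftingE'[OF f(2,1) S k, of A B x m]) (use km in auto)
  have s: "s0 \<in> Cof" "s1 \<in> Cof"
    using Cof_pushout'[OF S k] Cof_pushout[OF S k] .
  then have cof: "c1 \<cdot> s1 \<in> Cof" "c2 \<cdot> s0 \<in> Cof"
    using Cof_Comp c1 c2 by simp_all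
  obtain t1 t2 D where D: "is_pushout C (c1 \<cdot> s1) (c2 \<cdot> s0) t1 t2"
    and [simp]: "t1 \<in> Arr C" "t2 \<in> Arr C" "Dom C t1 = E1" "Dom C t2 = E2" "Cod C t1 = D"
      "Cod C t2 = D"
    and t: "t1 \<cdot> c1 \<cdot> s1 = t2 \<cdot> c2 \<cdot> s0"
    by (rule pushout_obtain[of "c1 \<cdot> s1" "c2 \<cdot> s0"]) auto
  \<comment> \<open>The glued ends are acyclic cofibrations, so both cylinders include into
    \<open>D\<close> by weak equivalences and the outer ends stay in \<open>W\<close>.\<close>
  have "t1 \<in> W" "t2 \<in> W"
    using acyclic_pushout'[OF D cof(2) c2(2)] acyclic_pushout[OF D cof(1) c1(3)] .
  then have W: "t1 \<cdot> c1 \<cdot> s0 \<in> W" "t2 \<cdot> c2 \<cdot> s1 \<in> W"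
    using W_Comp c1 c2 by simp_all
  have "Res R (c1 \<cdot> s1) (g E1 z1) = Res R (c2 \<cdot> s0) z2"
    using g.natural'[of "c1 \<cdot> s1" B E1 z1] z1 z2 by simp
  then obtain z where z [simp]: "z \<in> El R D" and zt: "Res R t1 z = g E1 z1" "Res R t2 z = z2"
    using g.Q.glue[OF D, of "g E1 z1" z2] by auto
  have "Res R (t1 \<cdot> c1 \<cdot> s0) z = g B (f B l)"
    using g.Q.Res_Comp[of "c1 \<cdot> s0" t1 z] g.natural'[of "c1 \<cdot> s0" B E1 z1] zt z1 by simp
  moreover have "Res R (t2 \<cdot> c2 \<cdot> s1) z = y"
    using g.Q.Res_Comp[of "c2 \<cdot> s1" t2 z] zt z2 by simp
  moreover have "(t1 \<cdot> c1 \<cdot> s0) \<cdot> k = (t2 \<cdot> c2 \<cdot> s1) \<cdot> k"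
  proof -
    have "(t1 \<cdot> c1 \<cdot> s0) \<cdot> k = (t1 \<cdot> c1 \<cdot> s1) \<cdot> k"
      by (simp add: assoc is_pushoutD(9)[OF S])
    then show ?thesis
      unfolding t by (simp add: assoc is_pushoutD(9)[OF S])
  qed
  ultimately show "\<exists>l\<in>El P (Cod C k). \<exists>E. \<exists>e0\<in>W \<inter> Hom C (Cod C k) E.
    \<exists>e1\<in>W \<inter> Hom C (Cod C k) E. \<exists>z\<in>El R E. e0 \<cdot> k = e1 \<cdot> k \<and> Res P k l = x \<and>
      Res R e0 z = g (Cod C k) (f (Cod C k) l) \<and> Res R e1 z = y"
    by (intro bexI[of _ l] exI[of _ D] bexI[of _ "t1 \<cdot> c1 \<cdot> s0"] bexI[of _ "t2 \<cdot> c2 \<cdot> s1"]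
        bexI[of _ z]) (use kl W in \<open>auto simp: Hom_iff\<close>)
qed

text \<open>The ends \<open>f l\<close> and \<open>y\<close> agree over \<open>A\<close>, hence form
  one element \<open>s\<close> over \<open>B\<close> doubled along \<open>A\<close>, and the
  homotopy \<open>z\<close> extends \<open>g s\<close> to the cylinder \<open>E\<close>. This is a
  lifting problem for \<open>g\<close> along the cofibration \<open>c\<close>. Its solution
  \<open>z'\<close> restricts to \<open>s\<close> exactly, so it is a homotopy from
  \<open>f l\<close> to \<open>y\<close>; how \<open>g z'\<close> compares with \<open>z\<close>
  does not matter.\<close>

lemma homotopy_lifting_cancel:
  assumes f: "presheaf_map C P Q f"
    and g: "presheaf_map C Q R g" "homotopy_lifting C Cof W Q R g"
    and gf: "homotopy_lifting C Cof W P R (\<lambda>A x. g A (f A x))"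
  shows "homotopy_lifting C Cof W P Q f"
  unfolding homotopy_lifting_def
proof (intro ballI impI)
  fix k x y
  assume k: "k \<in> Cof" and "x \<in> El P (Dom C k)" and "y \<in> El Q (Cod C k)"
    and "f (Dom C k) x = Res Q k y"
  moreover define A B where "A = Dom C k" and "B = Cod C k"
  ultimately have xy [simp]: "x \<in> El P A" "y \<in> El Q B" and sq: "f A x = Res Q k y"
    and k' [simp]: "k \<in> Arr C" "Dom C k = A" "Cod C k = B"
    by (auto simp: Cof_Arr)
  interpret f: presheaf_map C P Q f by fact
  interpret g: presheaf_map C Q R g by fact
  have [simp]: "A \<in> Obj C" "B \<in> Obj C"
    using dom_in_Obj[OF k'(1)] cod_in_Obj[OF k'(1)] by simp_all
  obtain s0 s1 where S: "is_pushout C k k s0 s1"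
    by (rule pushout_obtain[of k k]) auto
  note [simp] = is_pushoutD(1-8)[OF S]
  obtain l E c z where l [simp]: "l \<in> El P B"
    and c: "c \<in> Cof" "c \<cdot> s0 \<in> W" "c \<cdot> s1 \<in> W"
    and [simp]: "c \<in> Arr C" "Dom C c = Cod C s0" "Cod C c = E" "z \<in> El R E"
    and kl: "Res P k l = x"
    and z: "Res R (c \<cdot> s0) z = g B (f B l)" "Res R (c \<cdot> s1) z = g B y"
    by (rule homotopy_liftingE'[OF gf presheaf_map_comp[OF f g(1)] S k, of A B x "g B y"])
      (use sq g.natural'[of k A B y] in auto)
  have "Res Q k (f B l) = Res Q k y"
    using f.natural'[of k A B l] kl sq by simp
  then obtain s where s [simp]: "s \<in> El Q (Cod C s0)" and ss: "Res Q s0 s = f B l" "Res Q s1 s = y"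
    using f.Q.glue[OF S, of "f B l" y] by auto
  have "Cod C s0 \<in> Obj C"
    using cod_in_Obj[of s0] by simp
  have "g (Cod C s0) s = Res R c z"
  proof (rule g.Q.separated[OF S])
    show "Res R s0 (g (Cod C s0) s) = Res R s0 (Res R c z)"
      using z ss g.natural'[of s0 B "Cod C s0" s] g.Q.Res_Comp[of s0 c z] by simp
    show "Res R s1 (g (Cod C s0) s) = Res R s1 (Res R c z)"
      using z ss g.natural'[of s1 B "Cod C s0" s] g.Q.Res_Comp[of s1 c z] by simp
  qed (use \<open>Cod C s0 \<in> Obj C\<close> in auto)
  then obtain z' where z' [simp]: "z' \<in> El Q E" and cz': "Res Q c z' = s"
    by (rule_tac homotopy_liftingE[OF g(2) c(1), of "Cod C s0" E s z]) auto
  have "Res Q (c \<cdot> s0) z' = f B l" "Res Q (c \<cdot> s1) z' = y"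
    using f.Q.Res_Comp[of s0 c z'] f.Q.Res_Comp[of s1 c z'] cz' ss by simp_all
  moreover have "(c \<cdot> s0) \<cdot> k = (c \<cdot> s1) \<cdot> k"
    by (simp add: assoc is_pushoutD(9)[OF S])
  ultimately show "\<exists>l\<in>El P (Cod C k). \<exists>E. \<exists>e0\<in>W \<inter> Hom C (Cod C k) E.
    \<exists>e1\<in>W \<inter> Hom C (Cod C k) E. \<exists>z\<in>El Q E. e0 \<cdot> k = e1 \<cdot> k \<and> Res P k l = x \<and>
      Res Q e0 z = f (Cod C k) l \<and> Res Q e1 z = y"
    by (intro bexI[of _ l] exI[of _ E] bexI[of _ "c \<cdot> s0"] bexI[of _ "c \<cdot> s1"] bexI[of _ z'])
      (use kl c in \<open>auto simp: Hom_iff\<close>)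
qed

section \<open>Two out of three for cofinality of weak equivalences\<close>

lemma W_cofinal_comp:
  assumes "presheaf_map C P Q f" "presheaf_map C Q R g" "W_cofinal C W P Q f" "W_cofinal C W Q R g"
  shows "W_cofinal C W P R (\<lambda>A x. g A (f A x))"
  by (rule homotopy_lifting_imp_W_cofinal[OF presheaf_map_comp[OF assms(1,2)]
      homotopy_lifting_comp[OF assms(1) W_cofinal_imp_homotopy_lifting[OF assms(1,3)]
        assms(2) W_cofinal_imp_homotopy_lifting[OF assms(2,4)]]])

lemma W_cofinal_cancel_second:
  assumes "presheaf_map C P Q f" "presheaf_map C Q R g" "W_cofinal C W Q R g"
    "W_cofinal C W P R (\<lambda>A x. g A (f A x))"
  shows "W_cofinal C W P Q f"
  by (rule homotopy_lifting_imp_W_cofinal[OF assms(1)], rule homotopy_lifting_cancel[OF assms(1,2)])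
    (use assms W_cofinal_imp_homotopy_lifting presheaf_map_comp[OF assms(1,2)] in auto)

text \<open>Cofinality for \<open>f\<close> extends \<open>y\<close> to the target of a weak
  equivalence \<open>w1 : A1 -> B1\<close> on whose source it comes from \<open>x1\<close>. Once
  \<open>w1\<close> is turned into an acyclic cofibration \<open>j : A1 -> M\<close>, cofinality for
  the composite can be applied to a square that starts at \<open>A1\<close>, and cobase change of
  \<open>j\<close> carries the resulting weak equivalence back to one whose source receives
  \<open>M\<close>.\<close>

lemma W_cofinal_cancel_first:
  assumes f: "presheaf_map C P Q f" "W_cofinal C W P Q f"
    and g: "presheaf_map C Q R g"
    and gf: "W_cofinal C W P R (\<lambda>A x. g A (f A x))"
  shows "W_cofinal C W Q R g"
  unfolding W_cofinal_def
proof (intro ballI impI)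
  fix b y z
  assume b: "b \<in> Arr C" and "y \<in> El Q (Dom C b)" and "z \<in> El R (Cod C b)"
    and "g (Dom C b) y = Res R b z"
  moreover define B D where "B = Dom C b" and "D = Cod C b"
  ultimately have yz [simp]: "y \<in> El Q B" "z \<in> El R D" and sq: "g B y = Res R b z"
    and b' [simp]: "b \<in> Arr C" "Dom C b = B" "Cod C b = D"
    by auto
  interpret f: presheaf_map C P Q f by fact
  interpret g: presheaf_map C Q R g by fact
  have [simp]: "B \<in> Obj C"
    using dom_in_Obj[OF b'(1)] by simp
  \<comment> \<open>Each presheaf has exactly one element over the initial object, so the map
    \<open>Z -> B\<close> lies over \<open>f\<close> for free.\<close>
  obtain Z where Z: "is_initial C Z"
    using initial_exists[OF finite_colimits] by blast
  then have [simp]: "Z \<in> Obj C"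
    by (simp add: is_initial_def)
  obtain zB where [simp]: "zB \<in> Arr C" "Dom C zB = Z" "Cod C zB = B"
    by (rule initial_arrow[OF Z \<open>B \<in> Obj C\<close>])
  obtain x0 where [simp]: "x0 \<in> El P Z"
    using f.P.initial_El[OF Z] by blast
  have "f Z x0 = Res Q zB y"
    by (rule f.Q.initial_El_unique[OF Z]) simp_all
  then obtain w1 u1 v1 A1 B1 x1 y1 where w1: "w1 \<in> W"
    and [simp]: "v1 \<in> Arr C" "Dom C w1 = A1" "Cod C w1 = B1" "Dom C v1 = B" "Cod C v1 = B1"
    and [simp]: "x1 \<in> El P A1" "y1 \<in> El Q B1"
    and vy1: "Res Q v1 y1 = y" and wy1: "f A1 x1 = Res Q w1 y1"
    by (rule_tac W_cofinalE[OF f(2), of zB Z B x0 y]) auto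
  have w1' [simp]: "w1 \<in> Arr C"
    using w1 by (rule W_Arr)
  have [simp]: "A1 \<in> Obj C" "B1 \<in> Obj C"
    using dom_in_Obj[of w1] cod_in_Obj[of w1] by simp_all
  obtain zA where [simp]: "zA \<in> Arr C" "Dom C zA = Z" "Cod C zA = A1"
    by (rule initial_arrow[OF Z \<open>A1 \<in> Obj C\<close>])
  obtain zB1 where [simp]: "zB1 \<in> Arr C" "Dom C zB1 = Z" "Cod C zB1 = B1"
    by (rule initial_arrow[OF Z \<open>B1 \<in> Obj C\<close>])
  \<comment> \<open>\<open>R0\<close> is the sum of \<open>A1\<close> and \<open>B1\<close>, and
    factoring the map \<open>h\<close> that is \<open>w1\<close> and the identity on it gives a
    mapping cylinder \<open>M\<close> of \<open>w1\<close>: \<open>A1\<close> enters by a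
    cofibration because \<open>B1\<close> is cofibrant, and \<open>s : B1 -> M\<close> is a section
    of \<open>p\<close>.\<close>
  obtain iA iB R0 where R0: "is_pushout C zA zB1 iA iB"
    and [simp]: "iA \<in> Arr C" "iB \<in> Arr C" "Dom C iA = A1" "Dom C iB = B1" "Cod C iA = R0"
      "Cod C iB = R0"
    by (rule pushout_obtain[of zA zB1]) auto
  have "zB1 \<in> Cof"
    using all_cofibrant[of B1] Z by (auto simp: cofibrant_def Hom_iff)
  then have iA: "iA \<in> Cof"
    by (rule Cof_pushout'[OF R0])
  obtain h where h [simp]: "h \<in> Arr C" "Dom C h = R0" "Cod C h = B1"
    and hi: "h \<cdot> iA = w1" "h \<cdot> iB = Id C B1"
    by (rule is_pushout_induced[OF R0, of w1 "Id C B1"])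
      (auto intro: initial_arrow_unique[OF Z])
  obtain c p M where c: "c \<in> Cof" "p \<in> W"
    and [simp]: "c \<in> Arr C" "p \<in> Arr C" "Dom C c = R0" "Cod C c = M" "Dom C p = M"
      "Cod C p = B1"
    and pc: "p \<cdot> c = h"
    by (rule factor_obtain[OF h(1)]) auto
  define j where "j = c \<cdot> iA"
  define s where "s = c \<cdot> iB"
  have [simp]: "j \<in> Arr C" "s \<in> Arr C" "Dom C j = A1" "Cod C j = M" "Dom C s = B1" "Cod C s = M"
    by (simp_all add: j_def s_def)
  have pj: "p \<cdot> j = w1" and ps: "p \<cdot> s = Id C B1"
    by (simp_all add: j_def s_def Comp_reduce[OF pc] hi)
  have j: "j \<in> Cof" "j \<in> W"
    using Cof_Comp[OF iA c(1)] W_cancel_second[of p j] c w1 pj by (simp_all add: j_def)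
  define y2 where "y2 = Res Q p y1"
  have y2 [simp]: "y2 \<in> El Q M"
    by (simp add: y2_def)
  have jy2: "Res Q j y2 = f A1 x1"
    using f.Q.Res_Comp[of j p y1] pj wy1 by (simp add: y2_def)
  have sy2: "Res Q (s \<cdot> v1) y2 = y"
    using f.Q.Res_Comp[of "s \<cdot> v1" p y1] vy1 by (simp add: y2_def Comp_reduce[OF ps])
  have [simp]: "M \<in> Obj C"
    using cod_in_Obj[of c] by simp
  \<comment> \<open>\<open>C1\<close> is \<open>D\<close> glued to \<open>M\<close> along
    \<open>B\<close>, and \<open>z1\<close> over it restricts to \<open>g y2\<close> and to
    \<open>z\<close>. Since \<open>j\<close> pulls \<open>y2\<close> back to \<open>f x1\<close>,
    the arrow \<open>q \<cdot> j\<close> lies over the composite.\<close>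
  obtain q d C1 where C1: "is_pushout C (s \<cdot> v1) b q d"
    and [simp]: "q \<in> Arr C" "d \<in> Arr C" "Dom C q = M" "Dom C d = D" "Cod C q = C1"
      "Cod C d = C1"
    and qd: "q \<cdot> s \<cdot> v1 = d \<cdot> b"
    by (rule pushout_obtain[of "s \<cdot> v1" b]) (auto simp: assoc)
  have "Res R (s \<cdot> v1) (g M y2) = Res R b z"
    using g.natural'[of "s \<cdot> v1" B M y2] sy2 sq by simp
  then obtain z1 where z1 [simp]: "z1 \<in> El R C1"
    and z1r: "Res R q z1 = g M y2" "Res R d z1 = z"
    using g.Q.glue[OF C1, of "g M y2" z] by auto
  have "g A1 (f A1 x1) = Res R (q \<cdot> j) z1"
    using g.Q.Res_Comp[of j q z1] z1r g.natural'[of j A1 M y2] jy2 by simp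
  then obtain w2 u2 v2 A2 C2 x2 z2 where w2: "w2 \<in> W"
    and u2 [simp]: "u2 \<in> Arr C" "v2 \<in> Arr C" "Dom C w2 = A2" "Cod C w2 = C2" "Dom C u2 = A1"
      "Cod C u2 = A2" "Dom C v2 = C1" "Cod C v2 = C2"
    and [simp]: "x2 \<in> El P A2" "z2 \<in> El R C2"
    and wu2: "w2 \<cdot> u2 = v2 \<cdot> q \<cdot> j" and ux2: "Res P u2 x2 = x1" and vz2: "Res R v2 z2 = z1"
    and wz2: "g A2 (f A2 x2) = Res R w2 z2"
    by (rule_tac W_cofinalE[OF gf, of "q \<cdot> j" A1 C1 x1 z1]) auto
  have [simp]: "w2 \<in> Arr C"
    using w2 by (rule W_Arr)
  have [simp]: "A2 \<in> Obj C"
    using dom_in_Obj[of w2] by simp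
  obtain i \<pi> N where i: "i \<in> Cof" "\<pi> \<in> W"
    and [simp]: "i \<in> Arr C" "\<pi> \<in> Arr C" "Dom C i = A1" "Cod C i = N" "Dom C \<pi> = N"
      "Cod C \<pi> = A2" "N \<in> Obj C"
    and \<pi>i: "\<pi> \<cdot> i = u2"
    by (rule factor_obtain[OF u2(1)]) auto
  \<comment> \<open>\<open>M\<close> is put back by gluing it to \<open>N\<close> along
    \<open>A1\<close>. As a cobase change of \<open>j\<close>, the map \<open>n\<close> is a weak
    equivalence, and \<open>\<omega> \<cdot> n = w2 \<cdot> \<pi>\<close> makes
    \<open>\<omega>\<close> one; it is the weak equivalence over \<open>g\<close> that was to be
    found.\<close>
  obtain m n B2 where B2: "is_pushout C j i m n"
    and [simp]: "m \<in> Arr C" "n \<in> Arr C" "Dom C m = M" "Dom C n = N" "Cod C m = B2"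
      "Cod C n = B2" "B2 \<in> Obj C"
    by (rule pushout_obtain[of j i]) auto
  have "(v2 \<cdot> q) \<cdot> j = (w2 \<cdot> \<pi>) \<cdot> i"
    by (simp add: assoc \<pi>i wu2)
  then obtain \<omega> where [simp]: "\<omega> \<in> Arr C" "Dom C \<omega> = B2" "Cod C \<omega> = C2"
    and \<omega>: "\<omega> \<cdot> m = v2 \<cdot> q" "\<omega> \<cdot> n = w2 \<cdot> \<pi>"
    by (rule_tac is_pushout_induced[OF B2, of "v2 \<cdot> q" "w2 \<cdot> \<pi>"]) auto
  have "n \<in> W"
    using acyclic_pushout[OF B2 j] .
  then have \<omega>W: "\<omega> \<in> W"
    using W_cancel_first[of \<omega> n] W_Comp[of \<pi> w2] i w2 \<omega> by simp
  have "Res Q i (f N (Res P \<pi> x2)) = f A1 x1"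
    using f.natural'[of i A1 N "Res P \<pi> x2"] f.P.Res_Comp[of i \<pi> x2] \<pi>i ux2 by simp
  then obtain y' where y' [simp]: "y' \<in> El Q B2"
    and y'r: "Res Q m y' = y2" "Res Q n y' = f N (Res P \<pi> x2)"
    using f.Q.glue[OF B2, of y2 "f N (Res P \<pi> x2)"] jy2 by auto
  have gy': "g B2 y' = Res R \<omega> z2"
  proof (rule g.Q.separated[OF B2])
    show "Res R m (g B2 y') = Res R m (Res R \<omega> z2)"
      using g.natural'[of m M B2 y'] y'r g.Q.Res_Comp[of m \<omega> z2] g.Q.Res_Comp[of q v2 z2]
        \<omega> vz2 z1r by simp
    show "Res R n (g B2 y') = Res R n (Res R \<omega> z2)"
      using g.natural'[of n N B2 y'] y'r g.Q.Res_Comp[of n \<omega> z2] g.Q.Res_Comp[of \<pi> w2 z2]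
        \<omega> wz2 f.natural'[of \<pi> N A2 x2] g.natural'[of \<pi> N A2 "f A2 x2"] by simp
  qed auto
  have "\<omega> \<cdot> m \<cdot> s \<cdot> v1 = v2 \<cdot> q \<cdot> s \<cdot> v1"
    by (simp add: Comp_reduce[OF \<omega>(1)] assoc)
  then have "\<omega> \<cdot> m \<cdot> s \<cdot> v1 = (v2 \<cdot> d) \<cdot> b"
    by (simp add: qd assoc)
  moreover have "Res Q (m \<cdot> s \<cdot> v1) y' = y"
    using f.Q.Res_Comp[of "s \<cdot> v1" m y'] y'r sy2 by simp
  moreover have "Res R (v2 \<cdot> d) z2 = z"
    using g.Q.Res_Comp[of d v2 z2] vz2 z1r by simp
  ultimately show "\<exists>w\<in>W. \<exists>u\<in>Hom C (Dom C b) (Dom C w). \<exists>v\<in>Hom C (Cod C b) (Cod C w).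
    \<exists>x'\<in>El Q (Dom C w). \<exists>y'\<in>El R (Cod C w).
      w \<cdot> u = v \<cdot> b \<and> Res Q u x' = y \<and> Res R v y' = z \<and> g (Dom C w) x' = Res R w y'"
    using gy' \<omega>W
    by (intro bexI[of _ \<omega>] bexI[of _ "m \<cdot> s \<cdot> v1"] bexI[of _ "v2 \<cdot> d"] bexI[of _ y']
        bexI[of _ z2]) (auto simp: Hom_iff)
qed

end

section \<open>Maps from objects to ind-objects\<close>

locale ind_object = category C for C :: "('o, 'a) cat" +
  fixes J :: "('i, 'i) cat" and Y :: "('i, 'i, 'o, 'a) func"
  assumes filtered_J: "filtered_category J" and functor_Y: "is_functor J C Y"
begin

sublocale J: category J
  using filtered_J unfolding filtered_category_def by simp

abbreviation cls :: "'o \<Rightarrow> 'i \<Rightarrow> 'a \<Rightarrow> ('i \<times> 'a) set" where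
  "cls A t \<phi> \<equiv> colim_class C A (J, Y) (t, \<phi>)"

text \<open>Well-formedness of a representative. \<open>equivclp\<close> is reflexive on all pairs,
  so \<open>colim_class\<close> is defined for ill-typed pairs as well, and typing has to be tracked
  separately.\<close>

definition germ :: "'o \<Rightarrow> 'i \<Rightarrow> 'a \<Rightarrow> bool" where
  "germ A t \<phi> \<longleftrightarrow> t \<in> Obj J \<and> \<phi> \<in> Arr C \<and> Dom C \<phi> = A \<and> Cod C \<phi> = FObj Y t"

lemma germD: "germ A t \<phi> \<Longrightarrow> t \<in> Obj J" "germ A t \<phi> \<Longrightarrow> \<phi> \<in> Arr C" "germ A t \<phi> \<Longrightarrow> Dom C \<phi> = A"
    "germ A t \<phi> \<Longrightarrow> Cod C \<phi> = FObj Y t"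
  by (auto simp: germ_def)

lemma FObj_in [simp]: "t \<in> Obj J \<Longrightarrow> FObj Y t \<in> Obj C"
  using functor_Y by (simp add: is_functor_def)

lemma FArr_simps [simp]:
  assumes "u \<in> Arr J"
  shows "FArr Y u \<in> Arr C" "Dom C (FArr Y u) = FObj Y (Dom J u)"
    "Cod C (FArr Y u) = FObj Y (Cod J u)"
  using functor_Y assms by (auto simp: is_functor_def Hom_iff)

lemma FArr_Id [simp]: "t \<in> Obj J \<Longrightarrow> FArr Y (Id J t) = Id C (FObj Y t)"
  using functor_Y by (simp add: is_functor_def)

lemma FArr_Comp: "\<lbrakk>u \<in> Arr J; v \<in> Arr J; Dom J v = Cod J u\<rbrakk> \<Longrightarrow>
    FArr Y (Comp J v u) = FArr Y v \<cdot> FArr Y u"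
  using functor_Y by (simp add: is_functor_def)

lemma germ_shift: "\<lbrakk>germ A t \<phi>; u \<in> Arr J; Dom J u = t\<rbrakk> \<Longrightarrow> germ A (Cod J u) (FArr Y u \<cdot> \<phi>)"
  by (simp add: germ_def J.cod_in_Obj)

lemma germ_precomp: "\<lbrakk>germ B t \<phi>; a \<in> Arr C; Dom C a = A; Cod C a = B\<rbrakk> \<Longrightarrow> germ A t (\<phi> \<cdot> a)"
  by (simp add: germ_def)

lemma germ_Id: "t \<in> Obj J \<Longrightarrow> germ (FObj Y t) t (Id C (FObj Y t))"
  by (simp add: germ_def)

lemma upper_bound:
  assumes "s \<in> Obj J" "t \<in> Obj J"
  obtains u v where "u \<in> Arr J" "v \<in> Arr J" "Dom J u = s" "Dom J v = t" "Cod J v = Cod J u"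
proof -
  obtain k where "Hom J s k \<noteq> {}" "Hom J t k \<noteq> {}"
    using filtered_J assms unfolding filtered_category_def by meson
  then obtain u v where "u \<in> Hom J s k" "v \<in> Hom J t k"
    by blast
  then show thesis
    using that[of u v] by (simp add: J.Hom_iff)
qed

lemma equalize:
  assumes "u \<in> Arr J" "v \<in> Arr J" "Dom J u = Dom J v" "Cod J u = Cod J v"
  obtains w where "w \<in> Arr J" "Dom J w = Cod J v" "Comp J w u = Comp J w v"
proof -
  have "u \<in> Hom J (Dom J v) (Cod J v)" "v \<in> Hom J (Dom J v) (Cod J v)"
    using assms by (auto simp: J.Hom_iff)
  then obtain k w where "w \<in> Hom J (Cod J v) k" "Comp J w u = Comp J w v"
    using filtered_J J.dom_in_Obj[OF assms(2)] J.cod_in_Obj[OF assms(2)]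
    unfolding filtered_category_def by meson
  then show thesis
    using that by (auto simp: J.Hom_iff)
qed

text \<open>An upper bound of the two targets, followed by an arrow that equalises the two paths
  from the common source.\<close>

lemma span_complete:
  assumes "v \<in> Arr J" "w \<in> Arr J" "Dom J v = Dom J w"
  obtains a b where "a \<in> Arr J" "b \<in> Arr J" "Dom J a = Cod J v" "Dom J b = Cod J w"
    "Cod J b = Cod J a" "Comp J a v = Comp J b w"
proof -
  obtain a b where [simp]: "a \<in> Arr J" "b \<in> Arr J" "Dom J a = Cod J v" "Dom J b = Cod J w"
    "Cod J b = Cod J a"
    using upper_bound J.cod_in_Obj assms by metis
  note [simp] = assms
  obtain c where [simp]: "c \<in> Arr J" "Dom J c = Cod J a"
    and c: "Comp J c (Comp J a v) = Comp J c (Comp J b w)"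
    by (rule equalize[of "Comp J a v" "Comp J b w"]) auto
  show thesis
    by (rule that[of "Comp J c a" "Comp J c b"]) (use c in \<open>auto simp: J.assoc\<close>)
qed

lemma colim_step_iff:
  "colim_step C A (J, Y) (t, \<phi>) (t', \<phi>') \<longleftrightarrow>
    germ A t \<phi> \<and> (\<exists>u\<in>Arr J. Dom J u = t \<and> Cod J u = t' \<and> \<phi>' = FArr Y u \<cdot> \<phi>)"
  using J.dom_in_Obj by (auto simp: colim_step_def germ_def Hom_iff J.Hom_iff)

text \<open>Zig-zags of \<open>colim_step\<close> collapse to a single cospan. A cospan from
  \<open>(t, \<phi>)\<close> to the current pair is prolonged across a forward step by
  \<open>span_complete\<close> and across a backward step by mere composition.\<close>

lemma equivclp_germ:
  assumes "equivclp (colim_step C A (J, Y)) (t, \<phi>) q" "germ A t \<phi>"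
  shows "germ A (fst q) (snd q) \<and>
    (\<exists>u\<in>Arr J. \<exists>v\<in>Arr J. Dom J u = t \<and> Dom J v = fst q \<and> Cod J v = Cod J u \<and>
       FArr Y u \<cdot> \<phi> = FArr Y v \<cdot> snd q)"
  using assms(1)
proof (induction rule: equivclp_induct)
  case base
  show ?case
    using assms(2) by (auto simp: germ_def intro!: bexI[of _ "Id J t"])
next
  case (step y z)
  obtain s \<psi> where y: "y = (s, \<psi>)" by (cases y)
  obtain r \<kappa> where z: "z = (r, \<kappa>)" by (cases z)
  from step.IH y obtain u v where gy: "germ A s \<psi>" and [simp]: "u \<in> Arr J" "v \<in> Arr J"
      "Dom J u = t" "Dom J v = s" "Cod J v = Cod J u"
    and uv: "FArr Y u \<cdot> \<phi> = FArr Y v \<cdot> \<psi>"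
    by auto
  note [simp] = germD[OF assms(2)] germD[OF gy]
  from step.hyps(2) show ?case
  proof
    assume "colim_step C A (J, Y) y z"
    then obtain w where [simp]: "w \<in> Arr J" "Dom J w = s" "Cod J w = r"
      and \<kappa>: "\<kappa> = FArr Y w \<cdot> \<psi>"
      unfolding y z colim_step_iff by blast
    obtain a b where [simp]: "a \<in> Arr J" "b \<in> Arr J" "Dom J a = Cod J u" "Dom J b = r"
      "Cod J b = Cod J a" and ab: "Comp J a v = Comp J b w"
      by (rule span_complete[of v w]) auto
    have "FArr Y (Comp J a u) \<cdot> \<phi> = FArr Y (Comp J a v) \<cdot> \<psi>"
      by (simp add: FArr_Comp assoc uv)
    also have "\<dots> = FArr Y b \<cdot> \<kappa>"
      unfolding ab \<kappa> by (simp add: FArr_Comp assoc)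
    finally have "FArr Y (Comp J a u) \<cdot> \<phi> = FArr Y b \<cdot> \<kappa>" .
    moreover have "germ A r \<kappa>"
      using germ_shift[OF gy, of w] by (simp add: \<kappa>)
    ultimately show ?thesis
      unfolding z
      by (intro conjI, simp, rule_tac bexI[of _ "Comp J a u"], rule_tac bexI[of _ b]) simp_all
  next
    assume "colim_step C A (J, Y) z y"
    then obtain w where gz: "germ A r \<kappa>" and [simp]: "w \<in> Arr J" "Dom J w = r" "Cod J w = s"
      and \<psi>: "\<psi> = FArr Y w \<cdot> \<kappa>"
      unfolding y z colim_step_iff by blast
    note [simp] = germD[OF gz]
    have "FArr Y u \<cdot> \<phi> = FArr Y (Comp J v w) \<cdot> \<kappa>"
      unfolding uv \<psi> by (simp add: FArr_Comp assoc)
    then show ?thesis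
      unfolding z using gz
      by (intro conjI, simp, rule_tac bexI[of _ u], rule_tac bexI[of _ "Comp J v w"]) simp_all
  qed
qed

lemma cls_shift:
  assumes "germ A t \<phi>" "u \<in> Arr J" "Dom J u = t"
  shows "cls A (Cod J u) (FArr Y u \<cdot> \<phi>) = cls A t \<phi>"
proof -
  have "equivclp (colim_step C A (J, Y)) (t, \<phi>) (Cod J u, FArr Y u \<cdot> \<phi>)"
    using assms by (intro r_into_equivclp) (auto simp: colim_step_iff)
  then show ?thesis
    unfolding colim_class_def by (blast intro: equivclp_trans equivclp_sym)
qed

lemma cls_mem: "(t, \<phi>) \<in> cls A t \<phi>"
  by (simp add: colim_class_def)

lemma mem_cls:
  assumes "germ A t \<phi>" "(s, \<psi>) \<in> cls A t \<phi>"
  shows "germ A s \<psi>" "cls A s \<psi> = cls A t \<phi>"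
proof -
  have e: "equivclp (colim_step C A (J, Y)) (t, \<phi>) (s, \<psi>)"
    using assms(2) by (simp add: colim_class_def)
  show "germ A s \<psi>"
    using equivclp_germ[OF e assms(1)] by simp
  show "cls A s \<psi> = cls A t \<phi>"
    using e unfolding colim_class_def by (blast intro: equivclp_trans equivclp_sym)
qed

lemma cls_eqE:
  assumes "cls A t \<phi> = cls A s \<psi>" "germ A t \<phi>"
  obtains u v where "u \<in> Arr J" "v \<in> Arr J" "Dom J u = t" "Dom J v = s" "Cod J v = Cod J u"
    "FArr Y u \<cdot> \<phi> = FArr Y v \<cdot> \<psi>"
proof -
  have "(s, \<psi>) \<in> cls A t \<phi>"
    using cls_mem[of s \<psi> A] assms(1) by simp
  then have "equivclp (colim_step C A (J, Y)) (t, \<phi>) (s, \<psi>)"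
    by (simp add: colim_class_def)
  from equivclp_germ[OF this assms(2)] show thesis
    using that by auto
qed

text \<open>The two transitions of the cospan are equalised in turn, which leaves one arrow
  \<open>w\<close>. In this form an identity between maps into the ind-object becomes strict at a
  later stage.\<close>

lemma cls_eq_same_stage:
  assumes "cls A t \<phi> = cls A t \<psi>" "germ A t \<phi>" "germ A t \<psi>"
  obtains w where "w \<in> Arr J" "Dom J w = t" "FArr Y w \<cdot> \<phi> = FArr Y w \<cdot> \<psi>"
proof -
  note [simp] = germD[OF assms(2)] germD[OF assms(3)]
  obtain u v where [simp]: "u \<in> Arr J" "v \<in> Arr J" "Dom J u = t" "Dom J v = t"
      "Cod J v = Cod J u"
    and uv: "FArr Y u \<cdot> \<phi> = FArr Y v \<cdot> \<psi>"
    by (rule cls_eqE[OF assms(1,2)])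
  obtain w where [simp]: "w \<in> Arr J" "Dom J w = Cod J u" and w: "Comp J w u = Comp J w v"
    by (rule equalize[of u v]) auto
  have "FArr Y (Comp J w u) \<cdot> \<phi> = FArr Y (Comp J w v) \<cdot> \<psi>"
    by (simp add: FArr_Comp assoc uv)
  then show thesis
    using that[of "Comp J w u"] w by simp
qed

lemma colim_HomI: "germ A t \<phi> \<Longrightarrow> cls A t \<phi> \<in> colim_Hom C A (J, Y)"
  unfolding colim_Hom_def germ_def Hom_def by auto

lemma colim_HomE:
  assumes "c \<in> colim_Hom C A (J, Y)"
  obtains t \<phi> where "germ A t \<phi>" "c = cls A t \<phi>"
  using assms unfolding colim_Hom_def germ_def Hom_def by auto

lemma common_stage:
  assumes "c \<in> colim_Hom C A (J, Y)" "d \<in> colim_Hom C B (J, Y)"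
  obtains t \<phi> \<psi> where "germ A t \<phi>" "germ B t \<psi>" "c = cls A t \<phi>" "d = cls B t \<psi>"
proof -
  obtain r \<phi> where \<phi>: "germ A r \<phi>" "c = cls A r \<phi>"
    using assms(1) by (rule colim_HomE)
  obtain s \<psi> where \<psi>: "germ B s \<psi>" "d = cls B s \<psi>"
    using assms(2) by (rule colim_HomE)
  obtain u v where uv: "u \<in> Arr J" "v \<in> Arr J" "Dom J u = r" "Dom J v = s" "Cod J v = Cod J u"
    using upper_bound \<phi>(1) \<psi>(1) germD(1) by metis
  show thesis
    using that germ_shift[OF \<phi>(1) uv(1,3)] germ_shift[OF \<psi>(1) uv(2,4)]
      cls_shift[OF \<phi>(1) uv(1,3)] cls_shift[OF \<psi>(1) uv(2,4)] \<phi>(2) \<psi>(2) uv(5) by metis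
qed

lemma cls_precomp_cong:
  assumes "cls B t \<phi> = cls B s \<psi>" "germ B t \<phi>" "germ B s \<psi>" "a \<in> Arr C" "Dom C a = A"
    "Cod C a = B"
  shows "cls A t (\<phi> \<cdot> a) = cls A s (\<psi> \<cdot> a)"
proof -
  note [simp] = germD[OF assms(2)] germD[OF assms(3)] assms(4-)
  obtain u v where [simp]: "u \<in> Arr J" "v \<in> Arr J" "Dom J u = t" "Dom J v = s"
      "Cod J v = Cod J u"
    and uv: "FArr Y u \<cdot> \<phi> = FArr Y v \<cdot> \<psi>"
    by (rule cls_eqE[OF assms(1,2)])
  have "FArr Y u \<cdot> \<phi> \<cdot> a = FArr Y v \<cdot> \<psi> \<cdot> a"
    using uv by (simp add: assoc[symmetric])
  then show ?thesis
    using cls_shift[OF germ_precomp[OF assms(2,4-6)], of u]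
      cls_shift[OF germ_precomp[OF assms(3,4-6)], of v] by simp
qed

text \<open>The defining union runs over all representatives, and each of them contributes the same
  class.\<close>

lemma colim_precomp_cls:
  assumes "germ B t \<phi>" "a \<in> Arr C" "Dom C a = A" "Cod C a = B"
  shows "colim_precomp C a (J, Y) (cls B t \<phi>) = cls A t (\<phi> \<cdot> a)"
proof -
  have "cls A s (\<psi> \<cdot> a) = cls A t (\<phi> \<cdot> a)" if "(s, \<psi>) \<in> cls B t \<phi>" for s \<psi>
    by (rule cls_precomp_cong[OF mem_cls(2)[OF assms(1) that] mem_cls(1)[OF assms(1) that] assms])
  then have "(\<Union>(s, \<psi>)\<in>cls B t \<phi>. cls A s (\<psi> \<cdot> a)) = (\<Union>q\<in>cls B t \<phi>. cls A t (\<phi> \<cdot> a))"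
    by (intro SUP_cong refl) (auto split: prod.split)
  also have "\<dots> = cls A t (\<phi> \<cdot> a)"
    using cls_mem[of t \<phi> B] by blast
  finally show ?thesis
    unfolding colim_precomp_def by (simp add: assms(3))
qed

end

section \<open>Maps into an ind-object form a finitely continuous presheaf\<close>

definition ind_presheaf ::
  "('o, 'a) cat \<Rightarrow> ('i, 'o, 'a) diagram \<Rightarrow> ('o, 'a, ('i \<times> 'a) set) presheaf" where
  "ind_presheaf C Y = \<lparr>El = (\<lambda>A. colim_Hom C A Y), Res = (\<lambda>a. colim_precomp C a Y)\<rparr>"

context ind_object
begin

abbreviation hom_to :: "('o, 'a, ('i \<times> 'a) set) presheaf" where "hom_to \<equiv> ind_presheaf C (J, Y)"

lemma El_hom_to: "El hom_to A = colim_Hom C A (J, Y)"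
  by (simp add: ind_presheaf_def)

lemma cls_El: "germ A t \<phi> \<Longrightarrow> cls A t \<phi> \<in> El hom_to A"
  by (simp add: El_hom_to colim_HomI)

lemma ElE:
  assumes "c \<in> El hom_to A"
  obtains t \<phi> where "germ A t \<phi>" "c = cls A t \<phi>"
  using assms unfolding El_hom_to by (rule colim_HomE)

lemma Res_cls: "\<lbrakk>germ B t \<phi>; a \<in> Arr C; Dom C a = A; Cod C a = B\<rbrakk> \<Longrightarrow>
    Res hom_to a (cls B t \<phi>) = cls A t (\<phi> \<cdot> a)"
  by (simp add: ind_presheaf_def colim_precomp_cls)

text \<open>Filtered colimits of sets commute with finite limits. Concretely, two maps into
  \<open>Y\<close> are represented at a common stage, the equations between them hold strictly at a
  later one, and the universal property in C applies there. The element over the initial object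
  exists because \<open>J\<close> is not empty.\<close>

sublocale hom_to: lex_presheaf C "ind_presheaf C (J, Y)"
proof unfold_locales
  show "Res hom_to a x \<in> El hom_to (Dom C a)" if "a \<in> Arr C" "x \<in> El hom_to (Cod C a)" for a x
    using that(2,1) by (auto elim!: ElE simp: Res_cls germD intro!: cls_El germ_precomp[of "Cod C a"])
  show "Res hom_to (Id C A) x = x" if "A \<in> Obj C" "x \<in> El hom_to A" for A x
    using that(2,1) by (auto elim!: ElE simp: Res_cls germD)
  show "Res hom_to (b \<cdot> a) x = Res hom_to a (Res hom_to b x)"
    if "a \<in> Arr C" "b \<in> Arr C" "Dom C b = Cod C a" "x \<in> El hom_to (Cod C b)" for a b x
    using that(4,1-3)
    by (auto elim!: ElE simp: Res_cls germD assoc germ_precomp[where B = "Cod C b"])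
next
  fix a b p q x y
  assume po: "is_pushout C a b p q" and x: "x \<in> El hom_to (Cod C a)" and y: "y \<in> El hom_to (Cod C b)"
    and xy: "Res hom_to a x = Res hom_to b y"
  note D [simp] = is_pushoutD(1-8)[OF po]
  obtain t \<phi> \<psi> where \<phi>: "germ (Cod C a) t \<phi>" "x = cls (Cod C a) t \<phi>"
    and \<psi>: "germ (Cod C b) t \<psi>" "y = cls (Cod C b) t \<psi>"
    by (rule common_stage[OF x[unfolded El_hom_to] y[unfolded El_hom_to]])
  note [simp] = germD[OF \<phi>(1)] germD[OF \<psi>(1)]
  have g: "germ (Dom C a) t (\<phi> \<cdot> a)" "germ (Dom C a) t (\<psi> \<cdot> b)"
    by (simp_all add: germ_def)
  have "cls (Dom C a) t (\<phi> \<cdot> a) = cls (Dom C a) t (\<psi> \<cdot> b)"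
    using xy Res_cls[OF \<phi>(1), of a "Dom C a"] Res_cls[OF \<psi>(1), of b "Dom C a"] \<phi>(2) \<psi>(2) by simp
  then obtain w where w [simp]: "w \<in> Arr J" "Dom J w = t"
    and eq: "FArr Y w \<cdot> \<phi> \<cdot> a = FArr Y w \<cdot> \<psi> \<cdot> b"
    by (rule cls_eq_same_stage[OF _ g])
  obtain h where h [simp]: "h \<in> Arr C" "Dom C h = Cod C p" "Cod C h = FObj Y (Cod J w)"
    and hp: "h \<cdot> p = FArr Y w \<cdot> \<phi>" "h \<cdot> q = FArr Y w \<cdot> \<psi>"
    by (rule is_pushout_induced[OF po, of "FArr Y w \<cdot> \<phi>" "FArr Y w \<cdot> \<psi>"])
      (use eq in \<open>auto simp: assoc\<close>)
  have h: "germ (Cod C p) (Cod J w) h"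
    by (simp add: germ_def J.cod_in_Obj)
  show "\<exists>z\<in>El hom_to (Cod C p). Res hom_to p z = x \<and> Res hom_to q z = y"
    using cls_El[OF h] Res_cls[OF h, of p "Cod C a"] Res_cls[OF h, of q "Cod C b"] hp
      cls_shift[OF \<phi>(1) w] cls_shift[OF \<psi>(1) w] \<phi>(2) \<psi>(2)
    by (intro bexI[of _ "cls (Cod C p) (Cod J w) h"]) simp_all
next
  fix a b p q z z'
  assume po: "is_pushout C a b p q" and z: "z \<in> El hom_to (Cod C p)" "z' \<in> El hom_to (Cod C p)"
    and eq: "Res hom_to p z = Res hom_to p z'" "Res hom_to q z = Res hom_to q z'"
  note D [simp] = is_pushoutD(1-8)[OF po]
  obtain t \<phi> \<psi> where \<phi>: "germ (Cod C p) t \<phi>" "z = cls (Cod C p) t \<phi>"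
    and \<psi>: "germ (Cod C p) t \<psi>" "z' = cls (Cod C p) t \<psi>"
    by (rule common_stage[OF z[unfolded El_hom_to]])
  note [simp] = germD[OF \<phi>(1)] germD[OF \<psi>(1)]
  have "cls (Cod C a) t (\<phi> \<cdot> p) = cls (Cod C a) t (\<psi> \<cdot> p)"
    using eq Res_cls[OF \<phi>(1), of p "Cod C a"] Res_cls[OF \<psi>(1), of p "Cod C a"] \<phi>(2) \<psi>(2) by simp
  \<comment> \<open>The transition \<open>u\<close> makes the two maps agree along \<open>p\<close>;
    a further one, \<open>v\<close>, then serves \<open>q\<close>.\<close>
  then obtain u where u [simp]: "u \<in> Arr J" "Dom J u = t"
    and up: "FArr Y u \<cdot> \<phi> \<cdot> p = FArr Y u \<cdot> \<psi> \<cdot> p"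
    by (rule cls_eq_same_stage) (simp_all add: germ_def)
  note g = germ_shift[OF \<phi>(1) u] germ_shift[OF \<psi>(1) u]
  have "cls (Cod C b) (Cod J u) ((FArr Y u \<cdot> \<phi>) \<cdot> q) = cls (Cod C b) (Cod J u) ((FArr Y u \<cdot> \<psi>) \<cdot> q)"
    using eq Res_cls[OF g(1), of q "Cod C b"] Res_cls[OF g(2), of q "Cod C b"] \<phi>(2) \<psi>(2)
      cls_shift[OF \<phi>(1) u] cls_shift[OF \<psi>(1) u] by simp
  then obtain v where v [simp]: "v \<in> Arr J" "Dom J v = Cod J u"
    and vq: "FArr Y v \<cdot> (FArr Y u \<cdot> \<phi>) \<cdot> q = FArr Y v \<cdot> (FArr Y u \<cdot> \<psi>) \<cdot> q"
    by (rule cls_eq_same_stage) (simp_all add: germ_def J.cod_in_Obj)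
  have "FArr Y v \<cdot> FArr Y u \<cdot> \<phi> = FArr Y v \<cdot> FArr Y u \<cdot> \<psi>"
    by (rule is_pushout_unique[OF po]) (use up vq in \<open>simp_all add: assoc\<close>)
  then show "z = z'"
    using cls_shift[OF g(1) v] cls_shift[OF g(2) v] cls_shift[OF \<phi>(1) u] cls_shift[OF \<psi>(1) u]
      \<phi>(2) \<psi>(2) by simp
next
  fix Z assume Z: "is_initial C Z"
  obtain t where t: "t \<in> Obj J"
    using filtered_J unfolding filtered_category_def by blast
  obtain z where "z \<in> Arr C" "Dom C z = Z" "Cod C z = FObj Y t"
    by (rule initial_arrow[OF Z, of "FObj Y t"]) (use t in auto)
  then have "cls Z t z \<in> El hom_to Z"
    using t by (intro cls_El) (simp add: germ_def)
  moreover have "c = d" if c: "c \<in> El hom_to Z" and d: "d \<in> El hom_to Z" for c d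
  proof -
    obtain s \<phi> \<psi> where "germ Z s \<phi>" "germ Z s \<psi>" "c = cls Z s \<phi>" "d = cls Z s \<psi>"
      by (rule common_stage[OF c[unfolded El_hom_to] d[unfolded El_hom_to]])
    then show ?thesis
      using initial_arrow_unique[OF Z, of \<phi> \<psi>] by (simp add: germ_def)
  qed
  ultimately show "\<exists>!x. x \<in> El hom_to Z"
    by blast
qed

end


section \<open>The action of ind-morphisms\<close>

text \<open>Postcomposition of maps from \<open>A\<close> with the ind-morphism \<open>F\<close>.
  The formula is the inner part of the composition of \<open>Ind\<close>, so \<open>Comp_Ind\<close>
  holds by unfolding.\<close>

definition ind_act :: "('o, 'a) cat \<Rightarrow> ('i, 'o, 'a) diagram \<Rightarrow> ('i \<Rightarrow> ('i \<times> 'a) set) \<Rightarrow> 'o \<Rightarrow>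
    ('i \<times> 'a) set \<Rightarrow> ('i \<times> 'a) set" where
  "ind_act C Y F A c =
     (\<Union>(t, \<phi>)\<in>c. \<Union>(r, \<psi>)\<in>F t. colim_class C A Y (r, Comp C \<psi> \<phi>))"

locale ind_arrow = X: ind_object C I X + Y: ind_object C J Y
  for C :: "('o, 'a) cat" and I :: "('i, 'i) cat" and X :: "('i, 'i, 'o, 'a) func"
    and J :: "('i, 'i) cat" and Y :: "('i, 'i, 'o, 'a) func" +
  fixes F :: "'i \<Rightarrow> ('i \<times> 'a) set"
  assumes ind_Hom: "F \<in> ind_Hom C (I, X) (J, Y)"
begin

abbreviation act :: "'o \<Rightarrow> ('i \<times> 'a) set \<Rightarrow> ('i \<times> 'a) set" where
  "act \<equiv> ind_act C (J, Y) F"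

lemma F_El: "s \<in> Obj I \<Longrightarrow> F s \<in> El Y.hom_to (FObj X s)"
  using ind_Hom unfolding ind_Hom_def Y.El_hom_to by auto

lemma F_extensional: "F \<in> extensional (Obj I)"
  using ind_Hom unfolding ind_Hom_def by (auto simp: PiE_def)

lemma Res_F: "u \<in> Arr I \<Longrightarrow> Res Y.hom_to (FArr X u) (F (Cod I u)) = F (Dom I u)"
  using ind_Hom unfolding ind_Hom_def by (auto simp: ind_presheaf_def)

text \<open>Any other representative \<open>(s, \<psi>)\<close> is joined to
  \<open>(t, \<phi>)\<close> by a cospan, and compatibility of \<open>F\<close> with the transitions
  of \<open>X\<close> identifies the two restrictions.\<close>

lemma act_cls:
  assumes "X.germ A t \<phi>"
  shows "act A (X.cls A t \<phi>) = Res Y.hom_to \<phi> (F t)"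
proof -
  note [simp] = X.germD[OF assms]
  have "(\<Union>(r, \<kappa>)\<in>F s. Y.cls A r (Comp C \<kappa> \<psi>)) = Res Y.hom_to \<phi> (F t)"
    if s\<psi>: "(s, \<psi>) \<in> X.cls A t \<phi>" for s \<psi>
  proof -
    have g: "X.germ A s \<psi>" and eq: "X.cls A t \<phi> = X.cls A s \<psi>"
      using X.mem_cls[OF assms s\<psi>] by simp_all
    note [simp] = X.germD[OF g]
    obtain u v where [simp]: "u \<in> Arr I" "v \<in> Arr I" "Dom I u = t" "Dom I v = s"
        "Cod I v = Cod I u"
      and uv: "Comp C (FArr X u) \<phi> = Comp C (FArr X v) \<psi>"
      by (rule X.cls_eqE[OF eq assms])
    have k: "F (Cod I u) \<in> El Y.hom_to (FObj X (Cod I u))"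
      by (simp add: F_El X.J.cod_in_Obj)
    have "(\<Union>(r, \<kappa>)\<in>F s. Y.cls A r (Comp C \<kappa> \<psi>)) = Res Y.hom_to \<psi> (F s)"
      by (simp add: ind_presheaf_def colim_precomp_def)
    also have "\<dots> = Res Y.hom_to \<phi> (F t)"
      using Res_F[of u] Res_F[of v] Y.hom_to.Res_Comp[of \<phi> "FArr X u" "F (Cod I u)"]
        Y.hom_to.Res_Comp[of \<psi> "FArr X v" "F (Cod I u)"] uv k by simp
    finally show ?thesis .
  qed
  then have "act A (X.cls A t \<phi>) = (\<Union>q\<in>X.cls A t \<phi>. Res Y.hom_to \<phi> (F t))"
    unfolding ind_act_def by (intro SUP_cong refl) (auto split: prod.split)
  also have "\<dots> = Res Y.hom_to \<phi> (F t)"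
    using X.cls_mem[of t \<phi> A] by blast
  finally show ?thesis .
qed

lemma act_Id:
  assumes "s \<in> Obj I"
  shows "act (FObj X s) (X.cls (FObj X s) s (Id C (FObj X s))) = F s"
  using act_cls[OF X.germ_Id[OF assms]] Y.hom_to.Res_Id[OF _ F_El[OF assms]] assms by simp

sublocale presheaf_map C X.hom_to Y.hom_to act
proof unfold_locales
  show "act A c \<in> El Y.hom_to A" if "A \<in> Obj C" "c \<in> El X.hom_to A" for A c
    using that(2) by (auto elim!: X.ElE simp: act_cls X.germD intro!: Y.hom_to.Res_mem F_El)
  show "act (Dom C a) (Res X.hom_to a c) = Res Y.hom_to a (act (Cod C a) c)"
    if "a \<in> Arr C" "c \<in> El X.hom_to (Cod C a)" for a c
    using that(2,1)
    by (auto elim!: X.ElE simp: act_cls X.germD X.Res_cls Y.hom_to.Res_Comp F_El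
        X.germ_precomp[where B = "Cod C a"])
qed

end

text \<open>As in the Yoneda lemma, \<open>F s\<close> is the image of the class of the identity of
  \<open>X s\<close>; outside \<open>Obj I\<close> extensionality decides.\<close>

lemma ind_arrow_eqI:
  assumes "ind_arrow C I X J Y F" "ind_arrow C I X J Y G"
    and "\<And>A c. A \<in> Obj C \<Longrightarrow> c \<in> El (ind_presheaf C (I, X)) A \<Longrightarrow>
      ind_act C (J, Y) F A c = ind_act C (J, Y) G A c"
  shows "F = G"
proof -
  interpret F: ind_arrow C I X J Y F by fact
  interpret G: ind_arrow C I X J Y G by fact
  have "F s = G s" if "s \<in> Obj I" for s
    using F.act_Id[OF that] G.act_Id[OF that]
      assms(3)[OF F.X.FObj_in[OF that] F.X.cls_El[OF F.X.germ_Id[OF that]]] by simp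
  then show ?thesis
    using F.F_extensional G.F_extensional by (metis extensionalityI)
qed

section \<open>Composition, identities and isomorphisms of ind-morphisms through their
  actions\<close>

definition ind_comp :: "('o, 'a) cat \<Rightarrow> ('i, 'o, 'a) diagram \<Rightarrow> ('i, 'o, 'a) diagram \<Rightarrow>
    ('i \<Rightarrow> ('i \<times> 'a) set) \<Rightarrow> ('i \<Rightarrow> ('i \<times> 'a) set) \<Rightarrow> 'i \<Rightarrow> ('i \<times> 'a) set" where
  "ind_comp C X Z G F = (\<lambda>s\<in>Obj (fst X). ind_act C Z G (FObj (snd X) s) (F s))"

lemma Comp_Ind: "Comp (Ind C) (Y', Z, G) (X, Y, F) = (X, Z, ind_comp C X Z G F)"
  by (cases X) (simp add: Ind_def ind_comp_def ind_act_def)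

lemma
  assumes "ind_arrow C I X J Y F" "ind_arrow C J Y K Z G"
  shows ind_arrow_comp: "ind_arrow C I X K Z (ind_comp C (I, X) (K, Z) G F)"
    and ind_act_comp: "c \<in> El (ind_presheaf C (I, X)) A \<Longrightarrow>
      ind_act C (K, Z) (ind_comp C (I, X) (K, Z) G F) A c =
      ind_act C (K, Z) G A (ind_act C (J, Y) F A c)"
proof -
  interpret F: ind_arrow C I X J Y F by fact
  interpret G: ind_arrow C J Y K Z G by fact
  let ?H = "ind_comp C (I, X) (K, Z) G F"
  have H: "?H s = G.act (FObj X s) (F s)" if "s \<in> Obj I" for s
    using that by (simp add: ind_comp_def)
  show *: "ind_arrow C I X K Z ?H"
  proof unfold_locales
    have "?H s \<in> colim_Hom C (FObj X s) (K, Z)" if "s \<in> Obj I" for s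
      using G.map_in[OF F.X.FObj_in[OF that] F.F_El[OF that]] H[OF that] by (simp add: G.Y.El_hom_to)
    moreover have "colim_precomp C (FArr X u) (K, Z) (?H (Cod I u)) = ?H (Dom I u)"
      if "u \<in> Arr I" for u
      using that G.natural'[of "FArr X u" _ _ "F (Cod I u)"] F.Res_F[OF that]
      by (simp add: H F.X.J.dom_in_Obj F.X.J.cod_in_Obj F.F_El) (simp add: ind_presheaf_def)
    ultimately show "?H \<in> ind_Hom C (I, X) (K, Z)"
      by (simp add: ind_Hom_def PiE_iff) (simp add: ind_comp_def)
  qed
  interpret H: ind_arrow C I X K Z ?H by (rule *)
  show "H.act A c = G.act A (F.act A c)" if "c \<in> El (ind_presheaf C (I, X)) A"
    using that
  proof (rule F.X.ElE)
    fix t \<phi> assume \<phi>: "F.X.germ A t \<phi>" "c = F.X.cls A t \<phi>"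
    then show ?thesis
      using G.natural'[of \<phi> A "FObj X t" "F t"] F.F_El
      by (simp add: F.act_cls H.act_cls H F.X.germD)
  qed
qed

lemma
  assumes "ind_object C I X" "ind_object C I Y" "is_natural I C X Y \<tau>"
  shows ind_arrow_levelwise: "ind_arrow C I X I Y (snd (snd (levelwise C I X Y \<tau>)))"
    and ind_act_levelwise: "ind_object.germ C I X A t \<phi> \<Longrightarrow>
      ind_act C (I, Y) (snd (snd (levelwise C I X Y \<tau>))) A (colim_class C A (I, X) (t, \<phi>)) =
      colim_class C A (I, Y) (t, Comp C (\<tau> t) \<phi>)"
proof -
  interpret X: ind_object C I X by fact
  interpret Y: ind_object C I Y by fact
  let ?F = "snd (snd (levelwise C I X Y \<tau>))"
  have F: "?F s = Y.cls (FObj X s) s (\<tau> s)" if "s \<in> Obj I" for s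
    using that by (simp add: levelwise_def)
  have \<tau>: "Y.germ (FObj X s) s (\<tau> s)" if "s \<in> Obj I" for s
    using that assms(3) by (simp add: is_natural_def Y.germ_def X.Hom_iff)
  have nat: "Comp C (\<tau> (Cod I u)) (FArr X u) = Comp C (FArr Y u) (\<tau> (Dom I u))"
    if "u \<in> Arr I" for u
    using that assms(3) by (simp add: is_natural_def)
  show *: "ind_arrow C I X I Y ?F"
  proof unfold_locales
    have "colim_precomp C (FArr X u) (I, Y) (?F (Cod I u)) = ?F (Dom I u)" if "u \<in> Arr I" for u
      using that Y.colim_precomp_cls[OF \<tau>[of "Cod I u"], of "FArr X u"]
        Y.cls_shift[OF \<tau>[of "Dom I u"], of u] nat[OF that]
      by (simp add: F X.J.dom_in_Obj X.J.cod_in_Obj)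
    then show "?F \<in> ind_Hom C (I, X) (I, Y)"
      using F Y.colim_HomI[OF \<tau>] by (simp add: ind_Hom_def PiE_iff) (simp add: levelwise_def)
  qed
  interpret F: ind_arrow C I X I Y ?F by (rule *)
  show "F.act A (X.cls A t \<phi>) = Y.cls A t (Comp C (\<tau> t) \<phi>)" if "X.germ A t \<phi>"
    using that Y.Res_cls[OF \<tau>[of t], of \<phi> A] by (simp add: F.act_cls F X.germD)
qed


lemma Dom_Ind [simp]: "Dom (Ind C) (X, Y, F) = X"
  and Cod_Ind [simp]: "Cod (Ind C) (X, Y, F) = Y"
  by (simp_all add: Ind_def)

lemma Arr_Ind_iff:
  "category C \<Longrightarrow> ((I, X), (J, Y), F) \<in> Arr (Ind C) \<longleftrightarrow> ind_arrow C I X J Y F"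
  by (auto simp: Ind_def is_ind_object_def ind_arrow_def ind_arrow_axioms_def ind_object_def
      ind_object_axioms_def)

lemma levelwise_eq: "levelwise C I X Y \<tau> = ((I, X), (I, Y), snd (snd (levelwise C I X Y \<tau>)))"
  by (simp add: levelwise_def)

lemma Id_Ind: "Id (Ind C) (I, X) = levelwise C I X X (\<lambda>s. Id C (FObj X s))"
  by (simp add: Ind_def)

lemma
  assumes "ind_object C I X"
  shows ind_arrow_Id: "ind_arrow C I X I X (snd (snd (Id (Ind C) (I, X))))"
    and ind_act_Id: "c \<in> El (ind_presheaf C (I, X)) A \<Longrightarrow>
      ind_act C (I, X) (snd (snd (Id (Ind C) (I, X)))) A c = c"
proof -
  interpret X: ind_object C I X by fact
  have nat: "is_natural I C X X (\<lambda>s. Id C (FObj X s))"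
    by (simp add: is_natural_def X.Hom_iff X.J.dom_in_Obj X.J.cod_in_Obj)
  show "ind_arrow C I X I X (snd (snd (Id (Ind C) (I, X))))"
    unfolding Id_Ind by (rule ind_arrow_levelwise[OF assms assms nat])
  show "ind_act C (I, X) (snd (snd (Id (Ind C) (I, X)))) A c = c"
    if "c \<in> El (ind_presheaf C (I, X)) A"
    using that unfolding Id_Ind
    by (auto elim!: X.ElE simp: ind_act_levelwise[OF assms assms nat] X.germD)
qed

lemma ind_isoI:
  assumes F: "ind_arrow C I X J Y F" and G: "ind_arrow C J Y I X G"
    and "\<And>A c. A \<in> Obj C \<Longrightarrow> c \<in> El (ind_presheaf C (I, X)) A \<Longrightarrow>
      ind_act C (I, X) G A (ind_act C (J, Y) F A c) = c"
    and "\<And>A c. A \<in> Obj C \<Longrightarrow> c \<in> El (ind_presheaf C (J, Y)) A \<Longrightarrow>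
      ind_act C (J, Y) F A (ind_act C (I, X) G A c) = c"
  shows "is_iso (Ind C) ((I, X), (J, Y), F)"
proof -
  interpret F: ind_arrow C I X J Y F by fact
  have XY: "ind_object C I X" "ind_object C J Y"
    by unfold_locales
  have "ind_comp C (I, X) (I, X) G F = snd (snd (Id (Ind C) (I, X)))"
    by (rule ind_arrow_eqI[OF ind_arrow_comp[OF F G] ind_arrow_Id[OF XY(1)]])
      (simp add: ind_act_comp[OF F G] ind_act_Id[OF XY(1)] assms(3))
  moreover have "ind_comp C (J, Y) (J, Y) F G = snd (snd (Id (Ind C) (J, Y)))"
    by (rule ind_arrow_eqI[OF ind_arrow_comp[OF G F] ind_arrow_Id[OF XY(2)]])
      (simp add: ind_act_comp[OF G F] ind_act_Id[OF XY(2)] assms(4))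
  ultimately have "Comp (Ind C) ((J, Y), (I, X), G) ((I, X), (J, Y), F) = Id (Ind C) (I, X)"
    "Comp (Ind C) ((I, X), (J, Y), F) ((J, Y), (I, X), G) = Id (Ind C) (J, Y)"
    unfolding Comp_Ind by (simp_all add: Id_Ind levelwise_eq[symmetric])
  then show ?thesis
    unfolding is_iso_def using F G
    by (auto simp: Hom_def Arr_Ind_iff[OF F.X.category_axioms]
        intro!: bexI[of _ "((J, Y), (I, X), G)"])
qed

lemma ind_isoE:
  assumes "category C" "is_iso (Ind C) ((I, X), (J, Y), F)"
  obtains G where "ind_arrow C I X J Y F" "ind_arrow C J Y I X G"
    "\<And>A c. c \<in> El (ind_presheaf C (I, X)) A \<Longrightarrow>
      ind_act C (I, X) G A (ind_act C (J, Y) F A c) = c"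
    "\<And>A c. c \<in> El (ind_presheaf C (J, Y)) A \<Longrightarrow>
      ind_act C (J, Y) F A (ind_act C (I, X) G A c) = c"
proof -
  obtain g where F: "((I, X), (J, Y), F) \<in> Arr (Ind C)" and g: "g \<in> Hom (Ind C) (J, Y) (I, X)"
    and gF: "Comp (Ind C) g ((I, X), (J, Y), F) = Id (Ind C) (I, X)"
      "Comp (Ind C) ((I, X), (J, Y), F) g = Id (Ind C) (J, Y)"
    using assms(2) unfolding is_iso_def by auto
  obtain G where G: "g = ((J, Y), (I, X), G)"
    using g by (cases g) (auto simp: Hom_def)
  have FG: "ind_arrow C I X J Y F" "ind_arrow C J Y I X G"
    using F g by (auto simp: G Hom_def Arr_Ind_iff[OF assms(1)])
  interpret F: ind_arrow C I X J Y F by fact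
  have XY: "ind_object C I X" "ind_object C J Y"
    by unfold_locales
  have "ind_comp C (I, X) (I, X) G F = snd (snd (Id (Ind C) (I, X)))"
    "ind_comp C (J, Y) (J, Y) F G = snd (snd (Id (Ind C) (J, Y)))"
    using gF unfolding G Comp_Ind by (metis snd_conv)+
  then show thesis
    using that[OF FG] ind_act_comp[OF FG] ind_act_comp[OF FG(2,1)] ind_act_Id[OF XY(1)]
      ind_act_Id[OF XY(2)] by metis
qed

text \<open>The inverse takes stage \<open>t\<close> to the preimage of the class of the identity of
  \<open>Y t\<close>. Injectivity makes these preimages compatible with transitions, and naturality
  extends the inverse property from identities to all maps.\<close>

lemma ind_inverse:
  assumes "ind_arrow C I X J Y F"
    and bij: "\<And>A. A \<in> Obj C \<Longrightarrow> bij_betw (ind_act C (J, Y) F A)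
      (El (ind_presheaf C (I, X)) A) (El (ind_presheaf C (J, Y)) A)"
  obtains G where "ind_arrow C J Y I X G"
    "\<And>A c. A \<in> Obj C \<Longrightarrow> c \<in> El (ind_presheaf C (I, X)) A \<Longrightarrow>
      ind_act C (I, X) G A (ind_act C (J, Y) F A c) = c"
    "\<And>A c. A \<in> Obj C \<Longrightarrow> c \<in> El (ind_presheaf C (J, Y)) A \<Longrightarrow>
      ind_act C (J, Y) F A (ind_act C (I, X) G A c) = c"
proof -
  interpret F: ind_arrow C I X J Y F by fact
  let ?id = "\<lambda>t. F.Y.cls (FObj Y t) t (Id C (FObj Y t))"
  define G where "G = (\<lambda>t\<in>Obj J. inv_into (El F.X.hom_to (FObj Y t)) (F.act (FObj Y t)) (?id t))"
  have id: "?id t \<in> F.act (FObj Y t) ` El F.X.hom_to (FObj Y t)" if "t \<in> Obj J" for t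
    using bij[OF F.Y.FObj_in[OF that]] F.Y.cls_El[OF F.Y.germ_Id[OF that]]
    by (auto simp: bij_betw_def)
  have G: "G t \<in> El F.X.hom_to (FObj Y t)" "F.act (FObj Y t) (G t) = ?id t" if "t \<in> Obj J" for t
    using inv_into_into[OF id[OF that]] f_inv_into_f[OF id[OF that]] that by (simp_all add: G_def)
  have inj: "c = d" if "A \<in> Obj C" "c \<in> El F.X.hom_to A" "d \<in> El F.X.hom_to A"
    "F.act A c = F.act A d" for A c d
    using bij[OF that(1)] that by (auto simp: bij_betw_def inj_on_def)
  have "Res F.X.hom_to (FArr Y u) (G (Cod J u)) = G (Dom J u)" if "u \<in> Arr J" for u
  proof (rule inj[of "FObj Y (Dom J u)"])
    have [simp]: "Dom J u \<in> Obj J" "Cod J u \<in> Obj J"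
      using that F.Y.J.dom_in_Obj F.Y.J.cod_in_Obj by auto
    have "F.act (FObj Y (Dom J u)) (Res F.X.hom_to (FArr Y u) (G (Cod J u))) =
        Res F.Y.hom_to (FArr Y u) (?id (Cod J u))"
      using F.natural'[of "FArr Y u" "FObj Y (Dom J u)" "FObj Y (Cod J u)" "G (Cod J u)"] that
      by (simp add: G)
    also have "\<dots> = ?id (Dom J u)"
      using F.Y.Res_cls[OF F.Y.germ_Id[of "Cod J u"], of "FArr Y u"]
        F.Y.cls_shift[OF F.Y.germ_Id[of "Dom J u"], of u] that by simp
    finally show "F.act (FObj Y (Dom J u)) (Res F.X.hom_to (FArr Y u) (G (Cod J u))) =
        F.act (FObj Y (Dom J u)) (G (Dom J u))"
      by (simp add: G)
  qed (use that G F.Y.J.dom_in_Obj F.Y.J.cod_in_Obj in auto)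
  then have "G \<in> ind_Hom C (J, Y) (I, X)"
    using G(1) by (simp add: ind_Hom_def PiE_iff F.X.El_hom_to) (simp add: ind_presheaf_def G_def)
  then have G': "ind_arrow C J Y I X G"
    by unfold_locales
  interpret G: ind_arrow C J Y I X G by (rule G')
  have FG: "F.act A (G.act A c) = c" if "c \<in> El F.Y.hom_to A" for A c
    using that
  proof (rule F.Y.ElE)
    fix t \<phi> assume \<phi>: "F.Y.germ A t \<phi>" and c: "c = F.Y.cls A t \<phi>"
    note [simp] = F.Y.germD[OF \<phi>]
    show ?thesis
      using F.natural'[of \<phi> A "FObj Y t" "G t"] F.Y.Res_cls[OF F.Y.germ_Id[of t], of \<phi> A]
      by (simp add: c G.act_cls[OF \<phi>] G)
  qed
  show thesis
    by (rule that[OF G']) (use FG inj F.map_in G.map_in in auto)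
qed

text \<open>A recognition principle for \<open>Y\<close> as the colimit in Ind(C) of the objects
  \<open>D k\<close>, with cocone \<open>\<xi>\<close>. Every stage of \<open>Y\<close> has to
  factor through some \<open>D k\<close>, which gives surjectivity on maps from objects of C; and
  arrows into \<open>D k\<close> that \<open>\<xi> k\<close> identifies have to be identified
  further along \<open>K\<close>, which gives injectivity.\<close>

lemma
  assumes "ind_object C K D" "ind_object C J Y"
    and \<xi>: "\<xi> \<in> extensional (Obj K)"
      "\<And>k. k \<in> Obj K \<Longrightarrow> \<xi> k \<in> El (ind_presheaf C (J, Y)) (FObj D k)"
      "\<And>e. e \<in> Arr K \<Longrightarrow> Res (ind_presheaf C (J, Y)) (FArr D e) (\<xi> (Cod K e)) = \<xi> (Dom K e)"
    and cover: "\<And>s. s \<in> Obj J \<Longrightarrow> \<exists>k\<in>Obj K. \<exists>\<phi>\<in>Hom C (FObj Y s) (FObj D k).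
      Res (ind_presheaf C (J, Y)) \<phi> (\<xi> k) = colim_class C (FObj Y s) (J, Y) (s, Id C (FObj Y s))"
    and separate: "\<And>k A \<phi> \<psi>. \<lbrakk>k \<in> Obj K; \<phi> \<in> Hom C A (FObj D k); \<psi> \<in> Hom C A (FObj D k);
      Res (ind_presheaf C (J, Y)) \<phi> (\<xi> k) = Res (ind_presheaf C (J, Y)) \<psi> (\<xi> k)\<rbrakk> \<Longrightarrow>
      \<exists>e\<in>Arr K. Dom K e = k \<and> Comp C (FArr D e) \<phi> = Comp C (FArr D e) \<psi>"
  shows ind_arrow_cocone: "ind_arrow C K D J Y \<xi>"
    and bij_act_cocone: "A \<in> Obj C \<Longrightarrow> bij_betw (ind_act C (J, Y) \<xi> A)
      (El (ind_presheaf C (K, D)) A) (El (ind_presheaf C (J, Y)) A)"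
proof -
  interpret D: ind_object C K D by fact
  interpret Y: ind_object C J Y by fact
  have "\<xi> \<in> ind_Hom C (K, D) (J, Y)"
    using \<xi> by (simp add: ind_Hom_def PiE_iff Y.El_hom_to) (simp add: ind_presheaf_def)
  then show *: "ind_arrow C K D J Y \<xi>"
    by unfold_locales
  interpret \<xi>: ind_arrow C K D J Y \<xi> by (rule *)
  show "bij_betw (\<xi>.act A) (El D.hom_to A) (El Y.hom_to A)" if A: "A \<in> Obj C"
    unfolding bij_betw_def
  proof
    show "inj_on (\<xi>.act A) (El D.hom_to A)"
    proof (rule inj_onI)
      fix c d assume c: "c \<in> El D.hom_to A" and d: "d \<in> El D.hom_to A"
        and eq: "\<xi>.act A c = \<xi>.act A d"
      obtain k \<phi> \<psi> where g: "D.germ A k \<phi>" "D.germ A k \<psi>"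
        and cd: "c = D.cls A k \<phi>" "d = D.cls A k \<psi>"
        by (rule D.common_stage[OF c[unfolded D.El_hom_to] d[unfolded D.El_hom_to]])
      have "Res Y.hom_to \<phi> (\<xi> k) = Res Y.hom_to \<psi> (\<xi> k)"
        using eq g cd by (simp add: \<xi>.act_cls)
      then obtain e where "e \<in> Arr K" "Dom K e = k" "Comp C (FArr D e) \<phi> = Comp C (FArr D e) \<psi>"
        using separate[of k \<phi> A \<psi>] g by (auto simp: D.germ_def D.Hom_iff)
      then show "c = d"
        using D.cls_shift[OF g(1), of e] D.cls_shift[OF g(2), of e] cd by simp
    qed
    show "\<xi>.act A ` El D.hom_to A = El Y.hom_to A"
    proof
      show "\<xi>.act A ` El D.hom_to A \<subseteq> El Y.hom_to A"
        using \<xi>.map_in[OF A] by auto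
      show "El Y.hom_to A \<subseteq> \<xi>.act A ` El D.hom_to A"
      proof
        fix c assume "c \<in> El Y.hom_to A"
        then obtain s \<psi> where \<psi>: "Y.germ A s \<psi>" and c: "c = Y.cls A s \<psi>"
          by (rule Y.ElE)
        note [simp] = Y.germD[OF \<psi>]
        obtain k \<phi> where k [simp]: "k \<in> Obj K" and [simp]: "\<phi> \<in> Arr C" "Dom C \<phi> = FObj Y s"
            "Cod C \<phi> = FObj D k"
          and \<phi>: "Res Y.hom_to \<phi> (\<xi> k) = Y.cls (FObj Y s) s (Id C (FObj Y s))"
          using cover[of s] by (auto simp: D.Hom_iff)
        have g: "D.germ A k (Comp C \<phi> \<psi>)"
          by (simp add: D.germ_def)
        have "\<xi>.act A (D.cls A k (Comp C \<phi> \<psi>)) = c"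
          using Y.hom_to.Res_Comp[of \<psi> \<phi> "\<xi> k"] \<xi>(2)[OF k] Y.Res_cls[OF Y.germ_Id[of s], of \<psi> A]
          by (simp add: \<xi>.act_cls[OF g] \<phi> c)
        then show "c \<in> \<xi>.act A ` El D.hom_to A"
          using D.cls_El[OF g] by blast
      qed
    qed
  qed
qed


section \<open>The category of weak equivalences over an ind-morphism\<close>

text \<open>The comma category of arrows of C over \<open>f\<close>, cut down to weak equivalences:
  an object \<open>(w, x, y)\<close> is a square from \<open>w\<close> to \<open>f\<close>. An arrow
  stores both its ends because \<open>u\<close> and \<open>v\<close> do not determine them.\<close>

definition W_over ::
  "('o, 'a) cat \<Rightarrow> 'a set \<Rightarrow> ('o, 'a, 'x) presheaf \<Rightarrow> ('o, 'a, 'y) presheaf \<Rightarrow>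
     ('o \<Rightarrow> 'x \<Rightarrow> 'y) \<Rightarrow>
     ('a \<times> 'x \<times> 'y, ('a \<times> 'x \<times> 'y) \<times> ('a \<times> 'x \<times> 'y) \<times> 'a \<times> 'a) cat" where
  "W_over C W P Q f =
     (let Ob = {(w, x, y). w \<in> W \<and> x \<in> El P (Dom C w) \<and> y \<in> El Q (Cod C w) \<and>
        f (Dom C w) x = Res Q w y} in
      \<lparr>Obj = Ob,
       Arr = {((w, x, y), (w', x', y'), u, v) | w x y w' x' y' u v.
         (w, x, y) \<in> Ob \<and> (w', x', y') \<in> Ob \<and>
         u \<in> Hom C (Dom C w) (Dom C w') \<and> v \<in> Hom C (Cod C w) (Cod C w') \<and>
         Comp C w' u = Comp C v w \<and> Res P u x' = x \<and> Res Q v y' = y},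
       Dom = fst, Cod = (\<lambda>(p, q, u, v). q),
       Id = (\<lambda>(w, x, y). ((w, x, y), (w, x, y), Id C (Dom C w), Id C (Cod C w))),
       Comp = (\<lambda>(_, r, u', v') (p, _, u, v). (p, r, Comp C u' u, Comp C v' v))\<rparr>)"

lemma W_over_simps [simp]:
  "Dom (W_over C W P Q f) (p, q, u, v) = p"
  "Cod (W_over C W P Q f) (p, q, u, v) = q"
  "Id (W_over C W P Q f) (w, x, y) = ((w, x, y), (w, x, y), Id C (Dom C w), Id C (Cod C w))"
  "Comp (W_over C W P Q f) (q', r, u', v') (p, q, u, v) = (p, r, Comp C u' u, Comp C v' v)"
  by (simp_all add: W_over_def)

lemma W_over_Obj:
  "(w, x, y) \<in> Obj (W_over C W P Q f) \<longleftrightarrow>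
     w \<in> W \<and> x \<in> El P (Dom C w) \<and> y \<in> El Q (Cod C w) \<and> f (Dom C w) x = Res Q w y"
  by (simp add: W_over_def)

lemma W_over_Arr:
  "((w, x, y), (w', x', y'), u, v) \<in> Arr (W_over C W P Q f) \<longleftrightarrow>
     (w, x, y) \<in> Obj (W_over C W P Q f) \<and> (w', x', y') \<in> Obj (W_over C W P Q f) \<and>
     u \<in> Arr C \<and> Dom C u = Dom C w \<and> Cod C u = Dom C w' \<and>
     v \<in> Arr C \<and> Dom C v = Cod C w \<and> Cod C v = Cod C w' \<and>
     Comp C w' u = Comp C v w \<and> Res P u x' = x \<and> Res Q v y' = y"
  by (auto simp: W_over_def Hom_def)

lemma W_over_HomE:
  assumes "e \<in> Hom (W_over C W P Q f) p q"
  obtains w x y w' x' y' u v where "p = (w, x, y)" "q = (w', x', y')"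
    "e = ((w, x, y), (w', x', y'), u, v)"
    "((w, x, y), (w', x', y'), u, v) \<in> Arr (W_over C W P Q f)"
proof (cases e)
  case (fields p' q' u v)
  then show thesis
    using assms that by (cases p; cases q) (auto simp: Hom_def)
qed

lemma category_W_over:
  assumes "presheaf_map C P Q f" "W \<subseteq> Arr C"
  shows "category (W_over C W P Q f)" (is "category ?K")
proof -
  interpret presheaf_map C P Q f by fact
  have W: "w \<in> Arr C" if "w \<in> W" for w
    using assms(2) that by blast
  show ?thesis
  proof
    show "Dom ?K e \<in> Obj ?K" "Cod ?K e \<in> Obj ?K" if "e \<in> Arr ?K" for e
      using that by (cases e; auto simp: W_over_Arr)+
    show "Id ?K p \<in> Hom ?K p p" if "p \<in> Obj ?K" for p
      using that W
      by (cases p) (auto simp: Hom_def W_over_Arr W_over_Obj P.dom_in_Obj P.cod_in_Obj P.Res_Id Q.Res_Id)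
    show "Comp ?K g e \<in> Hom ?K p r" if e: "e \<in> Hom ?K p q" and g: "g \<in> Hom ?K q r" for e g p q r
      using W by (rule_tac W_over_HomE[OF e], rule_tac W_over_HomE[OF g])
        (auto simp: Hom_def W_over_Arr W_over_Obj P.Res_Comp Q.Res_Comp P.assoc[symmetric],
          auto simp: P.assoc)
    show "Comp ?K (Id ?K q) e = e" "Comp ?K e (Id ?K p) = e" if "e \<in> Hom ?K p q" for e p q
      by (rule W_over_HomE[OF that]; auto simp: W_over_Arr)+
    show "Comp ?K h (Comp ?K g e) = Comp ?K (Comp ?K h g) e"
      if e: "e \<in> Hom ?K p q" and g: "g \<in> Hom ?K q r" and h: "h \<in> Hom ?K r s" for e g h p q r s
      by (rule W_over_HomE[OF e], rule W_over_HomE[OF g], rule W_over_HomE[OF h])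
        (auto simp: W_over_Arr P.assoc)
  qed
qed

locale cofinal_ind_arrow = bifibrant_category C Cof W + ind_arrow C I X J Y F
  for C :: "('o, 'a) cat" and Cof W and I :: "('i, 'i) cat" and X :: "('i, 'i, 'o, 'a) func"
    and J :: "('i, 'i) cat" and Y :: "('i, 'i, 'o, 'a) func" and F +
  assumes cofinal: "W_cofinal C W X.hom_to Y.hom_to act"
begin

abbreviation K where "K \<equiv> W_over C W X.hom_to Y.hom_to act"

sublocale K: category K
  by (rule category_W_over) (use W_Arr in \<open>auto intro: presheaf_map_axioms\<close>)

lemma over_square:
  assumes "a \<in> Arr C" "Dom C a = A" "Cod C a = B" "x \<in> El X.hom_to A" "y \<in> El Y.hom_to B"
    "act A x = Res Y.hom_to a y"
  obtains w x' y' u v where "(w, x', y') \<in> Obj K" "w \<in> Arr C" "u \<in> Arr C" "v \<in> Arr C"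
    "Dom C u = A" "Cod C u = Dom C w" "Dom C v = B" "Cod C v = Cod C w" "w \<cdot> u = v \<cdot> a"
    "Res X.hom_to u x' = x" "Res Y.hom_to v y' = y"
proof (rule W_cofinalE[OF cofinal assms])
  fix w u v A' B' x' y'
  assume "w \<in> W" "u \<in> Arr C" "v \<in> Arr C" "Dom C w = A'" "Cod C w = B'" "Dom C u = A" "Cod C u = A'"
    "Dom C v = B" "Cod C v = B'" "x' \<in> El X.hom_to A'" "y' \<in> El Y.hom_to B'" "w \<cdot> u = v \<cdot> a"
    "Res X.hom_to u x' = x" "Res Y.hom_to v y' = y" "act A' x' = Res Y.hom_to w y'"
  then show thesis
    using that[of w x' y' u v] W_Arr by (simp add: W_over_Obj)
qed

text \<open>A representative \<open>\<kappa> : X s -> Y t\<close> of \<open>F s\<close>, with the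
  classes of the identities as elements, is an arrow over \<open>F\<close>; cofinality carries it
  into a weak equivalence.\<close>

lemma over_stage_dom:
  assumes "s \<in> Obj I"
  obtains w x y u where "(w, x, y) \<in> Obj K" "u \<in> Hom C (FObj X s) (Dom C w)"
    "Res X.hom_to u x = X.cls (FObj X s) s (Id C (FObj X s))"
proof -
  obtain t \<kappa> where \<kappa>: "Y.germ (FObj X s) t \<kappa>" "F s = Y.cls (FObj X s) t \<kappa>"
    using F_El[OF assms] by (rule Y.ElE)
  note [simp] = Y.germD[OF \<kappa>(1)]
  have "act (FObj X s) (X.cls (FObj X s) s (Id C (FObj X s))) =
      Res Y.hom_to \<kappa> (Y.cls (FObj Y t) t (Id C (FObj Y t)))"
    using Y.Res_cls[OF Y.germ_Id[of t], of \<kappa> "FObj X s"] \<kappa>(2) by (simp add: act_Id[OF assms])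
  then show thesis
    by (rule over_square[OF Y.germD(2,3,4)[OF \<kappa>(1)] X.cls_El[OF X.germ_Id[OF assms]]
          Y.cls_El[OF Y.germ_Id[OF Y.germD(1)[OF \<kappa>(1)]]]])
      (use that in \<open>auto simp: Hom_iff\<close>)
qed

text \<open>No stage of \<open>X\<close> need map to the given stage \<open>t\<close> of
  \<open>Y\<close>, so the arrow over \<open>F\<close> used here starts at the initial object, over
  which \<open>X\<close> has exactly one element.\<close>

lemma over_stage_cod:
  assumes "t \<in> Obj J"
  obtains w x y v where "(w, x, y) \<in> Obj K" "v \<in> Hom C (FObj Y t) (Cod C w)"
    "Res Y.hom_to v y = Y.cls (FObj Y t) t (Id C (FObj Y t))"
proof -
  let ?y = "Y.cls (FObj Y t) t (Id C (FObj Y t))"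
  have y: "?y \<in> El Y.hom_to (FObj Y t)"
    by (rule Y.cls_El[OF Y.germ_Id[OF assms]])
  obtain Z where Z: "is_initial C Z"
    using initial_exists[OF finite_colimits] by blast
  then have [simp]: "Z \<in> Obj C"
    by (simp add: is_initial_def)
  obtain z where z: "z \<in> Arr C" "Dom C z = Z" "Cod C z = FObj Y t"
    using initial_arrow[OF Z Y.FObj_in[OF assms]] .
  obtain x0 where x0: "x0 \<in> El X.hom_to Z"
    using X.hom_to.initial_El[OF Z] by blast
  have "act Z x0 = Res Y.hom_to z ?y"
    using map_in[of Z x0] x0 z y Y.hom_to.Res_mem[of z Z ?y]
    by (intro Y.hom_to.initial_El_unique[OF Z]) simp_all
  then show thesis
    by (rule over_square[OF z x0 y]) (use that in \<open>auto simp: Hom_iff\<close>)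
qed

text \<open>The sum of the two weak equivalences, formed by pushouts over the initial object, is an
  arrow \<open>a\<close> over \<open>F\<close>. Cofinality provides a weak equivalence beyond it,
  which receives both summands.\<close>

lemma over_upper_bound:
  assumes "(w1, x1, y1) \<in> Obj K" "(w2, x2, y2) \<in> Obj K"
  obtains q where "q \<in> Obj K" "Hom K (w1, x1, y1) q \<noteq> {}" "Hom K (w2, x2, y2) q \<noteq> {}"
proof -
  note obj = assms
  have [simp]: "w1 \<in> Arr C" "w2 \<in> Arr C"
    and el [simp]: "x1 \<in> El X.hom_to (Dom C w1)" "x2 \<in> El X.hom_to (Dom C w2)"
      "y1 \<in> El Y.hom_to (Cod C w1)" "y2 \<in> El Y.hom_to (Cod C w2)"
    and sq: "act (Dom C w1) x1 = Res Y.hom_to w1 y1" "act (Dom C w2) x2 = Res Y.hom_to w2 y2"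
    using assms W_Arr by (auto simp: W_over_Obj)
  have Ob [simp]: "Dom C w1 \<in> Obj C" "Dom C w2 \<in> Obj C" "Cod C w1 \<in> Obj C" "Cod C w2 \<in> Obj C"
    by (simp_all add: dom_in_Obj cod_in_Obj)
  obtain Z where Z: "is_initial C Z"
    using initial_exists[OF finite_colimits] by blast
  then have [simp]: "Z \<in> Obj C"
    by (simp add: is_initial_def)
  obtain a1 where [simp]: "a1 \<in> Arr C" "Dom C a1 = Z" "Cod C a1 = Dom C w1"
    using initial_arrow[OF Z Ob(1)] .
  obtain a2 where [simp]: "a2 \<in> Arr C" "Dom C a2 = Z" "Cod C a2 = Dom C w2"
    using initial_arrow[OF Z Ob(2)] .
  obtain b1 where [simp]: "b1 \<in> Arr C" "Dom C b1 = Z" "Cod C b1 = Cod C w1"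
    using initial_arrow[OF Z Ob(3)] .
  obtain b2 where [simp]: "b2 \<in> Arr C" "Dom C b2 = Z" "Cod C b2 = Cod C w2"
    using initial_arrow[OF Z Ob(4)] .
  obtain i1 i2 A where A: "is_pushout C a1 a2 i1 i2"
    and [simp]: "i1 \<in> Arr C" "i2 \<in> Arr C" "Dom C i1 = Dom C w1" "Dom C i2 = Dom C w2"
      "Cod C i1 = A" "Cod C i2 = A" "A \<in> Obj C"
    by (rule pushout_obtain[of a1 a2]) auto
  obtain j1 j2 B where B: "is_pushout C b1 b2 j1 j2"
    and [simp]: "j1 \<in> Arr C" "j2 \<in> Arr C" "Dom C j1 = Cod C w1" "Dom C j2 = Cod C w2"
      "Cod C j1 = B" "Cod C j2 = B" "B \<in> Obj C"
    by (rule pushout_obtain[of b1 b2]) auto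
  have "Res X.hom_to a1 x1 = Res X.hom_to a2 x2"
    by (rule X.hom_to.initial_El_unique[OF Z]) simp_all
  then obtain x where x [simp]: "x \<in> El X.hom_to A"
    and xi: "Res X.hom_to i1 x = x1" "Res X.hom_to i2 x = x2"
    using X.hom_to.glue[OF A, of x1 x2] by auto
  have "Res Y.hom_to b1 y1 = Res Y.hom_to b2 y2"
    by (rule Y.hom_to.initial_El_unique[OF Z]) simp_all
  then obtain y where y [simp]: "y \<in> El Y.hom_to B"
    and yj: "Res Y.hom_to j1 y = y1" "Res Y.hom_to j2 y = y2"
    using Y.hom_to.glue[OF B, of y1 y2] by auto
  obtain a where a [simp]: "a \<in> Arr C" "Dom C a = A" "Cod C a = B"
    and ai: "a \<cdot> i1 = j1 \<cdot> w1" "a \<cdot> i2 = j2 \<cdot> w2"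
    by (rule is_pushout_induced[OF A, of "j1 \<cdot> w1" "j2 \<cdot> w2"])
      (auto intro: initial_arrow_unique[OF Z])
  have "act A x = Res Y.hom_to a y"
  proof (rule Y.hom_to.separated[OF A])
    show "Res Y.hom_to i1 (act A x) = Res Y.hom_to i1 (Res Y.hom_to a y)"
      using natural'[of i1 "Dom C w1" A x] Y.hom_to.Res_Comp[of i1 a y]
        Y.hom_to.Res_Comp[of w1 j1 y] ai xi yj sq by simp
    show "Res Y.hom_to i2 (act A x) = Res Y.hom_to i2 (Res Y.hom_to a y)"
      using natural'[of i2 "Dom C w2" A x] Y.hom_to.Res_Comp[of i2 a y]
        Y.hom_to.Res_Comp[of w2 j2 y] ai xi yj sq by simp
  qed auto
  then obtain w x' y' u v where q: "(w, x', y') \<in> Obj K"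
    and [simp]: "w \<in> Arr C" "u \<in> Arr C" "v \<in> Arr C"
      "Dom C u = A" "Cod C u = Dom C w" "Dom C v = B" "Cod C v = Cod C w"
    and wu: "w \<cdot> u = v \<cdot> a" and uv: "Res X.hom_to u x' = x" "Res Y.hom_to v y' = y"
    by (rule over_square[OF a x y])
  have el' [simp]: "x' \<in> El X.hom_to (Dom C w)" "y' \<in> El Y.hom_to (Cod C w)"
    using q by (auto simp: W_over_Obj)
  have wui: "w \<cdot> u \<cdot> i1 = v \<cdot> j1 \<cdot> w1" "w \<cdot> u \<cdot> i2 = v \<cdot> j2 \<cdot> w2"
    by (simp_all add: Comp_reduce[OF wu] assoc ai)
  have "((w1, x1, y1), (w, x', y'), u \<cdot> i1, v \<cdot> j1) \<in> Hom K (w1, x1, y1) (w, x', y')"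
    "((w2, x2, y2), (w, x', y'), u \<cdot> i2, v \<cdot> j2) \<in> Hom K (w2, x2, y2) (w, x', y')"
    using q obj wui uv xi yj
    by (simp_all add: K.Hom_iff W_over_Arr X.hom_to.Res_Comp Y.hom_to.Res_Comp assoc)
  then show thesis
    using that[OF q] by blast
qed

text \<open>Represent the data at stages \<open>s\<close> of \<open>X\<close> and \<open>t\<close> of \<open>Y\<close> where the given identities hold
  strictly; the square then factors through an arrow \<open>X s \<rightarrow> Y t\<close> over \<open>F\<close>.\<close>

lemma over_equalize:
  assumes obj: "(w, x, y) \<in> Obj K"
    and "\<phi>1 \<in> Arr C" "\<phi>2 \<in> Arr C" "Dom C \<phi>1 = A" "Dom C \<phi>2 = A"
      "Cod C \<phi>1 = Dom C w" "Cod C \<phi>2 = Dom C w"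
    and x12: "Res X.hom_to \<phi>1 x = Res X.hom_to \<phi>2 x"
    and "\<psi>1 \<in> Arr C" "\<psi>2 \<in> Arr C" "Dom C \<psi>1 = B" "Dom C \<psi>2 = B"
      "Cod C \<psi>1 = Cod C w" "Cod C \<psi>2 = Cod C w"
    and y12: "Res Y.hom_to \<psi>1 y = Res Y.hom_to \<psi>2 y"
  obtains q u v where "q \<in> Obj K" "((w, x, y), q, u, v) \<in> Arr K" "u \<cdot> \<phi>1 = u \<cdot> \<phi>2"
    "v \<cdot> \<psi>1 = v \<cdot> \<psi>2"
proof -
  note [simp] = assms(2-7) assms(9-14)
  have w [simp]: "w \<in> Arr C"
    and el: "x \<in> El X.hom_to (Dom C w)" "y \<in> El Y.hom_to (Cod C w)"
    and sq: "act (Dom C w) x = Res Y.hom_to w y"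
    using obj W_Arr by (auto simp: W_over_Obj)
  obtain s0 \<phi>0 where \<phi>0: "X.germ (Dom C w) s0 \<phi>0" "x = X.cls (Dom C w) s0 \<phi>0"
    using el(1) by (rule X.ElE)
  note [simp] = X.germD[OF \<phi>0(1)]
  have "X.cls A s0 (\<phi>0 \<cdot> \<phi>1) = X.cls A s0 (\<phi>0 \<cdot> \<phi>2)"
    using x12 X.Res_cls[OF \<phi>0(1), of \<phi>1 A] X.Res_cls[OF \<phi>0(1), of \<phi>2 A] \<phi>0(2) by simp
  \<comment> \<open>Three refinements of stages are made: \<open>p\<close> makes the two
    restrictions of \<open>x\<close> agree, \<open>r\<close> those of \<open>y\<close>, and
    \<open>l\<close> makes the square from \<open>w\<close> to a representative of
    \<open>F s\<close> commute.\<close>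
  then obtain p where p [simp]: "p \<in> Arr I" "Dom I p = s0"
    and p12: "FArr X p \<cdot> \<phi>0 \<cdot> \<phi>1 = FArr X p \<cdot> \<phi>0 \<cdot> \<phi>2"
    by (rule X.cls_eq_same_stage) (simp_all add: X.germ_def)
  define s where "s = Cod I p"
  define \<phi> where "\<phi> = FArr X p \<cdot> \<phi>0"
  have \<phi>: "X.germ (Dom C w) s \<phi>" "x = X.cls (Dom C w) s \<phi>"
    using X.germ_shift[OF \<phi>0(1) p] X.cls_shift[OF \<phi>0(1) p] \<phi>0(2) by (simp_all add: s_def \<phi>_def)
  note [simp] = X.germD[OF \<phi>(1)]
  have \<phi>12: "\<phi> \<cdot> \<phi>1 = \<phi> \<cdot> \<phi>2"
    using p12 by (simp add: \<phi>_def assoc)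
  obtain t0 \<kappa>0 \<psi>0 where \<kappa>0: "Y.germ (FObj X s) t0 \<kappa>0" "F s = Y.cls (FObj X s) t0 \<kappa>0"
    and \<psi>0: "Y.germ (Cod C w) t0 \<psi>0" "y = Y.cls (Cod C w) t0 \<psi>0"
    by (rule Y.common_stage[OF F_El[OF X.germD(1)[OF \<phi>(1)], unfolded Y.El_hom_to]
          el(2)[unfolded Y.El_hom_to]])
  note [simp] = Y.germD[OF \<kappa>0(1)] Y.germD[OF \<psi>0(1)]
  have "Y.cls B t0 (\<psi>0 \<cdot> \<psi>1) = Y.cls B t0 (\<psi>0 \<cdot> \<psi>2)"
    using y12 Y.Res_cls[OF \<psi>0(1), of \<psi>1 B] Y.Res_cls[OF \<psi>0(1), of \<psi>2 B] \<psi>0(2) by simp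
  then obtain r where r [simp]: "r \<in> Arr J" "Dom J r = t0"
    and r12: "FArr Y r \<cdot> \<psi>0 \<cdot> \<psi>1 = FArr Y r \<cdot> \<psi>0 \<cdot> \<psi>2"
    by (rule Y.cls_eq_same_stage) (simp_all add: Y.germ_def)
  define t1 where "t1 = Cod J r"
  define \<kappa>1 where "\<kappa>1 = FArr Y r \<cdot> \<kappa>0"
  define \<psi>3 where "\<psi>3 = FArr Y r \<cdot> \<psi>0"
  have \<kappa>1: "Y.germ (FObj X s) t1 \<kappa>1" "F s = Y.cls (FObj X s) t1 \<kappa>1"
    using Y.germ_shift[OF \<kappa>0(1) r] Y.cls_shift[OF \<kappa>0(1) r] \<kappa>0(2) by (simp_all add: t1_def \<kappa>1_def)
  have \<psi>3: "Y.germ (Cod C w) t1 \<psi>3" "y = Y.cls (Cod C w) t1 \<psi>3"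
    using Y.germ_shift[OF \<psi>0(1) r] Y.cls_shift[OF \<psi>0(1) r] \<psi>0(2) by (simp_all add: t1_def \<psi>3_def)
  note [simp] = Y.germD[OF \<kappa>1(1)] Y.germD[OF \<psi>3(1)]
  have "Y.cls (Dom C w) t1 (\<kappa>1 \<cdot> \<phi>) = Y.cls (Dom C w) t1 (\<psi>3 \<cdot> w)"
    using sq Y.Res_cls[OF \<kappa>1(1), of \<phi> "Dom C w"] Y.Res_cls[OF \<psi>3(1), of w "Dom C w"] \<phi>(2)
      \<kappa>1(2) \<psi>3(2) by (simp add: act_cls[OF \<phi>(1)])
  then obtain l where l [simp]: "l \<in> Arr J" "Dom J l = t1"
    and l12: "FArr Y l \<cdot> \<kappa>1 \<cdot> \<phi> = FArr Y l \<cdot> \<psi>3 \<cdot> w"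
    by (rule Y.cls_eq_same_stage) (simp_all add: Y.germ_def)
  define t where "t = Cod J l"
  define \<kappa> where "\<kappa> = FArr Y l \<cdot> \<kappa>1"
  define \<psi> where "\<psi> = FArr Y l \<cdot> \<psi>3"
  have \<kappa>: "Y.germ (FObj X s) t \<kappa>" "F s = Y.cls (FObj X s) t \<kappa>"
    using Y.germ_shift[OF \<kappa>1(1) l] Y.cls_shift[OF \<kappa>1(1) l] \<kappa>1(2) by (simp_all add: t_def \<kappa>_def)
  have \<psi>: "Y.germ (Cod C w) t \<psi>" "y = Y.cls (Cod C w) t \<psi>"
    using Y.germ_shift[OF \<psi>3(1) l] Y.cls_shift[OF \<psi>3(1) l] \<psi>3(2) by (simp_all add: t_def \<psi>_def)
  note [simp] = Y.germD[OF \<kappa>(1)] Y.germD[OF \<psi>(1)]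
  have \<kappa>\<phi>: "\<kappa> \<cdot> \<phi> = \<psi> \<cdot> w"
    using l12 by (simp add: \<kappa>_def \<psi>_def assoc)
  have "\<psi>3 \<cdot> \<psi>1 = \<psi>3 \<cdot> \<psi>2"
    using r12 by (simp add: \<psi>3_def assoc)
  then have \<psi>12: "\<psi> \<cdot> \<psi>1 = \<psi> \<cdot> \<psi>2"
    by (simp add: \<psi>_def assoc)
  \<comment> \<open>With these identity classes \<open>\<kappa>\<close> is an arrow over
    \<open>F\<close> through which \<open>(w, x, y)\<close> factors. As \<open>\<phi>\<close> and
    \<open>\<psi>\<close> already equalise the given pairs, so does whatever follows them.\<close>
  let ?x = "X.cls (FObj X s) s (Id C (FObj X s))" and ?y = "Y.cls (FObj Y t) t (Id C (FObj Y t))"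
  have xy: "?x \<in> El X.hom_to (FObj X s)" "?y \<in> El Y.hom_to (FObj Y t)"
    by (simp_all add: X.cls_El X.germ_Id Y.cls_El Y.germ_Id)
  have "act (FObj X s) ?x = Res Y.hom_to \<kappa> ?y"
    using Y.Res_cls[OF Y.germ_Id[of t], of \<kappa> "FObj X s"] by (simp add: act_Id \<kappa>(2))
  then obtain w' x' y' u v where q: "(w', x', y') \<in> Obj K"
    and [simp]: "w' \<in> Arr C" "u \<in> Arr C" "v \<in> Arr C"
      "Dom C u = FObj X s" "Cod C u = Dom C w'" "Dom C v = FObj Y t" "Cod C v = Cod C w'"
    and wu: "w' \<cdot> u = v \<cdot> \<kappa>" and uv: "Res X.hom_to u x' = ?x" "Res Y.hom_to v y' = ?y"
    by (rule over_square[OF Y.germD(2,3,4)[OF \<kappa>(1)] xy])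
  have [simp]: "x' \<in> El X.hom_to (Dom C w')" "y' \<in> El Y.hom_to (Cod C w')"
    using q by (auto simp: W_over_Obj)
  have "w' \<cdot> u \<cdot> \<phi> = v \<cdot> \<psi> \<cdot> w"
    by (simp add: Comp_reduce[OF wu] assoc \<kappa>\<phi>)
  moreover have "Res X.hom_to (u \<cdot> \<phi>) x' = x"
    using X.hom_to.Res_Comp[of \<phi> u x'] uv X.Res_cls[OF X.germ_Id[of s], of \<phi> "Dom C w"] \<phi>(2) by simp
  moreover have "Res Y.hom_to (v \<cdot> \<psi>) y' = y"
    using Y.hom_to.Res_Comp[of \<psi> v y'] uv Y.Res_cls[OF Y.germ_Id[of t], of \<psi> "Cod C w"] \<psi>(2) by simp
  ultimately have "((w, x, y), (w', x', y'), u \<cdot> \<phi>, v \<cdot> \<psi>) \<in> Arr K"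
    using q obj by (simp add: W_over_Arr assoc)
  then show thesis
    using that[OF q] by (simp add: assoc \<phi>12 \<psi>12)
qed

lemma filtered_K: "filtered_category K"
  unfolding filtered_category_def
proof (intro conjI ballI)
  show "category K"
    by unfold_locales
  obtain s where "s \<in> Obj I"
    using X.filtered_J unfolding filtered_category_def by blast
  then show "Obj K \<noteq> {}"
    by (rule over_stage_dom) auto
  show "\<exists>q\<in>Obj K. Hom K p1 q \<noteq> {} \<and> Hom K p2 q \<noteq> {}" if "p1 \<in> Obj K" "p2 \<in> Obj K" for p1 p2
    using that by (cases p1; cases p2) (metis over_upper_bound)
  show "\<exists>r\<in>Obj K. \<exists>h\<in>Hom K q r. Comp K h d = Comp K h e"
    if "p \<in> Obj K" "q \<in> Obj K" and d: "d \<in> Hom K p q" and e: "e \<in> Hom K p q" for p q d e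
  proof -
    obtain w x y w' x' y' u1 v1 where pq: "p = (w, x, y)" "q = (w', x', y')"
      and d': "d = ((w, x, y), (w', x', y'), u1, v1)"
      "((w, x, y), (w', x', y'), u1, v1) \<in> Arr K"
      using d by (rule W_over_HomE)
    obtain u2 v2 where e': "e = ((w, x, y), (w', x', y'), u2, v2)"
      "((w, x, y), (w', x', y'), u2, v2) \<in> Arr K"
      using e by (rule W_over_HomE) (auto simp: pq)
    obtain r u v where r: "r \<in> Obj K" "((w', x', y'), r, u, v) \<in> Arr K" "u \<cdot> u1 = u \<cdot> u2"
      "v \<cdot> v1 = v \<cdot> v2"
      by (rule over_equalize[of w' x' y' u1 u2 "Dom C w" v1 v2 "Cod C w"])
        (use d'(2) e'(2) in \<open>auto simp: W_over_Arr\<close>)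
    show ?thesis
      by (intro bexI[OF _ r(1)] bexI[of _ "((w', x', y'), r, u, v)"])
        (use r pq d' e' in \<open>auto simp: K.Hom_iff\<close>)
  qed
qed

end


section \<open>Transporting an index category into the universe\<close>

lemma is_functor_comp:
  assumes "is_functor A B F" "is_functor B D G"
  shows "is_functor A D (func_comp G F)"
  using assms unfolding is_functor_def func_comp_def Hom_def by simp

text \<open>Ind-objects are indexed by categories with objects and arrows in \<open>'i\<close>, so
  the structure is carried along injections into \<open>'i\<close>. Of the resulting isomorphism the
  statement records surjectivity on objects and fullness.\<close>

lemma small_copy:
  fixes K :: "('k, 'l) cat"
  assumes K: "filtered_category K" and "Obj K \<lesssim> (UNIV :: 'i set)" "Arr K \<lesssim> (UNIV :: 'i set)"
  obtains K' :: "('i, 'i) cat" and \<Phi> :: "('i, 'i, 'k, 'l) func"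
  where "filtered_category K'" "is_functor K' K \<Phi>" "FObj \<Phi> ` Obj K' = Obj K"
    "\<forall>i\<in>Obj K'. \<forall>j\<in>Obj K'. FArr \<Phi> ` Hom K' i j = Hom K (FObj \<Phi> i) (FObj \<Phi> j)"
proof -
  interpret K: category K
    using K by (simp add: filtered_category_def)
  obtain eo :: "'k \<Rightarrow> 'i" where eo: "inj_on eo (Obj K)"
    using assms(2) unfolding lepoll_def by blast
  obtain ea :: "'l \<Rightarrow> 'i" where ea: "inj_on ea (Arr K)"
    using assms(3) unfolding lepoll_def by blast
  let ?o = "inv_into (Obj K) eo" and ?a = "inv_into (Arr K) ea"
  define K' :: "('i, 'i) cat" where
    "K' = \<lparr>Obj = eo ` Obj K, Arr = ea ` Arr K, Dom = (\<lambda>e. eo (Dom K (?a e))),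
       Cod = (\<lambda>e. eo (Cod K (?a e))), Id = (\<lambda>i. ea (Id K (?o i))),
       Comp = (\<lambda>g f. ea (Comp K (?a g) (?a f)))\<rparr>"
  define \<Phi> :: "('i, 'i, 'k, 'l) func" where "\<Phi> = \<lparr>FObj = ?o, FArr = ?a\<rparr>"
  have o [simp]: "?o (eo p) = p" if "p \<in> Obj K" for p
    using eo that by simp
  have a [simp]: "?a (ea e) = e" if "e \<in> Arr K" for e
    using ea that by simp
  have eo_eq [simp]: "eo p = eo q \<longleftrightarrow> p = q" if "p \<in> Obj K" "q \<in> Obj K" for p q
    using eo that by (auto simp: inj_on_def)
  have K'_simps [simp]: "Obj K' = eo ` Obj K" "Arr K' = ea ` Arr K"
    "e \<in> Arr K \<Longrightarrow> Dom K' (ea e) = eo (Dom K e)" "e \<in> Arr K \<Longrightarrow> Cod K' (ea e) = eo (Cod K e)"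
    "p \<in> Obj K \<Longrightarrow> Id K' (eo p) = ea (Id K p)"
    "e \<in> Arr K \<Longrightarrow> g \<in> Arr K \<Longrightarrow> Comp K' (ea g) (ea e) = ea (Comp K g e)" for e g p
    by (simp_all add: K'_def)
  have Hom': "Hom K' (eo p) (eo q) = ea ` Hom K p q" if "p \<in> Obj K" "q \<in> Obj K" for p q
    using that K.dom_in_Obj K.cod_in_Obj unfolding Hom_def by auto
  have HomE: "\<exists>p\<in>Obj K. \<exists>q\<in>Obj K. \<exists>e'\<in>Hom K p q. i = eo p \<and> j = eo q \<and> e = ea e'"
    if "e \<in> Hom K' i j" for e i j
    using that K.dom_in_Obj K.cod_in_Obj unfolding Hom_def by auto
  have "category K'"
  proof
    show "Dom K' e \<in> Obj K'" "Cod K' e \<in> Obj K'" if "e \<in> Arr K'" for e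
      using that K.dom_in_Obj K.cod_in_Obj by auto
    show "Id K' i \<in> Hom K' i i" if "i \<in> Obj K'" for i
      using that by (auto simp: Hom' K.Id_in_Hom)
    show "Comp K' g e \<in> Hom K' i k" if e: "e \<in> Hom K' i j" and g: "g \<in> Hom K' j k" for e g i j k
      using HomE[OF e] HomE[OF g] by (auto simp: Hom') (auto simp: K.Hom_iff)
    show "Comp K' (Id K' j) e = e" "Comp K' e (Id K' i) = e" if e: "e \<in> Hom K' i j" for e i j
      using HomE[OF e] by (auto simp: K.Hom_iff)
    show "Comp K' h (Comp K' g e) = Comp K' (Comp K' h g) e"
      if e: "e \<in> Hom K' i j" and g: "g \<in> Hom K' j k" and h: "h \<in> Hom K' k l" for e g h i j k l
      using HomE[OF e] HomE[OF g] HomE[OF h] by (auto simp: K.Hom_iff K.assoc)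
  qed
  moreover have "\<exists>k\<in>Obj K'. Hom K' i k \<noteq> {} \<and> Hom K' j k \<noteq> {}"
    if ij: "i \<in> Obj K'" "j \<in> Obj K'" for i j
  proof -
    obtain p q where pq: "p \<in> Obj K" "q \<in> Obj K" "i = eo p" "j = eo q"
      using ij by auto
    then obtain r where "r \<in> Obj K" "Hom K p r \<noteq> {}" "Hom K q r \<noteq> {}"
      using K unfolding filtered_category_def by meson
    then show ?thesis
      using pq by (intro bexI[of _ "eo r"]) (auto simp: Hom')
  qed
  moreover have "\<exists>k\<in>Obj K'. \<exists>w\<in>Hom K' j k. Comp K' w u = Comp K' w v"
    if u: "u \<in> Hom K' i j" and v: "v \<in> Hom K' i j" for i j u v
  proof -
    obtain p q u' where u': "p \<in> Obj K" "q \<in> Obj K" "u' \<in> Hom K p q" "i = eo p" "j = eo q"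
      "u = ea u'"
      using HomE[OF u] by blast
    then obtain v' where v': "v' \<in> Hom K p q" "v = ea v'"
      using v by (auto simp: Hom')
    obtain r w where r: "r \<in> Obj K" "w \<in> Hom K q r" "Comp K w u' = Comp K w v'"
      using K u'(1-3) v'(1) unfolding filtered_category_def by blast
    have "ea w \<in> Hom K' j (eo r)"
      using r u' by (auto simp: Hom')
    moreover have "Comp K' (ea w) u = Comp K' (ea w) v"
      using r u' v' by (simp add: K.Hom_iff)
    ultimately show ?thesis
      using r(1) by auto
  qed
  moreover have "Obj K' \<noteq> {}"
    using K by (simp add: filtered_category_def)
  ultimately have "filtered_category K'"
    unfolding filtered_category_def by blast
  moreover have "is_functor K' K \<Phi>"
    unfolding is_functor_def by (auto simp: \<Phi>_def K.Hom_iff K.dom_in_Obj K.cod_in_Obj)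
  moreover have "FObj \<Phi> ` Obj K' = Obj K"
    by (auto simp: \<Phi>_def image_image)
  moreover have "\<forall>i\<in>Obj K'. \<forall>j\<in>Obj K'. FArr \<Phi> ` Hom K' i j = Hom K (FObj \<Phi> i) (FObj \<Phi> j)"
    by (auto simp: \<Phi>_def Hom' image_image K.Hom_iff image_iff)
  ultimately show thesis
    by (rule that)
qed

text \<open>This is for a size estimate: a class of maps from \<open>A\<close> is determined by
  \<open>A\<close> and one chosen representative, which lives in a smaller set.\<close>

lemma (in ind_object) some_representative:
  assumes "c \<in> El hom_to A"
  shows "(SOME p. p \<in> c) \<in> UNIV \<times> Arr C" "colim_class C A (J, Y) (SOME p. p \<in> c) = c"
proof -
  obtain t \<phi> where \<phi>: "germ A t \<phi>" "c = cls A t \<phi>"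
    using assms by (rule ElE)
  obtain s \<psi> where s\<psi>: "(SOME p. p \<in> c) = (s, \<psi>)"
    by fastforce
  have "(SOME p. p \<in> c) \<in> c"
    by (rule someI[of _ "(t, \<phi>)"]) (simp add: \<phi>(2) cls_mem)
  then have "(s, \<psi>) \<in> cls A t \<phi>"
    unfolding s\<psi> \<phi>(2)[symmetric] .
  from mem_cls[OF \<phi>(1) this]
  show "(SOME p. p \<in> c) \<in> UNIV \<times> Arr C" "colim_class C A (J, Y) (SOME p. p \<in> c) = c"
    unfolding s\<psi> by (simp_all add: \<phi>(2) germD)
qed

text \<open>An infinite set absorbs its square.\<close>

lemma times_lepoll_UNIV:
  assumes "infinite (UNIV :: 'i set)" "A \<lesssim> (UNIV :: 'i set)" "B \<lesssim> (UNIV :: 'i set)"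
  shows "A \<times> B \<lesssim> (UNIV :: 'i set)"
proof -
  have "(UNIV :: 'i set) \<times> (UNIV :: 'i set) \<lesssim> (UNIV :: 'i set)"
    using card_of_Times_same_infinite[OF assms(1)] ordIso_imp_ordLeq
    unfolding lepoll_def card_of_ordLeq by blast
  then show ?thesis
    using lepoll_trans[OF times_lepoll_mono[OF assms(2,3)]] by blast
qed

text \<open>The action of a composite agrees with the composite of the actions on elements of the
  presheaf only, whereas \<open>W_cofinal\<close> takes actions as total functions.\<close>

lemma W_cofinal_cong:
  assumes "category C" "W \<subseteq> Arr C"
    "\<And>A x. A \<in> Obj C \<Longrightarrow> x \<in> El P A \<Longrightarrow> f A x = g A x"
  shows "W_cofinal C W P Q f \<longleftrightarrow> W_cofinal C W P Q g"
proof -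
  interpret category C by fact
  have "W_cofinal C W P Q g"
    if f: "W_cofinal C W P Q f" and fg: "\<And>A x. A \<in> Obj C \<Longrightarrow> x \<in> El P A \<Longrightarrow> f A x = g A x" for f g
    unfolding W_cofinal_def
  proof (intro ballI impI)
    fix a x y
    assume a: "a \<in> Arr C" "x \<in> El P (Dom C a)" "y \<in> El Q (Cod C a)" "g (Dom C a) x = Res Q a y"
    then have "f (Dom C a) x = Res Q a y"
      using fg[OF dom_in_Obj] by simp
    then obtain w u v x' y' where w: "w \<in> W" and r: "u \<in> Hom C (Dom C a) (Dom C w)"
      "v \<in> Hom C (Cod C a) (Cod C w)" "x' \<in> El P (Dom C w)" "y' \<in> El Q (Cod C w)"
      "w \<cdot> u = v \<cdot> a" "Res P u x' = x" "Res Q v y' = y" "f (Dom C w) x' = Res Q w y'"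
      using f a unfolding W_cofinal_def by blast
    moreover have "f (Dom C w) x' = g (Dom C w) x'"
      using fg[OF dom_in_Obj] r assms(2) w by blast
    ultimately show "\<exists>w\<in>W. \<exists>u\<in>Hom C (Dom C a) (Dom C w). \<exists>v\<in>Hom C (Cod C a) (Cod C w).
        \<exists>x'\<in>El P (Dom C w). \<exists>y'\<in>El Q (Cod C w).
        w \<cdot> u = v \<cdot> a \<and> Res P u x' = x \<and> Res Q v y' = y \<and> g (Dom C w) x' = Res Q w y'"
      by metis
  qed
  from this[of f g] this[of g f] show ?thesis
    using assms(3) by metis
qed

section \<open>Levelwise weak equivalences\<close>

text \<open>The isomorphisms \<open>a\<close> and \<open>b\<close> turn \<open>x\<close> and
  \<open>y\<close> into maps to \<open>X'\<close> and \<open>Y'\<close>. At a late enough stage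
  \<open>s\<close> of the common index the square commutes strictly, and so it factors through the
  component \<open>\<tau> s\<close>, a weak equivalence.\<close>

lemma Lw_iso_imp_W_cofinal:
  assumes "category C" and W: "W \<subseteq> Arr C" and f: "((I, X), (J, Y), F) \<in> Lw_iso C W"
  shows "W_cofinal C W (ind_presheaf C (I, X)) (ind_presheaf C (J, Y)) (ind_act C (J, Y) F)"
proof -
  interpret category C by fact
  obtain K X' Y' \<tau> a b where K: "filtered_category K" "is_functor K C X'" "is_functor K C Y'"
    and \<tau>: "is_natural K C X' Y' \<tau>" "\<And>s. s \<in> Obj K \<Longrightarrow> \<tau> s \<in> W"
    and a: "is_iso (Ind C) a" "a \<in> Hom (Ind C) (I, X) (K, X')"
    and b: "is_iso (Ind C) b" "b \<in> Hom (Ind C) (J, Y) (K, Y')"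
    and eq: "Comp (Ind C) b ((I, X), (J, Y), F) = Comp (Ind C) (levelwise C K X' Y' \<tau>) a"
    using f unfolding Lw_iso_def by (simp del: split_paired_Ex) blast
  obtain \<alpha> where \<alpha>: "a = ((I, X), (K, X'), \<alpha>)"
    using a(2) by (cases a) (auto simp: Hom_def)
  obtain \<beta> where \<beta>: "b = ((J, Y), (K, Y'), \<beta>)"
    using b(2) by (cases b) (auto simp: Hom_def)
  let ?\<tau> = "snd (snd (levelwise C K X' Y' \<tau>))"
  have F: "ind_arrow C I X J Y F"
    using f by (simp add: Lw_iso_def Arr_Ind_iff[OF \<open>category C\<close>])
  obtain \<alpha>' where \<alpha>A: "ind_arrow C I X K X' \<alpha>" "ind_arrow C K X' I X \<alpha>'"
    and \<alpha>'\<alpha>: "\<And>A c. c \<in> El (ind_presheaf C (I, X)) A \<Longrightarrow>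
      ind_act C (I, X) \<alpha>' A (ind_act C (K, X') \<alpha> A c) = c"
    and \<alpha>\<alpha>': "\<And>A c. c \<in> El (ind_presheaf C (K, X')) A \<Longrightarrow>
      ind_act C (K, X') \<alpha> A (ind_act C (I, X) \<alpha>' A c) = c"
    using ind_isoE[OF \<open>category C\<close> a(1)[unfolded \<alpha>]] by metis
  obtain \<beta>' where \<beta>A: "ind_arrow C J Y K Y' \<beta>" "ind_arrow C K Y' J Y \<beta>'"
    and \<beta>'\<beta>: "\<And>A c. c \<in> El (ind_presheaf C (J, Y)) A \<Longrightarrow>
      ind_act C (J, Y) \<beta>' A (ind_act C (K, Y') \<beta> A c) = c"
    and \<beta>\<beta>': "\<And>A c. c \<in> El (ind_presheaf C (K, Y')) A \<Longrightarrow>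
      ind_act C (K, Y') \<beta> A (ind_act C (J, Y) \<beta>' A c) = c"
    using ind_isoE[OF \<open>category C\<close> b(1)[unfolded \<beta>]] by metis
  interpret F: ind_arrow C I X J Y F by fact
  interpret \<alpha>: ind_arrow C I X K X' \<alpha> by fact
  interpret \<beta>: ind_arrow C J Y K Y' \<beta> by fact
  interpret \<alpha>': ind_arrow C K X' I X \<alpha>' by fact
  interpret \<beta>': ind_arrow C K Y' J Y \<beta>' by fact
  have XY': "ind_object C K X'" "ind_object C K Y'"
    by unfold_locales
  interpret \<tau>: ind_arrow C K X' K Y' ?\<tau>
    by (rule ind_arrow_levelwise[OF XY' \<tau>(1)])
  note \<tau>_cls = ind_act_levelwise[OF XY' \<tau>(1)]
  have "ind_comp C (I, X) (K, Y') \<beta> F = ind_comp C (I, X) (K, Y') ?\<tau> \<alpha>"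
    using eq unfolding \<alpha> \<beta> Comp_Ind by (subst (asm) levelwise_eq, unfold Comp_Ind) simp
  then have sq: "\<beta>.act A (F.act A c) = \<tau>.act A (\<alpha>.act A c)" if "c \<in> El F.X.hom_to A" for A c
    using ind_act_comp[OF F \<beta>A(1) that] ind_act_comp[OF \<alpha>A(1) \<tau>.ind_arrow_axioms that] by simp
  show ?thesis
    unfolding W_cofinal_def
  proof (intro ballI impI)
    fix a x y
    assume a [simp]: "a \<in> Arr C" and x: "x \<in> El F.X.hom_to (Dom C a)"
      and y: "y \<in> El F.Y.hom_to (Cod C a)" and xy: "F.act (Dom C a) x = Res F.Y.hom_to a y"
    let ?A = "Dom C a" and ?B = "Cod C a"
    have [simp]: "?A \<in> Obj C" "?B \<in> Obj C"
      by (simp_all add: dom_in_Obj cod_in_Obj)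
    obtain s0 \<phi>0 where \<phi>0: "\<alpha>.Y.germ ?A s0 \<phi>0" "\<alpha>.act ?A x = \<alpha>.Y.cls ?A s0 \<phi>0"
      by (rule \<alpha>.Y.ElE[OF \<alpha>.map_in[OF _ x]]) auto
    obtain s1 \<psi>0 where \<psi>0: "\<beta>.Y.germ ?B s1 \<psi>0" "\<beta>.act ?B y = \<beta>.Y.cls ?B s1 \<psi>0"
      by (rule \<beta>.Y.ElE[OF \<beta>.map_in[OF _ y]]) auto
    note [simp] = \<alpha>.Y.germD[OF \<phi>0(1)] \<beta>.Y.germD[OF \<psi>0(1)]
    have \<tau>' [simp]: "\<tau> s \<in> Arr C" "Dom C (\<tau> s) = FObj X' s" "Cod C (\<tau> s) = FObj Y' s"
      if "s \<in> Obj K" for s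
      using \<tau>(1) that by (auto simp: is_natural_def Hom_iff)
    have "\<beta>.Y.cls ?A s0 (\<tau> s0 \<cdot> \<phi>0) = \<beta>.act ?A (F.act ?A x)"
      using sq[OF x] \<tau>_cls[OF \<phi>0(1)] \<phi>0(2) by simp
    also have "\<dots> = \<beta>.Y.cls ?A s1 (\<psi>0 \<cdot> a)"
      using xy \<beta>.natural[of a y] y \<psi>0(2) \<beta>.Y.Res_cls[OF \<psi>0(1), of a ?A] by simp
    \<comment> \<open>Two equal maps into the ind-object \<open>Y'\<close> agree strictly at the
      common target of \<open>u0\<close> and \<open>u1\<close>, which becomes the stage
      \<open>s\<close>.\<close>
    finally obtain u0 u1 where [simp]: "u0 \<in> Arr K" "u1 \<in> Arr K" "Dom K u0 = s0" "Dom K u1 = s1"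
        "Cod K u1 = Cod K u0"
      and u01: "FArr Y' u0 \<cdot> \<tau> s0 \<cdot> \<phi>0 = FArr Y' u1 \<cdot> \<psi>0 \<cdot> a"
      by (rule \<beta>.Y.cls_eqE) (simp add: \<beta>.Y.germ_def)
    define s where "s = Cod K u0"
    have s [simp]: "s \<in> Obj K"
      by (simp add: s_def \<alpha>.Y.J.cod_in_Obj)
    define \<phi> where "\<phi> = FArr X' u0 \<cdot> \<phi>0"
    define \<psi> where "\<psi> = FArr Y' u1 \<cdot> \<psi>0"
    have \<phi>: "\<alpha>.Y.germ ?A s \<phi>" "\<alpha>.act ?A x = \<alpha>.Y.cls ?A s \<phi>"
      using \<alpha>.Y.germ_shift[OF \<phi>0(1), of u0] \<alpha>.Y.cls_shift[OF \<phi>0(1), of u0] \<phi>0(2)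
      by (simp_all add: s_def \<phi>_def)
    have \<psi>: "\<beta>.Y.germ ?B s \<psi>" "\<beta>.act ?B y = \<beta>.Y.cls ?B s \<psi>"
      using \<beta>.Y.germ_shift[OF \<psi>0(1), of u1] \<beta>.Y.cls_shift[OF \<psi>0(1), of u1] \<psi>0(2)
      by (simp_all add: s_def \<psi>_def)
    note [simp] = \<alpha>.Y.germD[OF \<phi>(1)] \<beta>.Y.germD[OF \<psi>(1)]
    have nat: "\<tau> s \<cdot> FArr X' u0 = FArr Y' u0 \<cdot> \<tau> s0"
      using \<tau>(1) unfolding is_natural_def s_def
      by (metis \<open>Dom K u0 = s0\<close> \<open>u0 \<in> Arr K\<close>)
    have "\<tau> s \<cdot> \<phi> = \<psi> \<cdot> a"
    proof -
      have "\<tau> s \<cdot> \<phi> = (\<tau> s \<cdot> FArr X' u0) \<cdot> \<phi>0"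
        unfolding \<phi>_def by (subst assoc) (simp_all add: s_def \<alpha>.Y.J.cod_in_Obj)
      also have "\<dots> = \<psi> \<cdot> a"
        unfolding nat \<psi>_def using u01 by (simp add: assoc)
      finally show ?thesis .
    qed
    \<comment> \<open>The elements over \<open>\<tau> s\<close> are the identity classes at stage
      \<open>s\<close>, moved back by the inverse isomorphisms.\<close>
    define x' where "x' = \<alpha>'.act (FObj X' s) (\<alpha>.Y.cls (FObj X' s) s (Id C (FObj X' s)))"
    define y' where "y' = \<beta>'.act (FObj Y' s) (\<beta>.Y.cls (FObj Y' s) s (Id C (FObj Y' s)))"
    have id: "\<alpha>.Y.germ (FObj X' s) s (Id C (FObj X' s))" "\<beta>.Y.germ (FObj Y' s) s (Id C (FObj Y' s))"
      by (simp_all add: \<alpha>.Y.germ_Id \<beta>.Y.germ_Id)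
    have x' [simp]: "x' \<in> El F.X.hom_to (FObj X' s)" and y' [simp]: "y' \<in> El F.Y.hom_to (FObj Y' s)"
      using \<alpha>.Y.cls_El[OF id(1)] \<beta>.Y.cls_El[OF id(2)] by (simp_all add: x'_def y'_def)
    have \<alpha>x': "\<alpha>.act (FObj X' s) x' = \<alpha>.Y.cls (FObj X' s) s (Id C (FObj X' s))"
      and \<beta>y': "\<beta>.act (FObj Y' s) y' = \<beta>.Y.cls (FObj Y' s) s (Id C (FObj Y' s))"
      using \<alpha>\<alpha>'[OF \<alpha>.Y.cls_El[OF id(1)]] \<beta>\<beta>'[OF \<beta>.Y.cls_El[OF id(2)]] by (simp_all add: x'_def y'_def)
    have \<alpha>_inj: "c = d" if "c \<in> El F.X.hom_to A" "d \<in> El F.X.hom_to A" "\<alpha>.act A c = \<alpha>.act A d" for A c d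
      by (metis \<alpha>'\<alpha>[OF that(1)] \<alpha>'\<alpha>[OF that(2)] that(3))
    have \<beta>_inj: "c = d" if "c \<in> El F.Y.hom_to A" "d \<in> El F.Y.hom_to A" "\<beta>.act A c = \<beta>.act A d" for A c d
      by (metis \<beta>'\<beta>[OF that(1)] \<beta>'\<beta>[OF that(2)] that(3))
    have "Res F.X.hom_to \<phi> x' = x"
    proof (rule \<alpha>_inj)
      show "\<alpha>.act ?A (Res F.X.hom_to \<phi> x') = \<alpha>.act ?A x"
        using \<alpha>.natural'[of \<phi> ?A "FObj X' s" x'] \<alpha>.Y.Res_cls[OF id(1), of \<phi> ?A] by (simp add: \<alpha>x' \<phi>(2))
    qed (use x in auto)
    moreover have "Res F.Y.hom_to \<psi> y' = y"
    proof (rule \<beta>_inj)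
      show "\<beta>.act ?B (Res F.Y.hom_to \<psi> y') = \<beta>.act ?B y"
        using \<beta>.natural'[of \<psi> ?B "FObj Y' s" y'] \<beta>.Y.Res_cls[OF id(2), of \<psi> ?B] by (simp add: \<beta>y' \<psi>(2))
    qed (use y in auto)
    moreover have "F.act (FObj X' s) x' = Res F.Y.hom_to (\<tau> s) y'"
    proof (rule \<beta>_inj)
      show "\<beta>.act (FObj X' s) (F.act (FObj X' s) x') = \<beta>.act (FObj X' s) (Res F.Y.hom_to (\<tau> s) y')"
        using \<beta>.natural'[of "\<tau> s" "FObj X' s" "FObj Y' s" y'] \<beta>.Y.Res_cls[OF id(2), of "\<tau> s" "FObj X' s"]
          \<tau>_cls[OF id(1)] by (simp add: sq[OF x'] \<alpha>x' \<beta>y')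
    qed auto
    ultimately show "\<exists>w\<in>W. \<exists>u\<in>Hom C (Dom C a) (Dom C w). \<exists>v\<in>Hom C (Cod C a) (Cod C w).
      \<exists>x'\<in>El F.X.hom_to (Dom C w). \<exists>y'\<in>El F.Y.hom_to (Cod C w).
        w \<cdot> u = v \<cdot> a \<and> Res F.X.hom_to u x' = x \<and> Res F.Y.hom_to v y' = y \<and>
        F.act (Dom C w) x' = Res F.Y.hom_to w y'"
      using \<tau>(2)[OF s] \<open>\<tau> s \<cdot> \<phi> = \<psi> \<cdot> a\<close>
      by (intro bexI[of _ "\<tau> s"] bexI[of _ \<phi>] bexI[of _ \<psi>] bexI[of _ x'] bexI[of _ y'])
        (simp_all add: Hom_iff)
  qed
qed


type_synonym ('i, 'a) over_obj = "'a \<times> ('i \<times> 'a) set \<times> ('i \<times> 'a) set"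

text \<open>The weak equivalences that are the objects of \<open>K\<close> become the components of
  the levelwise morphism. Their elements over \<open>X\<close> and \<open>Y\<close> form the cocones
  \<open>\<xi>\<close> and \<open>\<eta>\<close>, which \<open>bij_act_cocone\<close> and
  \<open>ind_inverse\<close> show to be isomorphisms.\<close>

lemma (in cofinal_ind_arrow) Lw_iso:
  assumes "infinite (UNIV :: 'i set)" "small_category TYPE('i) C"
  shows "((I, X), (J, Y), F) \<in> Lw_iso C W"
proof -
  have C: "Arr C \<lesssim> (UNIV :: 'i set)"
    using assms(2) by (simp add: small_category_def)
  note times = times_lepoll_UNIV[OF assms(1)]
  \<comment> \<open>A class of maps is a subset of \<open>'i \<times> 'a\<close>, so classes could
    be too numerous to count. Each is determined by a chosen representative and its source, and in
    an object of \<open>K\<close> the source is read off from \<open>w\<close>.\<close>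
  let ?rep = "\<lambda>c :: ('i \<times> 'a) set. SOME p. p \<in> c"
  let ?g = "\<lambda>(w :: 'a, x, y). (w, ?rep x, ?rep y)"
  have "inj_on ?g (Obj K)"
  proof (rule inj_onI)
    fix p q assume p: "p \<in> Obj K" and q: "q \<in> Obj K" and eq: "?g p = ?g q"
    obtain w x y w' x' y' where pq: "p = (w, x, y)" "q = (w', x', y')"
      by (metis surj_pair)
    have w: "w = w'" and r: "?rep x = ?rep x'" "?rep y = ?rep y'"
      using eq by (simp_all add: pq)
    have "x = colim_class C (Dom C w) (I, X) (?rep x)"
      "x' = colim_class C (Dom C w) (I, X) (?rep x')"
      "y = colim_class C (Cod C w) (J, Y) (?rep y)"
      "y' = colim_class C (Cod C w) (J, Y) (?rep y')"
      using p q unfolding pq W_over_Obj w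
      by (simp_all add: X.some_representative(2) Y.some_representative(2))
    then show "p = q"
      using w r by (simp add: pq)
  qed
  moreover have "?g ` Obj K \<subseteq> Arr C \<times> (UNIV \<times> Arr C) \<times> (UNIV \<times> Arr C)"
  proof (rule image_subsetI)
    fix p assume p: "p \<in> Obj K"
    obtain w x y where "p = (w, x, y)"
      by (metis surj_pair)
    then show "?g p \<in> Arr C \<times> (UNIV \<times> Arr C) \<times> (UNIV \<times> Arr C)"
      using p X.some_representative(1)[of x] Y.some_representative(1)[of y] W_Arr
      by (auto simp: W_over_Obj mem_Times_iff simp del: split_paired_All)
  qed
  ultimately have "Obj K \<lesssim> Arr C \<times> ((UNIV :: 'i set) \<times> Arr C) \<times> ((UNIV :: 'i set) \<times> Arr C)"
    unfolding lepoll_def by blast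
  also have "\<dots> \<lesssim> (UNIV :: 'i set)"
    by (intro times C lepoll_refl)
  finally have ObjK: "Obj K \<lesssim> (UNIV :: 'i set)" .
  have "Arr K \<lesssim> Obj K \<times> Obj K \<times> Arr C \<times> Arr C"
    by (rule subset_imp_lepoll) (auto simp: W_over_Arr)
  also have "\<dots> \<lesssim> (UNIV :: 'i set)"
    by (intro times C ObjK)
  finally have ArrK: "Arr K \<lesssim> (UNIV :: 'i set)" .
  obtain K' :: "('i, 'i) cat" and \<Phi> where K': "filtered_category K'" "is_functor K' K \<Phi>"
    and \<Phi>_Obj: "FObj \<Phi> ` Obj K' = Obj K"
    and \<Phi>_Hom: "\<forall>i\<in>Obj K'. \<forall>j\<in>Obj K'. FArr \<Phi> ` Hom K' i j = Hom K (FObj \<Phi> i) (FObj \<Phi> j)"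
    by (rule small_copy[OF filtered_K ObjK ArrK])
  define domF ::
    "(('i, 'a) over_obj, ('i, 'a) over_obj \<times> ('i, 'a) over_obj \<times> 'a \<times> 'a, 'o, 'a) func" where
    "domF = \<lparr>FObj = (\<lambda>p. Dom C (fst p)), FArr = (\<lambda>(p, q, u, v). u)\<rparr>"
  define codF ::
    "(('i, 'a) over_obj, ('i, 'a) over_obj \<times> ('i, 'a) over_obj \<times> 'a \<times> 'a, 'o, 'a) func" where
    "codF = \<lparr>FObj = (\<lambda>p. Cod C (fst p)), FArr = (\<lambda>(p, q, u, v). v)\<rparr>"
  have Obj_W: "fst p \<in> Arr C" if "p \<in> Obj K" for p
    using that W_Arr by (cases p) (auto simp: W_over_Obj)
  have "is_functor K C domF" "is_functor K C codF"
    using Obj_W unfolding is_functor_def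
    by (auto simp: domF_def codF_def W_over_Arr Hom_iff dom_in_Obj cod_in_Obj)
  define X' where "X' = func_comp domF \<Phi>"
  define Y' where "Y' = func_comp codF \<Phi>"
  have X'_functor: "is_functor K' C X'" and Y'_functor: "is_functor K' C Y'"
    unfolding X'_def Y'_def by (rule is_functor_comp[OF K'(2)]; fact)+
  have X': "ind_object C K' X'" and Y': "ind_object C K' Y'"
    using K'(1) X'_functor Y'_functor by unfold_locales
  interpret X': ind_object C K' X' by (rule X')
  interpret Y': ind_object C K' Y' by (rule Y')
  define \<tau> where "\<tau> k = fst (FObj \<Phi> k)" for k
  define \<xi> where "\<xi> = (\<lambda>k\<in>Obj K'. fst (snd (FObj \<Phi> k)))"
  define \<eta> where "\<eta> = (\<lambda>k\<in>Obj K'. snd (snd (FObj \<Phi> k)))"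
  have \<Phi>: "(\<tau> k, \<xi> k, \<eta> k) \<in> Obj K" "FObj \<Phi> k = (\<tau> k, \<xi> k, \<eta> k)" "FObj X' k = Dom C (\<tau> k)"
    "FObj Y' k = Cod C (\<tau> k)" "\<tau> k \<in> W" "\<tau> k \<in> Arr C" "\<xi> k \<in> El X.hom_to (FObj X' k)"
    "\<eta> k \<in> El Y.hom_to (FObj Y' k)" "act (FObj X' k) (\<xi> k) = Res Y.hom_to (\<tau> k) (\<eta> k)"
    if "k \<in> Obj K'" for k
  proof -
    show eq: "FObj \<Phi> k = (\<tau> k, \<xi> k, \<eta> k)"
      using that by (simp add: \<tau>_def \<xi>_def \<eta>_def)
    have "FObj \<Phi> k \<in> Obj K"
      using that \<Phi>_Obj by blast
    then show "(\<tau> k, \<xi> k, \<eta> k) \<in> Obj K"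
      by (simp add: eq)
    moreover show "FObj X' k = Dom C (\<tau> k)" "FObj Y' k = Cod C (\<tau> k)"
      by (simp_all add: X'_def Y'_def func_comp_def domF_def codF_def \<tau>_def)
    ultimately show "\<tau> k \<in> W" "\<tau> k \<in> Arr C" "\<xi> k \<in> El X.hom_to (FObj X' k)"
      "\<eta> k \<in> El Y.hom_to (FObj Y' k)" "act (FObj X' k) (\<xi> k) = Res Y.hom_to (\<tau> k) (\<eta> k)"
      using W_Arr by (auto simp: W_over_Obj)
  qed
  have \<Phi>_Arr: "\<tau> (Cod K' e) \<cdot> FArr X' e = FArr Y' e \<cdot> \<tau> (Dom K' e)"
    "Res X.hom_to (FArr X' e) (\<xi> (Cod K' e)) = \<xi> (Dom K' e)"
    "Res Y.hom_to (FArr Y' e) (\<eta> (Cod K' e)) = \<eta> (Dom K' e)" if "e \<in> Arr K'" for e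
  proof -
    have ob: "Dom K' e \<in> Obj K'" "Cod K' e \<in> Obj K'"
      using that X'.J.dom_in_Obj X'.J.cod_in_Obj by auto
    have "FArr \<Phi> e \<in> Hom K (FObj \<Phi> (Dom K' e)) (FObj \<Phi> (Cod K' e))"
      using K'(2) that by (simp add: is_functor_def)
    then obtain w x y w' x' y' u v where r: "FObj \<Phi> (Dom K' e) = (w, x, y)"
      "FObj \<Phi> (Cod K' e) = (w', x', y')" "FArr \<Phi> e = ((w, x, y), (w', x', y'), u, v)"
      "((w, x, y), (w', x', y'), u, v) \<in> Arr K"
      by (rule W_over_HomE)
    then show "\<tau> (Cod K' e) \<cdot> FArr X' e = FArr Y' e \<cdot> \<tau> (Dom K' e)"
      "Res X.hom_to (FArr X' e) (\<xi> (Cod K' e)) = \<xi> (Dom K' e)"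
      "Res Y.hom_to (FArr Y' e) (\<eta> (Cod K' e)) = \<eta> (Dom K' e)"
      using ob by (auto simp: W_over_Arr X'_def Y'_def func_comp_def domF_def codF_def \<tau>_def \<xi>_def \<eta>_def)
  qed
  \<comment> \<open>Sources and targets are treated together by one arrow of \<open>K\<close>;
    fullness of \<open>\<Phi>\<close> brings it back to \<open>K'\<close>.\<close>
  have eq: "\<exists>e\<in>Arr K'. Dom K' e = k \<and> FArr X' e \<cdot> \<phi>1 = FArr X' e \<cdot> \<phi>2 \<and>
      FArr Y' e \<cdot> \<psi>1 = FArr Y' e \<cdot> \<psi>2"
    if k: "k \<in> Obj K'" and \<phi>: "\<phi>1 \<in> Hom C A (FObj X' k)" "\<phi>2 \<in> Hom C A (FObj X' k)"
      "Res X.hom_to \<phi>1 (\<xi> k) = Res X.hom_to \<phi>2 (\<xi> k)"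
      and \<psi>: "\<psi>1 \<in> Hom C B (FObj Y' k)" "\<psi>2 \<in> Hom C B (FObj Y' k)"
      "Res Y.hom_to \<psi>1 (\<eta> k) = Res Y.hom_to \<psi>2 (\<eta> k)" for k A B \<phi>1 \<phi>2 \<psi>1 \<psi>2
  proof -
    have \<phi>': "\<phi>1 \<in> Arr C" "\<phi>2 \<in> Arr C" "Dom C \<phi>1 = A" "Dom C \<phi>2 = A"
      "Cod C \<phi>1 = Dom C (\<tau> k)" "Cod C \<phi>2 = Dom C (\<tau> k)"
      and \<psi>': "\<psi>1 \<in> Arr C" "\<psi>2 \<in> Arr C" "Dom C \<psi>1 = B" "Dom C \<psi>2 = B"
      "Cod C \<psi>1 = Cod C (\<tau> k)" "Cod C \<psi>2 = Cod C (\<tau> k)"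
      using \<phi>(1,2) \<psi>(1,2) \<Phi>(3,4)[OF k] by (simp_all add: Hom_iff)
    obtain q u v where q: "q \<in> Obj K" "((\<tau> k, \<xi> k, \<eta> k), q, u, v) \<in> Arr K"
      and uv: "u \<cdot> \<phi>1 = u \<cdot> \<phi>2" "v \<cdot> \<psi>1 = v \<cdot> \<psi>2"
      by (rule over_equalize[OF \<Phi>(1)[OF k] \<phi>' \<phi>(3) \<psi>' \<psi>(3)])
    obtain j where j: "j \<in> Obj K'" "FObj \<Phi> j = q"
      using q(1) \<Phi>_Obj by (metis imageE)
    have "((\<tau> k, \<xi> k, \<eta> k), q, u, v) \<in> FArr \<Phi> ` Hom K' k j"
      unfolding \<Phi>_Hom[rule_format, OF k j(1)] using q(2) by (simp add: K.Hom_iff j(2) \<Phi>(2)[OF k])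
    then obtain e where e: "e \<in> Hom K' k j" "FArr \<Phi> e = ((\<tau> k, \<xi> k, \<eta> k), q, u, v)"
      by auto
    then have "FArr X' e = u" "FArr Y' e = v"
      by (simp_all add: X'_def Y'_def func_comp_def domF_def codF_def)
    then show ?thesis
      using e(1) uv by (auto simp: X'.J.Hom_iff)
  qed
  have cover_X: "\<exists>k\<in>Obj K'. \<exists>\<phi>\<in>Hom C (FObj X s) (FObj X' k).
      Res X.hom_to \<phi> (\<xi> k) = X.cls (FObj X s) s (Id C (FObj X s))" if s: "s \<in> Obj I" for s
  proof -
    obtain w x y u where o: "(w, x, y) \<in> Obj K" "u \<in> Hom C (FObj X s) (Dom C w)"
      "Res X.hom_to u x = X.cls (FObj X s) s (Id C (FObj X s))"
      by (rule over_stage_dom[OF s])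
    then obtain k where "k \<in> Obj K'" "FObj \<Phi> k = (w, x, y)"
      using \<Phi>_Obj by (metis imageE)
    then show ?thesis
      using o \<Phi>(2,3)[of k] by (intro bexI[of _ k], intro bexI[of _ u]) auto
  qed
  have cover_Y: "\<exists>k\<in>Obj K'. \<exists>\<psi>\<in>Hom C (FObj Y t) (FObj Y' k).
      Res Y.hom_to \<psi> (\<eta> k) = Y.cls (FObj Y t) t (Id C (FObj Y t))" if t: "t \<in> Obj J" for t
  proof -
    obtain w x y v where o: "(w, x, y) \<in> Obj K" "v \<in> Hom C (FObj Y t) (Cod C w)"
      "Res Y.hom_to v y = Y.cls (FObj Y t) t (Id C (FObj Y t))"
      by (rule over_stage_cod[OF t])
    then obtain k where "k \<in> Obj K'" "FObj \<Phi> k = (w, x, y)"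
      using \<Phi>_Obj by (metis imageE)
    then show ?thesis
      using o \<Phi>(2,4)[of k] by (intro bexI[of _ k], intro bexI[of _ v]) auto
  qed
  have id: "Id C (FObj X' k) \<in> Hom C (FObj X' k) (FObj X' k)"
    "Id C (FObj Y' k) \<in> Hom C (FObj Y' k) (FObj Y' k)" if "k \<in> Obj K'" for k
    using that by (simp_all add: Id_in_Hom)
  \<comment> \<open>For one diagram alone the pair on the other side is the identity taken
    twice.\<close>
  have sep_X: "\<exists>e\<in>Arr K'. Dom K' e = k \<and> FArr X' e \<cdot> \<phi>1 = FArr X' e \<cdot> \<phi>2"
    if "k \<in> Obj K'" "\<phi>1 \<in> Hom C A (FObj X' k)" "\<phi>2 \<in> Hom C A (FObj X' k)"
      "Res X.hom_to \<phi>1 (\<xi> k) = Res X.hom_to \<phi>2 (\<xi> k)" for k A \<phi>1 \<phi>2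
    using eq[OF that id(2)[OF that(1)] id(2)[OF that(1)] refl] by blast
  have sep_Y: "\<exists>e\<in>Arr K'. Dom K' e = k \<and> FArr Y' e \<cdot> \<psi>1 = FArr Y' e \<cdot> \<psi>2"
    if "k \<in> Obj K'" "\<psi>1 \<in> Hom C A (FObj Y' k)" "\<psi>2 \<in> Hom C A (FObj Y' k)"
      "Res Y.hom_to \<psi>1 (\<eta> k) = Res Y.hom_to \<psi>2 (\<eta> k)" for k A \<psi>1 \<psi>2
    using eq[OF that(1) id(1)[OF that(1)] id(1)[OF that(1)] refl that(2-4)] by blast
  have X: "ind_object C I X" and Y: "ind_object C J Y"
    by unfold_locales
  have ext: "\<xi> \<in> extensional (Obj K')" "\<eta> \<in> extensional (Obj K')"
    by (simp_all add: \<xi>_def \<eta>_def)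
  have \<xi>: "ind_arrow C K' X' I X \<xi>"
    by (rule ind_arrow_cocone[OF X' X ext(1)];
        rule \<Phi>(7) \<Phi>_Arr(2) cover_X sep_X; assumption)
  have \<xi>_bij: "bij_betw (ind_act C (I, X) \<xi> A) (El (ind_presheaf C (K', X')) A)
      (El (ind_presheaf C (I, X)) A)" if "A \<in> Obj C" for A
    by (rule bij_act_cocone[OF X' X ext(1) _ _ _ _ that];
        rule \<Phi>(7) \<Phi>_Arr(2) cover_X sep_X; assumption)
  have \<eta>: "ind_arrow C K' Y' J Y \<eta>"
    by (rule ind_arrow_cocone[OF Y' Y ext(2)];
        rule \<Phi>(8) \<Phi>_Arr(3) cover_Y sep_Y; assumption)
  have \<eta>_bij: "bij_betw (ind_act C (J, Y) \<eta> A) (El (ind_presheaf C (K', Y')) A)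
      (El (ind_presheaf C (J, Y)) A)" if "A \<in> Obj C" for A
    by (rule bij_act_cocone[OF Y' Y ext(2) _ _ _ _ that];
        rule \<Phi>(8) \<Phi>_Arr(3) cover_Y sep_Y; assumption)
  interpret \<xi>: ind_arrow C K' X' I X \<xi> by (rule \<xi>)
  interpret \<eta>: ind_arrow C K' Y' J Y \<eta> by (rule \<eta>)
  obtain \<alpha> where \<alpha>: "ind_arrow C I X K' X' \<alpha>"
    and \<alpha>\<xi>: "\<And>A c. A \<in> Obj C \<Longrightarrow> c \<in> El X'.hom_to A \<Longrightarrow> ind_act C (K', X') \<alpha> A (\<xi>.act A c) = c"
    and \<xi>\<alpha>: "\<And>A c. A \<in> Obj C \<Longrightarrow> c \<in> El X.hom_to A \<Longrightarrow> \<xi>.act A (ind_act C (K', X') \<alpha> A c) = c"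
    using ind_inverse[OF \<xi> \<xi>_bij] by blast
  obtain \<beta> where \<beta>: "ind_arrow C J Y K' Y' \<beta>"
    and \<beta>\<eta>: "\<And>A c. A \<in> Obj C \<Longrightarrow> c \<in> El Y'.hom_to A \<Longrightarrow> ind_act C (K', Y') \<beta> A (\<eta>.act A c) = c"
    and \<eta>\<beta>: "\<And>A c. A \<in> Obj C \<Longrightarrow> c \<in> El Y.hom_to A \<Longrightarrow> \<eta>.act A (ind_act C (K', Y') \<beta> A c) = c"
    using ind_inverse[OF \<eta> \<eta>_bij] by blast
  interpret \<alpha>: ind_arrow C I X K' X' \<alpha> by (rule \<alpha>)
  interpret \<beta>: ind_arrow C J Y K' Y' \<beta> by (rule \<beta>)
  have \<tau>: "is_natural K' C X' Y' \<tau>"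
    using \<Phi>(3,4,6) \<Phi>_Arr(1) by (simp add: is_natural_def Hom_iff)
  let ?\<tau> = "snd (snd (levelwise C K' X' Y' \<tau>))"
  interpret \<tau>: ind_arrow C K' X' K' Y' ?\<tau>
    by (rule ind_arrow_levelwise[OF X' Y' \<tau>])
  have F: "ind_arrow C I X J Y F"
    by unfold_locales
  \<comment> \<open>The square of cocones commutes because every object of \<open>K\<close> lies
    over \<open>F\<close>; composing with the inverses \<open>\<alpha>\<close> and
    \<open>\<beta>\<close> gives the square that \<open>Lw_iso\<close> asks for.\<close>
  have F\<xi>: "act A (\<xi>.act A c) = \<eta>.act A (\<tau>.act A c)" if cA: "c \<in> El X'.hom_to A" for A c
  proof -
    obtain k \<phi> where \<phi>: "X'.germ A k \<phi>" and c: "c = X'.cls A k \<phi>"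
      using cA by (rule X'.ElE)
    note k = X'.germD(1)[OF \<phi>]
    have g: "Y'.germ A k (\<tau> k \<cdot> \<phi>)"
      using \<Phi>[OF k] X'.germD[OF \<phi>] by (simp add: Y'.germ_def)
    have "act A (\<xi>.act A c) = Res Y.hom_to \<phi> (Res Y.hom_to (\<tau> k) (\<eta> k))"
      using natural'[of \<phi> A "FObj X' k" "\<xi> k"] \<Phi>[OF k] X'.germD[OF \<phi>] by (simp add: c \<xi>.act_cls[OF \<phi>])
    also have "\<dots> = Res Y.hom_to (\<tau> k \<cdot> \<phi>) (\<eta> k)"
      using Y.hom_to.Res_Comp[of \<phi> "\<tau> k" "\<eta> k"] \<Phi>[OF k] X'.germD[OF \<phi>] by simp
    also have "\<dots> = \<eta>.act A (\<tau>.act A c)"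
      by (simp add: c ind_act_levelwise[OF X' Y' \<tau> \<phi>] \<eta>.act_cls[OF g])
    finally show ?thesis .
  qed
  have "ind_comp C (I, X) (K', Y') \<beta> F = ind_comp C (I, X) (K', Y') ?\<tau> \<alpha>"
  proof (rule ind_arrow_eqI[OF ind_arrow_comp[OF F \<beta>] ind_arrow_comp[OF \<alpha> \<tau>.ind_arrow_axioms]])
    fix A c assume A: "A \<in> Obj C" and c: "c \<in> El X.hom_to A"
    have "\<beta>.act A (act A c) = \<tau>.act A (\<alpha>.act A c)"
      using F\<xi>[OF \<alpha>.map_in[OF A c]] \<xi>\<alpha>[OF A c] \<beta>\<eta>[OF A \<tau>.map_in[OF A \<alpha>.map_in[OF A c]]] by simp
    then show "ind_act C (K', Y') (ind_comp C (I, X) (K', Y') \<beta> F) A c =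
        ind_act C (K', Y') (ind_comp C (I, X) (K', Y') ?\<tau> \<alpha>) A c"
      by (simp add: ind_act_comp[OF F \<beta> c] ind_act_comp[OF \<alpha> \<tau>.ind_arrow_axioms c])
  qed
  then have "Comp (Ind C) ((J, Y), (K', Y'), \<beta>) ((I, X), (J, Y), F) =
      Comp (Ind C) (levelwise C K' X' Y' \<tau>) ((I, X), (K', X'), \<alpha>)"
    by (subst levelwise_eq) (simp add: Comp_Ind)
  moreover have "is_iso (Ind C) ((I, X), (K', X'), \<alpha>)" "is_iso (Ind C) ((J, Y), (K', Y'), \<beta>)"
    using ind_isoI[OF \<alpha> \<xi> \<xi>\<alpha> \<alpha>\<xi>] ind_isoI[OF \<beta> \<eta> \<eta>\<beta> \<beta>\<eta>] by simp_all
  moreover have "((I, X), (K', X'), \<alpha>) \<in> Hom (Ind C) (I, X) (K', X')"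
    "((J, Y), (K', Y'), \<beta>) \<in> Hom (Ind C) (J, Y) (K', Y')" "((I, X), (J, Y), F) \<in> Arr (Ind C)"
    using \<alpha> \<beta> F by (simp_all add: Hom_def Arr_Ind_iff[OF category_axioms])
  ultimately show ?thesis
    unfolding Lw_iso_def using K'(1) X'_functor Y'_functor \<tau> \<Phi>(5)
    by (simp del: split_paired_Ex) blast
qed

section \<open>Two out of three in Ind(C)\<close>

theorem (in bifibrant_category) Lw_iso_two_out_of_three:
  assumes "infinite (UNIV :: 'i set)" "small_category TYPE('i) C"
  shows "two_out_of_three (Ind C :: (('i, 'o, 'a) diagram, ('i, 'o, 'a) ind_arr) cat) (Lw_iso C W)"
proof -
  note cat = category_axioms
  have W: "W \<subseteq> Arr C"
    using W_Arr by auto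
  have iff: "((I, X), (J, Y), F) \<in> Lw_iso C W \<longleftrightarrow>
      W_cofinal C W (ind_presheaf C (I, X)) (ind_presheaf C (J, Y)) (ind_act C (J, Y) F)"
    if "ind_arrow C I X J Y F" for I J :: "('i, 'i) cat" and X Y F
  proof
    assume "W_cofinal C W (ind_presheaf C (I, X)) (ind_presheaf C (J, Y)) (ind_act C (J, Y) F)"
    then interpret cofinal_ind_arrow C Cof W I X J Y F
      using that bifibrant_category_axioms
      by (simp add: cofinal_ind_arrow_def cofinal_ind_arrow_axioms_def)
    show "((I, X), (J, Y), F) \<in> Lw_iso C W"
      by (rule Lw_iso[OF assms])
  qed (rule Lw_iso_imp_W_cofinal[OF cat W])
  show ?thesis
    unfolding two_out_of_three_def
  proof (intro ballI impI)
    fix f g :: "('i, 'o, 'a) ind_arr"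
    assume f: "f \<in> Arr (Ind C)" and g: "g \<in> Arr (Ind C)" and fg: "Dom (Ind C) g = Cod (Ind C) f"
    obtain I X J Y F where f': "f = ((I, X), (J, Y), F)"
      by (metis surj_pair)
    then obtain L Z G where g': "g = ((J, Y), (L, Z), G)"
      using fg by (metis surj_pair Dom_Ind Cod_Ind)
    have F: "ind_arrow C I X J Y F" and G: "ind_arrow C J Y L Z G"
      using f g by (simp_all add: f' g' Arr_Ind_iff[OF cat])
    interpret F: ind_arrow C I X J Y F by fact
    interpret G: ind_arrow C J Y L Z G by fact
    \<comment> \<open>The action of the composite is exchanged for the composite of the actions, the
      form in which stability of cofinality is available.\<close>
    have "W_cofinal C W F.X.hom_to G.Y.hom_to (ind_act C (L, Z) (ind_comp C (I, X) (L, Z) G F)) \<longleftrightarrow>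
        W_cofinal C W F.X.hom_to G.Y.hom_to (\<lambda>A x. G.act A (F.act A x))"
      by (rule W_cofinal_cong[OF cat W]) (rule ind_act_comp[OF F G])
    then have GF: "Comp (Ind C) g f \<in> Lw_iso C W \<longleftrightarrow>
        W_cofinal C W F.X.hom_to G.Y.hom_to (\<lambda>A x. G.act A (F.act A x))"
      using iff[OF ind_arrow_comp[OF F G]] by (simp add: f' g' Comp_Ind)
    note maps = F.presheaf_map_axioms G.presheaf_map_axioms
    show "(f \<in> Lw_iso C W \<and> g \<in> Lw_iso C W \<longrightarrow> Comp (Ind C) g f \<in> Lw_iso C W) \<and>
      (f \<in> Lw_iso C W \<and> Comp (Ind C) g f \<in> Lw_iso C W \<longrightarrow> g \<in> Lw_iso C W) \<and>
      (g \<in> Lw_iso C W \<and> Comp (Ind C) g f \<in> Lw_iso C W \<longrightarrow> f \<in> Lw_iso C W)"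
      unfolding GF unfolding f' g' iff[OF F] iff[OF G]
      using W_cofinal_comp[OF maps] W_cofinal_cancel_first[OF maps(1) _ maps(2)]
        W_cofinal_cancel_second[OF maps] by blast
  qed
qed

theorem theorem1p2:
  fixes C :: "('o, 'a) cat" and Cof W :: "'a set"
    and T :: "('o, 'a) tensor"
    and \<alpha> :: "nat sset \<Rightarrow> nat sset \<Rightarrow> 'o \<Rightarrow> 'a" and \<upsilon> :: "'o \<Rightarrow> 'a"
  assumes "infinite (UNIV :: 'i set)"
    and "small_category TYPE('i) C"
    and "simplicial_weak_cofibration_category C Cof W T \<alpha> \<upsilon>"
    and "has_finite_limits C"
    and "\<forall>D\<in>Obj C. fibrant C Cof W D \<and> cofibrant C Cof D"
    and "\<forall>f\<in>Arr C. homotopy_equivalence C T \<upsilon> f \<longrightarrow> f \<in> W"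
  shows "ind_admissible TYPE('i) C W"
proof -
  interpret simplicial_weak_cofibration_category C Cof W T \<alpha> \<upsilon> by fact
  interpret bifibrant_category C Cof W
    using assms(5) by unfold_locales auto
  show ?thesis
    unfolding ind_admissible_def by (rule Lw_iso_two_out_of_three[OF assms(1,2)])
qed

end
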